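(* Let $X=\{x+x^{2}y+z^{2}+t^{3}=0\}\subset\mathbb{A}^4=\mathrm{Spec}(\mathbb{C}[x,y,z,t])$ be the Russell cubic, equipped with the $\mathbb{C}^*$-action induced by the linear action on $\mathbb{A}^4$ with weights $(6,-6,3,2)$ on $(x,y,z,t)$. Then the $\mathbb{C}^*$-variety $X$ is isomorphic to $\mathbb{S}(\tilde{\mathbb{A}}_{(u,v)}^{2},\mathcal{D})$ for $$\mathcal{D}=\left\{ \tfrac{1}{2}\right\} D_{3}+\left\{ -\tfrac{1}{3}\right\} D_{2}+\left[0,\tfrac{1}{6}\right]E,$$ where $E$ is the exceptional divisor of the blow-up $\pi:\tilde{\mathbb{A}}_{(u,v)}^{2}\rightarrow\mathbb{A}^{2}=\mathrm{Spec}(\mathbb{C}[u,v])$, and where $D_{2}$ and $D_{3}$ are the strict transforms of the curves $\{u=0\}$ and $\{u+v+v^{2}=0\}$ in $\mathbb{A}^{2}$ respectively.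
   Context: $\tilde{\mathbb{A}}^2_{(u,v)}$ is the blow-up of $\mathbb{A}^2=\mathrm{Spec}(\mathbb{C}[u,v])$ along the ideal $(u,v)$. For $\mathbb{T}=\mathbb{C}^*$ the character lattice and its dual are $M=N=\mathbb{Z}$. A polyhedral divisor with tail cone $\{0\}$ on a normal variety $Y$ is a finite formal sum $\mathcal{D}=\sum\Delta_i D_i$ (also written $\sum \Delta_i\otimes D_i$), with $D_i$ prime divisors and $\Delta_i=[a_i,b_i]\subset\mathbb{Q}$ closed bounded intervals with rational endpoints ($\{q\}$ denotes the single point interval $[q,q]$). For $n\in\mathbb{Z}$, $\mathcal{D}(n)=\sum\min_{v\in\Delta_i}(nv)\,D_i$, a Weil $\mathbb{Q}$-divisor, and $$\mathbb{S}(Y,\mathcal{D})=\mathrm{Spec}\Big(\bigoplus_{n\in\mathbb{Z}}\Gamma(Y,\mathcal{O}_Y(\mathcal{D}(n)))\Big)$$ with the $\mathbb{C}^*$-action given by the $\mathbb{Z}$-grading, where sections of $\mathcal{O}_Y(D)$ for a $\mathbb{Q}$-divisor $D$ are the sections of $\mathcal{O}_Y(\lfloor D\rfloor)$. For a $\mathbb{C}^*$-variety $X=\mathrm{Spec}(A)$ the grading is $A_n=\{f\in A\mid f(\lambda\cdot x)=\lambda^n f(x)\}$. *)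

theory Defs
  imports
    Complex_Main
    "HOL-Library.FuncSet"
    "HOL-Library.Poly_Mapping"
    "HOL-Computational_Algebra.Polynomial"
    "HOL-Computational_Algebra.Fraction_Field"
    "HOL-Algebra.QuotRing"
begin

section \<open>Affine varieties with an action of the multiplicative group\<close>

text \<open>
  A complex affine variety with an action of the multiplicative group is recorded by its closed
  points, its coordinate algebra (a ring together with the structure map \<open>cv_const\<close> from the
  complex numbers), the evaluation of an element of the coordinate algebra at a closed point, and
  the action of nonzero complex numbers on closed points.
\<close>

record ('p, 'r) cstar_variety =
  cv_points :: "'p set"
  cv_ring :: "'r ring"
  cv_const :: "complex \<Rightarrow> 'r"
  cv_eval :: "'r \<Rightarrow> 'p \<Rightarrow> complex"
  cv_act :: "complex \<Rightarrow> 'p \<Rightarrow> 'p"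

text \<open>
  An isomorphism is a bijection \<open>\<phi>\<close> on closed points with a comorphism \<open>\<psi>\<close>, an isomorphism of
  complex algebras in the opposite direction. Requiring \<open>\<psi>\<close> on the coordinate algebras
  themselves, and not only on the functions they induce on closed points, means that no
  information is lost on nilpotents or for algebras with few closed points.
\<close>

definition cstar_isomorphic ::
    "('p, 'r) cstar_variety \<Rightarrow> ('q, 's) cstar_variety \<Rightarrow> bool" where
  "cstar_isomorphic X Y \<longleftrightarrow>
    (\<exists>\<phi> \<psi>. bij_betw \<phi> (cv_points X) (cv_points Y)
      \<and> \<psi> \<in> ring_iso (cv_ring Y) (cv_ring X)
      \<and> (\<forall>c. \<psi> (cv_const Y c) = cv_const X c)
      \<and> (\<forall>p\<in>cv_points X. \<forall>g\<in>carrier (cv_ring Y). cv_eval X (\<psi> g) p = cv_eval Y g (\<phi> p))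
      \<and> (\<forall>l. l \<noteq> 0 \<longrightarrow> (\<forall>p\<in>cv_points X. \<phi> (cv_act X l p) = cv_act Y l (\<phi> p))))"

definition subring_record :: "'a::comm_ring_1 set \<Rightarrow> 'a ring" where
  "subring_record A = \<lparr>carrier = A, mult = (*), one = 1, zero = 0, add = (+)\<rparr>"


section \<open>The Russell cubic\<close>

type_synonym point4 = "complex \<times> complex \<times> complex \<times> complex"

inductive_set polynomial_functions4 :: "(point4 \<Rightarrow> complex) set" where
  const: "(\<lambda>_. c) \<in> polynomial_functions4"
| x: "(\<lambda>(x, y, z, t). x) \<in> polynomial_functions4"
| y: "(\<lambda>(x, y, z, t). y) \<in> polynomial_functions4"
| z: "(\<lambda>(x, y, z, t). z) \<in> polynomial_functions4"
| t: "(\<lambda>(x, y, z, t). t) \<in> polynomial_functions4"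
| add: "f \<in> polynomial_functions4 \<Longrightarrow> g \<in> polynomial_functions4
    \<Longrightarrow> (\<lambda>p. f p + g p) \<in> polynomial_functions4"
| mult: "f \<in> polynomial_functions4 \<Longrightarrow> g \<in> polynomial_functions4
    \<Longrightarrow> (\<lambda>p. f p * g p) \<in> polynomial_functions4"

definition regular_function_ring :: "point4 set \<Rightarrow> (point4 \<Rightarrow> complex) ring" where
  "regular_function_ring X =
    \<lparr>carrier = (\<lambda>f. restrict f X) ` polynomial_functions4,
     mult = (\<lambda>f g. \<lambda>p\<in>X. f p * g p), one = (\<lambda>p\<in>X. 1),
     zero = (\<lambda>p\<in>X. 0), add = (\<lambda>f g. \<lambda>p\<in>X. f p + g p)\<rparr>"

definition russell_cubic_points :: "point4 set" where
  "russell_cubic_points = {(x, y, z, t). x + x^2 * y + z^2 + t^3 = 0}"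

definition russell_cubic :: "(point4, point4 \<Rightarrow> complex) cstar_variety" where
  "russell_cubic =
    \<lparr>cv_points = russell_cubic_points,
     cv_ring = regular_function_ring russell_cubic_points,
     cv_const = (\<lambda>c. \<lambda>p\<in>russell_cubic_points. c),
     cv_eval = (\<lambda>f p. f p),
     cv_act = (\<lambda>l (x, y, z, t). (l powi 6 * x, l powi (-6) * y, l powi 3 * z, l powi 2 * t))\<rparr>"


section \<open>The function field of the affine plane\<close>

type_synonym plane_poly = "complex poly poly"

type_synonym plane_field = "complex poly poly fract"

definition u_coord :: plane_poly where
  "u_coord = [:[:0, 1:]:]"

definition v_coord :: plane_poly where
  "v_coord = [:0, 1:]"

definition plane_fun :: "plane_poly \<Rightarrow> plane_field" where
  "plane_fun p = Fract p 1"

definition plane_const :: "complex \<Rightarrow> plane_field" where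
  "plane_const c = plane_fun [:[:c:]:]"


section \<open>Prime divisors and orders of vanishing\<close>

text \<open>
  An integral separated scheme with function field \<open>'a\<close> is given by a finite set of affine charts,
  each recorded by its coordinate ring inside \<open>'a\<close>. A prime divisor is recorded by the local
  ring at its generic point: the localization of a chart at a prime ideal of height one. As the
  scheme is separated, a prime divisor meeting several charts gives the same subring of \<open>'a\<close> in
  each of them.
\<close>

definition localization :: "'a::field set \<Rightarrow> 'a set \<Rightarrow> 'a set" where
  "localization R P = {a / b | a b. a \<in> R \<and> b \<in> R \<and> b \<notin> P}"

definition height_one_prime :: "'a::field set \<Rightarrow> 'a set \<Rightarrow> bool" where
  "height_one_prime R P \<longleftrightarrow>
    primeideal P (subring_record R) \<and> P \<noteq> {0} \<and>
    (\<forall>Q. primeideal Q (subring_record R) \<and> Q \<noteq> {0} \<and> Q \<subseteq> P \<longrightarrow> Q = P)"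

definition prime_divisors :: "'a::field set set \<Rightarrow> 'a set set" where
  "prime_divisors charts = {localization R P | R P. R \<in> charts \<and> height_one_prime R P}"

definition maximal_ideal_of :: "'a::field set \<Rightarrow> 'a set" where
  "maximal_ideal_of L = {f \<in> L. f = 0 \<or> inverse f \<notin> L}"

text \<open>
  On a normal variety the local ring \<open>L\<close> of a prime divisor is a discrete valuation ring;
  \<open>\<pi>\<close> below is a uniformizer and \<open>e\<close> a unit. Only the order of a nonzero \<open>f\<close> is meaningful.
\<close>

definition ord_along :: "'a::field set \<Rightarrow> 'a \<Rightarrow> int" where
  "ord_along L f =
    (THE k. \<exists>\<pi> e. \<pi> \<in> L \<and> maximal_ideal_of L = {\<pi> * a | a. a \<in> L}
      \<and> e \<noteq> 0 \<and> e \<in> L \<and> inverse e \<in> L \<and> f = e * \<pi> powi k)"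

text \<open>A Weil \<open>\<rat>\<close>-divisor is given by its coefficients at the prime divisors.\<close>

definition sections :: "'a::field set set \<Rightarrow> ('a set \<Rightarrow> rat) \<Rightarrow> 'a set" where
  "sections charts D =
    {f. f = 0 \<or> (\<forall>L\<in>prime_divisors charts. ord_along L f + \<lfloor>D L\<rfloor> \<ge> 0)}"


section \<open>Polyhedral divisors and their spectra\<close>

text \<open>The finite formal sum of the \<open>\<Delta> D\<close>, with \<open>\<Delta>\<close> a closed bounded interval and \<open>D\<close> a prime divisor.\<close>

type_synonym 'a polyhedral_divisor = "(rat set \<times> 'a set) list"

definition evaluate :: "'a polyhedral_divisor \<Rightarrow> int \<Rightarrow> 'a set \<Rightarrow> rat" where
  "evaluate D n = (\<lambda>L. \<Sum>(\<Delta>, L')\<leftarrow>D.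
     (if L' = L then (LEAST m. m \<in> (\<lambda>q. of_int n * q) ` \<Delta>) else 0))"

text \<open>
  The direct sum over all integers \<open>n\<close> of the spaces of sections of \<open>D(n)\<close>, as a subring of the
  Laurent polynomials over the function field: the homogeneous elements of degree \<open>n\<close> are the
  \<open>Poly_Mapping.single n f\<close> with \<open>f\<close> a section of \<open>D(n)\<close>.
\<close>

definition section_algebra :: "'a::field set set \<Rightarrow> 'a polyhedral_divisor \<Rightarrow> (int \<Rightarrow>\<^sub>0 'a) set" where
  "section_algebra charts D =
    {F. \<forall>n. Poly_Mapping.lookup F n \<in> sections charts (evaluate D n)}"

definition \<comment> \<open>multiplies the homogeneous component of degree \<open>n\<close> by the \<open>n\<close>-th power of \<open>l\<close>\<close>
  grading_scale :: "(complex \<Rightarrow> 'a::field) \<Rightarrow> complex \<Rightarrow> (int \<Rightarrow>\<^sub>0 'a) \<Rightarrow> (int \<Rightarrow>\<^sub>0 'a)" where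
  "grading_scale \<iota> l F = Poly_Mapping.mapp (\<lambda>n f. \<iota> (l powi n) * f) F"

text \<open>
  The spectrum of a \<open>\<int>\<close>-graded complex algebra \<open>A\<close> of Laurent polynomials, where \<open>\<iota>\<close> embeds the
  complex numbers in the coefficient field. The closed points are the algebra homomorphisms to
  the complex numbers. The action is such that a homogeneous \<open>F\<close> of degree \<open>n\<close> satisfies
  \<open>F(l \<cdot> p) = l^n F(p)\<close>.
\<close>

definition graded_Spec ::
    "(complex \<Rightarrow> 'a::field) \<Rightarrow> (int \<Rightarrow>\<^sub>0 'a) set
      \<Rightarrow> ((int \<Rightarrow>\<^sub>0 'a) \<Rightarrow> complex, int \<Rightarrow>\<^sub>0 'a) cstar_variety" where
  "graded_Spec \<iota> A =
    \<lparr>cv_points = {\<chi> \<in> ring_hom (subring_record A) (subring_record UNIV).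
        \<chi> \<in> extensional A \<and> (\<forall>c. \<chi> (Poly_Mapping.single 0 (\<iota> c)) = c)},
     cv_ring = subring_record A,
     cv_const = (\<lambda>c. Poly_Mapping.single 0 (\<iota> c)),
     cv_eval = (\<lambda>F \<chi>. \<chi> F),
     cv_act = (\<lambda>l \<chi>. \<lambda>F\<in>A. \<chi> (grading_scale \<iota> l F))\<rparr>"

definition polyhedral_Spec ::
    "(complex \<Rightarrow> 'a::field) \<Rightarrow> 'a set set \<Rightarrow> 'a polyhedral_divisor
      \<Rightarrow> ((int \<Rightarrow>\<^sub>0 'a) \<Rightarrow> complex, int \<Rightarrow>\<^sub>0 'a) cstar_variety" where
  "polyhedral_Spec \<iota> charts D = graded_Spec \<iota> (section_algebra charts D)"


section \<open>The blow-up of the affine plane at the origin\<close>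

definition \<comment> \<open>the \<open>n\<close>-th power of the ideal \<open>(u,v)\<close>\<close>
  origin_ideal_power :: "nat \<Rightarrow> plane_poly set" where
  "origin_ideal_power n =
    {\<Sum>i\<le>n. c i * u_coord ^ i * v_coord ^ (n - i) | c. True}"

text \<open>
  The blow-up is the \<open>Proj\<close> of the Rees algebra of \<open>I = (u,v)\<close>. It is covered by the standard
  charts of the two generators \<open>g = u, v\<close> of \<open>I\<close>, in degree one: the coordinate ring of such a
  chart is the degree zero part of the Rees algebra localized at \<open>g\<close>, consisting of the \<open>a / g^n\<close>
  with \<open>a \<in> I^n\<close>.
\<close>

definition rees_chart :: "plane_poly \<Rightarrow> plane_field set" where
  "rees_chart g = {plane_fun a / plane_fun g ^ n | a n. a \<in> origin_ideal_power n}"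

definition blowup_plane :: "plane_field set set" where
  "blowup_plane = {rees_chart u_coord, rees_chart v_coord}"

definition \<comment> \<open>the prime ideal of \<open>\<complex>[u,v]\<close> that is the image under \<open>\<pi>\<close> of the generic point\<close>
  center_on_plane :: "plane_field set \<Rightarrow> plane_poly set" where
  "center_on_plane L = {a. plane_fun a \<in> maximal_ideal_of L}"

text \<open>
  The exceptional divisor is the inverse image of the origin; its generic point is the only
  point of codimension one over the origin.
\<close>

definition exceptional_divisor :: "plane_field set" where
  "exceptional_divisor =
    (THE L. L \<in> prime_divisors blowup_plane \<and> center_on_plane L = origin_ideal_power 1)"

text \<open>
  The strict transform of an irreducible curve \<open>C = {p = 0}\<close>, the closure of the inverse image of
  \<open>C\<close> minus the origin, is the only prime divisor whose generic point maps to the generic point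
  of \<open>C\<close>, the prime ideal \<open>(p)\<close>.
\<close>

definition strict_transform :: "plane_poly \<Rightarrow> plane_field set" where
  "strict_transform p =
    (THE L. L \<in> prime_divisors blowup_plane \<and> center_on_plane L = {a. p dvd a})"

end

theory Submission
  imports Defs
    "HOL-Computational_Algebra.Polynomial_Factorial"
    "HOL-Computational_Algebra.Field_as_Ring"
    "HOL-Computational_Algebra.Fundamental_Theorem_Algebra"
begin

text \<open>
  Write \<open>w = u + v + v\<^sup>2\<close> for the equation of the curve that defines \<open>D\<^sub>3\<close> and
  \<open>G = x + x\<^sup>2y + z\<^sup>2 + t\<^sup>3\<close> for the equation of the cubic. Both coordinate algebras are
  identified with the quotient of \<open>\<complex>[x,y,z,t]\<close> by \<open>G\<close>, so that they are isomorphic.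

  The weights suggest how to map \<open>\<complex>[x,y,z,t]\<close> to Laurent polynomials over \<open>\<complex>(u,v)\<close>. The
  functions \<open>v = xy\<close> and \<open>u = yt\<^sup>3\<close> on the cubic are invariant, and multiplying the equation by \<open>y\<close>
  gives \<open>yz\<^sup>2 = -w\<close>. A function of degree one is \<open>z/t\<close>, and solving for the coordinates gives, up
  to constants, \<open>t = u/w\<close> in degree 2, \<open>z = \<i>u/w\<close> in degree 3, \<open>x = u\<^sup>2v/w\<^sup>3\<close> in degree 6 and
  \<open>y = w\<^sup>3/u\<^sup>2\<close> in degree -6. This is the map \<open>laurent\<close>; it sends \<open>G\<close> to 0.

  Its image and its kernel are found by looking at monomials. As \<open>G\<close> is monic in \<open>z\<close>, every
  polynomial is congruent modulo \<open>G\<close> to a combination of monomials \<open>x\<^sup>iy\<^sup>jt\<^sup>kz\<^sup>l\<close> with \<open>l < 2\<close>. Put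
  \<open>f\<^sub>n = u\<^sup>a w\<^sup>-\<^sup>b\<close> with \<open>a = \<lceil>n/3\<rceil>\<close> and \<open>b = \<lfloor>n/2\<rfloor>\<close>. A monomial of degree \<open>n\<close> is sent to a constant
  times \<open>f\<^sub>n u\<^sup>p v\<^sup>q\<close> with \<open>p = k div 3\<close> and \<open>q = i\<close>, and \<open>j = p + q - (b - a)\<close>. This gives a bijection
  between the monomials and the triples \<open>(n,p,q)\<close> with \<open>p, q \<ge> 0\<close> and \<open>p + q \<ge> b - a\<close>
  (\<open>laurent_monom\<close>, \<open>exponents_iff\<close>). Hence the kernel is generated by \<open>G\<close>
  (\<open>laurent_eq_0_iff\<close>), and the image consists of the Laurent polynomials whose coefficient in degree
  \<open>n\<close> is \<open>f\<^sub>n\<close> times a polynomial in \<open>u\<close> and \<open>v\<close> of multiplicity at least \<open>b - a\<close> at the origin.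

  These are exactly the sections of \<open>\<D>(n)\<close> (\<open>sections_russell\<close>): the factor \<open>f\<^sub>n\<close> has the least
  orders allowed along \<open>D\<^sub>2\<close> and \<open>D\<^sub>3\<close>, the multiplicity of a polynomial is its order along \<open>E\<close>, and a function without poles
  on the blow-up outside \<open>E\<close> is a polynomial in \<open>u\<close> and \<open>v\<close>. To compute with orders, the two
  charts are seen as the polynomial rings in \<open>u, v/u\<close> and in \<open>u/v, v\<close>. These are factorial, so their
  prime divisors are given by prime elements and the order is the exponent of the prime element.
  Outside \<open>E\<close> a prime divisor is determined by its image in the plane, which is how divisors seen
  in different charts are compared.

  On the other side, a polynomial \<open>a + bz\<close> with \<open>a, b\<close> in \<open>\<complex>[x,y,t]\<close> vanishing on the cubic is 0, as
  both signs of \<open>z\<close> occur over a general \<open>(x,y,t)\<close> (\<open>vanishing_on_cubic_iff\<close>). Finally the closed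
  points of the spectrum are the values that \<open>x, y, z, t\<close> can take subject to \<open>G = 0\<close>, and the
  action multiplies the four coordinates by the powers given by their degrees.
\<close>

section \<open>Morphisms of polynomial rings\<close>

locale ring_morphism =
  fixes h :: "'a::comm_ring_1 \<Rightarrow> 'b::comm_ring_1"
  assumes add: "h (x + y) = h x + h y"
    and mult: "h (x * y) = h x * h y"
    and one: "h 1 = 1"
begin

lemma zero: "h 0 = 0"
  using add[of 0 0] by simp

lemma uminus: "h (- x) = - h x"
  using add[of x "- x"] by (simp add: zero eq_neg_iff_add_eq_0 add.commute)

lemma diff: "h (x - y) = h x - h y"
  using add[of x "- y"] by (simp add: uminus)

lemma power: "h (x ^ n) = h x ^ n"
  by (induction n) (simp_all add: one mult)

lemma sum: "h (sum f A) = (\<Sum>a\<in>A. h (f a))"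
  by (induction A rule: infinite_finite_induct) (simp_all add: zero add)

lemma dvd: "x dvd y \<Longrightarrow> h x dvd h y"
  by (auto simp: dvd_def mult)

lemmas hom = zero one add mult uminus diff power sum

end

definition eval_poly :: "('a::comm_ring_1 \<Rightarrow> 'b::comm_ring_1) \<Rightarrow> 'b \<Rightarrow> 'a poly \<Rightarrow> 'b" where
  "eval_poly h a p = poly (map_poly h p) a"

context ring_morphism
begin

lemma eval_poly_pCons: "eval_poly h a (pCons c p) = h c + a * eval_poly h a p"
  unfolding eval_poly_def
  by (cases "c = 0 \<and> p = 0") (auto simp: map_poly_pCons zero)

lemma eval_poly_0: "eval_poly h a 0 = 0"
  by (simp add: eval_poly_def)

lemma eval_poly_const: "eval_poly h a [:c:] = h c"
  by (simp add: eval_poly_pCons eval_poly_0)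

lemma eval_poly_var: "eval_poly h a [:0, 1:] = a"
  by (simp add: eval_poly_pCons eval_poly_0 zero one)

lemma eval_poly_add: "eval_poly h a (p + q) = eval_poly h a p + eval_poly h a q"
proof (induction p arbitrary: q)
  case 0
  then show ?case by (simp add: eval_poly_0)
next
  case (pCons c p)
  then show ?case
    by (cases q) (simp add: eval_poly_pCons add algebra_simps)
qed

lemma eval_poly_smult: "eval_poly h a (smult c p) = h c * eval_poly h a p"
  by (induction p) (simp_all add: eval_poly_0 eval_poly_pCons mult algebra_simps)

lemma eval_poly_mult: "eval_poly h a (p * q) = eval_poly h a p * eval_poly h a q"
proof (induction p)
  case 0
  then show ?case by (simp add: eval_poly_0)
next
  case (pCons c p)
  then show ?case
    by (simp add: eval_poly_add eval_poly_smult eval_poly_pCons zero algebra_simps)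
qed

lemma ring_morphism_eval_poly: "ring_morphism (eval_poly h a)"
  by unfold_locales
    (simp_all add: eval_poly_add eval_poly_mult one_pCons eval_poly_const one)

end

lemma ring_morphism_comp:
  assumes "ring_morphism g" "ring_morphism h"
  shows "ring_morphism (\<lambda>x. g (h x))"
proof -
  interpret g: ring_morphism g by fact
  interpret h: ring_morphism h by fact
  show ?thesis by unfold_locales (simp_all add: g.hom h.hom)
qed

lemma ring_morphism_ident: "ring_morphism (\<lambda>x. x)"
  by unfold_locales auto

lemma ring_morphism_const_poly: "ring_morphism (\<lambda>c. [:c:])"
  by unfold_locales (simp_all add: one_pCons)

text \<open>
  Identities between substitutions are reduced to their values on generators by this uniqueness.
\<close>

lemma ring_morphism_poly_unique:
  assumes "ring_morphism f" "ring_morphism g"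
    and "\<And>c. f [:c:] = g [:c:]" "f [:0, 1:] = g [:0, 1:]"
  shows "f p = g p"
proof -
  interpret f: ring_morphism f by fact
  interpret g: ring_morphism g by fact
  show ?thesis
  proof (induction p)
    case 0
    then show ?case by (simp add: f.zero g.zero)
  next
    case (pCons c p)
    have "pCons c p = [:c:] + [:0, 1:] * p" by simp
    then show ?case using pCons assms(3,4) by (simp only: f.hom g.hom)
  qed
qed

lemma poly_monom_induct [case_names add monom]:
  assumes add: "\<And>p q. P p \<Longrightarrow> P q \<Longrightarrow> P (p + q)" and monom: "\<And>a i. P (monom a i)"
  shows "P p"
proof -
  have zero: "P 0" using monom[of 0 0] by simp
  have "finite A \<Longrightarrow> P (\<Sum>i\<in>A. monom (coeff p i) i)" for A
    by (induction A rule: finite_induct) (auto simp: zero add monom)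
  from this[of "{..degree p}"] show ?thesis by (simp add: poly_as_sum_of_monoms)
qed

lemma monom_eq_mult: "monom q l = [:q:] * [:0, 1:] ^ l"
  by (induction l) (simp_all add: monom_0 monom_Suc)

section \<open>Discrete valuation rings of a factorial domain\<close>

text \<open>
  A factorial domain with an embedding into its fraction field. A morphism is used in place of a
  subring because the charts of the blow-up are different subrings of one field, all of them
  isomorphic to the same polynomial ring.
\<close>

locale ufd_in_field = ring_morphism \<sigma>
  for \<sigma> :: "'a::{factorial_ring_gcd,semiring_gcd_mult_normalize} \<Rightarrow> 'b::field" +
  assumes inj: "\<sigma> a = 0 \<Longrightarrow> a = 0"
    and frac: "\<exists>a b. b \<noteq> 0 \<and> f = \<sigma> a / \<sigma> b"
begin

lemma eq_0_iff [simp]: "\<sigma> a = 0 \<longleftrightarrow> a = 0"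
  using inj zero by auto

lemma eq_iff [simp]: "\<sigma> a = \<sigma> b \<longleftrightarrow> a = b"
  using inj[of "a - b"] by (auto simp: diff)

definition prime_set :: "'a \<Rightarrow> 'b set" where
  "prime_set q = \<sigma> ` {a. q dvd a}"

definition dvr :: "'a \<Rightarrow> 'b set" where
  "dvr q = {\<sigma> a / \<sigma> b | a b. \<not> q dvd b}"

lemma prime_set_iff [simp]: "\<sigma> a \<in> prime_set q \<longleftrightarrow> q dvd a"
  by (auto simp: prime_set_def)

lemma localization_prime_set: "localization (range \<sigma>) (prime_set q) = dvr q"
  by (force simp: localization_def dvr_def)

lemma cring_range: "cring (subring_record (range \<sigma>))"
proof (rule cringI)
  show "abelian_group (subring_record (range \<sigma>))"
  proof (rule abelian_groupI)
    fix x assume "x \<in> carrier (subring_record (range \<sigma>))"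
    then obtain a where "x = \<sigma> a" by (auto simp: subring_record_def)
    then show "\<exists>y\<in>carrier (subring_record (range \<sigma>)).
        y \<oplus>\<^bsub>subring_record (range \<sigma>)\<^esub> x = \<zero>\<^bsub>subring_record (range \<sigma>)\<^esub>"
      by (intro bexI[of _ "\<sigma> (- a)"]) (simp_all add: subring_record_def add[symmetric] zero)
  next
    show "\<zero>\<^bsub>subring_record (range \<sigma>)\<^esub> \<in> carrier (subring_record (range \<sigma>))"
      using zero by (auto simp: subring_record_def intro: range_eqI[of _ _ 0])
  qed (auto simp: subring_record_def add[symmetric] algebra_simps)
  show "comm_monoid (subring_record (range \<sigma>))"
  proof (rule comm_monoidI)
    show "\<one>\<^bsub>subring_record (range \<sigma>)\<^esub> \<in> carrier (subring_record (range \<sigma>))"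
      using one by (auto simp: subring_record_def intro: range_eqI[of _ _ 1])
  qed (auto simp: subring_record_def mult[symmetric] algebra_simps)
qed (auto simp: subring_record_def algebra_simps)

lemma primeideal_prime_set:
  assumes "prime_elem q"
  shows "primeideal (prime_set q) (subring_record (range \<sigma>))"
proof -
  interpret R: cring "subring_record (range \<sigma>)" by (rule cring_range)
  have "subgroup (prime_set q) (add_monoid (subring_record (range \<sigma>)))"
  proof (rule R.add.subgroupI)
    fix x assume "x \<in> prime_set q"
    then obtain a where a: "x = \<sigma> a" "q dvd a" by (auto simp: prime_set_def)
    have "\<ominus>\<^bsub>subring_record (range \<sigma>)\<^esub> \<sigma> a = \<sigma> (- a)"
      using R.minus_equality[of "\<sigma> (- a)" "\<sigma> a"]
      by (simp add: subring_record_def add[symmetric] zero)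
    then show "\<ominus>\<^bsub>subring_record (range \<sigma>)\<^esub> x \<in> prime_set q"
      using a by (simp add: prime_set_def)
  qed (auto simp: prime_set_def subring_record_def add[symmetric])
  then have "ideal (prime_set q) (subring_record (range \<sigma>))"
    by (rule idealI[OF R.ring_axioms])
      (auto simp: prime_set_def subring_record_def mult[symmetric])
  moreover have "\<sigma> 1 \<notin> prime_set q"
    using assms by (simp add: prime_elem_def)
  ultimately show ?thesis
    using assms
    by (intro primeidealI cring_range)
      (auto simp: prime_set_def subring_record_def mult[symmetric] prime_elem_dvd_mult_iff)
qed

lemma primeidealD:
  assumes "primeideal P (subring_record (range \<sigma>))"
  shows "P \<subseteq> range \<sigma>" "0 \<in> P" "\<sigma> x \<in> P \<Longrightarrow> \<sigma> (r * x) \<in> P" "\<sigma> 1 \<notin> P"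
    "\<sigma> (x * y) \<in> P \<Longrightarrow> \<sigma> x \<in> P \<or> \<sigma> y \<in> P"
proof -
  interpret primeideal P "subring_record (range \<sigma>)" by fact
  show "P \<subseteq> range \<sigma>" "0 \<in> P"
    using a_subset additive_subgroup.zero_closed[OF additive_subgroup_axioms]
    by (auto simp: subring_record_def)
  show "\<sigma> x \<in> P \<Longrightarrow> \<sigma> (r * x) \<in> P"
    using I_l_closed[of "\<sigma> x" "\<sigma> r"] by (simp add: subring_record_def mult)
  show "\<sigma> 1 \<notin> P"
    using one_imp_carrier I_notcarr by (auto simp: subring_record_def one)
  show "\<sigma> (x * y) \<in> P \<Longrightarrow> \<sigma> x \<in> P \<or> \<sigma> y \<in> P"
    using I_prime[of "\<sigma> x" "\<sigma> y"] by (simp add: subring_record_def mult)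
qed

text \<open>
  One of the prime factors of a nonzero element of a prime ideal lies in that ideal.
\<close>

lemma primeideal_contains_prime:
  assumes P: "primeideal P (subring_record (range \<sigma>))" and "P \<noteq> {0}"
  obtains q where "prime_elem q" "\<sigma> q \<in> P"
proof -
  have ex: "\<sigma> a \<in> P \<Longrightarrow> a \<noteq> 0 \<Longrightarrow> \<exists>q. prime_elem q \<and> \<sigma> q \<in> P" for a
  proof (induction a rule: prime_divisors_induct)
    case (unit a)
    then obtain b where "1 = b * a" by (metis dvd_def mult.commute)
    then show ?case using primeidealD(3,4)[OF P] unit.prems by metis
  next
    case (factor p a)
    then show ?case using primeidealD(5)[OF P] by (auto simp: prime_def)
  qed simp
  obtain a where "\<sigma> a \<in> P" "a \<noteq> 0"
    using assms(2) primeidealD(1,2)[OF P] zero by fastforce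
  then show ?thesis using ex that by blast
qed

text \<open>
  A nonzero prime ideal contains a prime element \<open>q\<close>, hence the prime ideal \<open>(q)\<close>, and equals it
  if it is minimal. Conversely, a prime ideal inside \<open>(q)\<close> contains a prime element that is a
  multiple of \<open>q\<close>, hence associated to \<open>q\<close>.
\<close>

lemma height_one_prime_iff:
  "height_one_prime (range \<sigma>) P \<longleftrightarrow> (\<exists>q. prime_elem q \<and> P = prime_set q)"
proof
  assume h: "height_one_prime (range \<sigma>) P"
  then have P: "primeideal P (subring_record (range \<sigma>))" and "P \<noteq> {0}"
    by (auto simp: height_one_prime_def)
  then obtain q where q: "prime_elem q" "\<sigma> q \<in> P" by (rule primeideal_contains_prime)
  have "prime_set q \<subseteq> P"
    using primeidealD(3)[OF P q(2)] by (auto simp: prime_set_def dvd_def mult.commute)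
  moreover have "prime_set q \<noteq> {0}"
    using prime_set_iff[of q q] q(1) by (auto simp del: prime_set_iff)
  ultimately have "prime_set q = P"
    using h primeideal_prime_set[OF q(1)] by (auto simp: height_one_prime_def)
  with q show "\<exists>q. prime_elem q \<and> P = prime_set q" by blast
next
  assume "\<exists>q. prime_elem q \<and> P = prime_set q"
  then obtain q where q: "prime_elem q" and [simp]: "P = prime_set q" by blast
  have "Q = prime_set q"
    if Q: "primeideal Q (subring_record (range \<sigma>))" "Q \<noteq> {0}" "Q \<subseteq> prime_set q" for Q
  proof
    obtain p where p: "prime_elem p" "\<sigma> p \<in> Q"
      using Q by (auto elim: primeideal_contains_prime)
    then have "q dvd p" using Q(3) prime_set_iff by blast
    then have "p dvd q"
      using p(1) q by (meson irreducibleD' prime_elem_def prime_elem_imp_irreducible)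
    then show "prime_set q \<subseteq> Q"
      using primeidealD(3)[OF Q(1) p(2)]
      by (auto simp: prime_set_def dvd_def) (metis mult.assoc mult.commute)
  qed (use Q in auto)
  moreover have "prime_set q \<noteq> {0}"
    using prime_set_iff[of q q] q by (auto simp del: prime_set_iff)
  ultimately show "height_one_prime (range \<sigma>) P"
    using primeideal_prime_set[OF q] by (auto simp: height_one_prime_def)
qed

lemma prime_divisors_chart:
  "{localization (range \<sigma>) P | P. height_one_prime (range \<sigma>) P} = {dvr q | q. prime_elem q}"
  by (auto simp: height_one_prime_iff localization_prime_set) (use localization_prime_set in blast)

lemma dvr_assoc:
  assumes "prime_elem q" "prime_elem p" "q dvd p"
  shows "dvr q = dvr p"
proof -
  have "p dvd q"
    using assms by (meson irreducibleD' prime_elem_def prime_elem_imp_irreducible)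
  then have "q dvd b \<longleftrightarrow> p dvd b" for b
    using assms(3) dvd_trans by blast
  then show ?thesis by (simp add: dvr_def)
qed

context
  fixes q :: 'a assumes q: "prime_elem q"
begin

lemma in_dvr: "\<sigma> a \<in> dvr q"
proof -
  have "\<sigma> a = \<sigma> a / \<sigma> 1" "\<not> q dvd 1"
    using q by (auto simp: one prime_elem_def)
  then show ?thesis unfolding dvr_def by blast
qed

lemma inverse_in_dvr: "\<not> q dvd b \<Longrightarrow> inverse (\<sigma> b) \<in> dvr q"
proof -
  assume "\<not> q dvd b"
  moreover have "inverse (\<sigma> b) = \<sigma> 1 / \<sigma> b" by (simp add: one field_simps)
  ultimately show ?thesis unfolding dvr_def by blast
qed

lemma powi_in_dvr: "\<not> q dvd b \<Longrightarrow> \<sigma> b powi k \<in> dvr q"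
  using in_dvr[of "b ^ nat k"] inverse_in_dvr[of "b ^ nat (- k)"] q
  by (auto simp: power_int_def power prime_elem_dvd_power_iff power_inverse dest: prime_elem_dvd_power)

lemma mult_in_dvr: "f \<in> dvr q \<Longrightarrow> g \<in> dvr q \<Longrightarrow> f * g \<in> dvr q"
proof -
  assume "f \<in> dvr q" "g \<in> dvr q"
  then obtain a b c d where *: "f = \<sigma> a / \<sigma> b" "\<not> q dvd b" "g = \<sigma> c / \<sigma> d" "\<not> q dvd d"
    by (auto simp: dvr_def)
  then have "f * g = \<sigma> (a * c) / \<sigma> (b * d)" "\<not> q dvd b * d"
    using q by (auto simp: mult prime_elem_dvd_mult_iff)
  then show ?thesis unfolding dvr_def by blast
qed

lemma add_in_dvr: "f \<in> dvr q \<Longrightarrow> g \<in> dvr q \<Longrightarrow> f + g \<in> dvr q"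
proof -
  assume "f \<in> dvr q" "g \<in> dvr q"
  then obtain a b c d where *: "f = \<sigma> a / \<sigma> b" "\<not> q dvd b" "g = \<sigma> c / \<sigma> d" "\<not> q dvd d"
    by (auto simp: dvr_def)
  then have "b \<noteq> 0" "d \<noteq> 0" by auto
  then have "f + g = \<sigma> (a * d + b * c) / \<sigma> (b * d)" "\<not> q dvd b * d"
    using * q by (auto simp: mult add prime_elem_dvd_mult_iff field_simps)
  then show ?thesis unfolding dvr_def by blast
qed

lemma in_maximal_ideal_iff:
  assumes "b \<noteq> 0" "\<not> q dvd b"
  shows "\<sigma> a / \<sigma> b \<in> maximal_ideal_of (dvr q) \<longleftrightarrow> q dvd a"
proof -
  have "\<sigma> a / \<sigma> b \<in> dvr q" using assms by (auto simp: dvr_def)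
  moreover have "\<not> q dvd a \<Longrightarrow> \<sigma> b / \<sigma> a \<in> dvr q" by (auto simp: dvr_def)
  moreover have False if qa: "q dvd a" "a \<noteq> 0" "\<sigma> b / \<sigma> a \<in> dvr q"
  proof -
    obtain c d where "\<sigma> b / \<sigma> a = \<sigma> c / \<sigma> d" "\<not> q dvd d"
      using qa by (auto simp: dvr_def)
    then have "\<sigma> (b * d) = \<sigma> (c * a)"
      using qa by (cases "d = 0") (auto simp: frac_eq_eq mult)
    then show False
      using qa assms \<open>\<not> q dvd d\<close> q by (metis dvd_mult eq_iff prime_elem_dvd_mult_iff)
  qed
  ultimately show ?thesis
    using assms by (auto simp: maximal_ideal_of_def)
qed

lemma maximal_ideal_iff [simp]: "\<sigma> a \<in> maximal_ideal_of (dvr q) \<longleftrightarrow> q dvd a"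
  using in_maximal_ideal_iff[of 1 a] q by (auto simp: one prime_elem_def)

lemma maximal_ideal_eq: "maximal_ideal_of (dvr q) = {\<sigma> q * a | a. a \<in> dvr q}"
proof (intro equalityI subsetI)
  fix f assume f: "f \<in> maximal_ideal_of (dvr q)"
  then obtain a b where ab: "f = \<sigma> a / \<sigma> b" "\<not> q dvd b"
    by (auto simp: maximal_ideal_of_def dvr_def)
  then have "b \<noteq> 0" by auto
  then have "q dvd a" using f ab in_maximal_ideal_iff by blast
  then obtain c where "a = q * c" by (auto simp: dvd_def)
  then have "f = \<sigma> q * (\<sigma> c / \<sigma> b)" using ab by (simp add: mult)
  moreover have "\<sigma> c / \<sigma> b \<in> dvr q" using ab by (auto simp: dvr_def)
  ultimately show "f \<in> {\<sigma> q * a | a. a \<in> dvr q}" by blast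
next
  fix f assume "f \<in> {\<sigma> q * a | a. a \<in> dvr q}"
  then obtain a b where ab: "f = \<sigma> q * (\<sigma> a / \<sigma> b)" "\<not> q dvd b" by (auto simp: dvr_def)
  then have "f = \<sigma> (q * a) / \<sigma> b" "b \<noteq> 0" by (auto simp: mult)
  then show "f \<in> maximal_ideal_of (dvr q)"
    using in_maximal_ideal_iff[of b "q * a"] ab by simp
qed

text \<open>
  The exponent is the difference of the multiplicities of \<open>q\<close> in a numerator and a denominator.
\<close>

lemma dvr_decompose:
  assumes "f \<noteq> 0"
  obtains e k where "e \<noteq> 0" "e \<in> dvr q" "inverse e \<in> dvr q" "f = e * \<sigma> q powi k"
proof -
  obtain a b where ab: "b \<noteq> 0" "f = \<sigma> a / \<sigma> b" using frac by blast
  then have "a \<noteq> 0" using assms by (auto simp: zero)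
  have q': "q \<noteq> 0" "\<not> is_unit q" using q by (auto simp: prime_elem_def)
  obtain a' where a': "a = q ^ multiplicity q a * a'" "\<not> q dvd a'"
    using multiplicity_decompose'[of a q] \<open>a \<noteq> 0\<close> q' by metis
  obtain b' where b': "b = q ^ multiplicity q b * b'" "\<not> q dvd b'"
    using multiplicity_decompose'[of b q] \<open>b \<noteq> 0\<close> q' by metis
  define m n where "m = multiplicity q a" and "n = multiplicity q b"
  have nz: "a' \<noteq> 0" "b' \<noteq> 0" using a' b' by auto
  have "\<sigma> a = \<sigma> q ^ m * \<sigma> a'" "\<sigma> b = \<sigma> q ^ n * \<sigma> b'"
    unfolding m_def n_def by (metis a'(1) mult power, metis b'(1) mult power)
  then have "f = (\<sigma> a' / \<sigma> b') * (\<sigma> q ^ m / \<sigma> q ^ n)"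
    using ab(2) by (simp add: mult.commute)
  also have "\<sigma> q ^ m / \<sigma> q ^ n = \<sigma> q powi (int m - int n)"
    using q' by (subst power_int_diff) auto
  finally have "f = (\<sigma> a' / \<sigma> b') * \<sigma> q powi (int m - int n)" .
  moreover have "\<sigma> a' / \<sigma> b' \<in> dvr q" "inverse (\<sigma> a' / \<sigma> b') \<in> dvr q"
    using a' b' by (auto simp: dvr_def)
  ultimately show ?thesis using that[of "\<sigma> a' / \<sigma> b'"] nz by auto
qed

lemma inverse_prime_notin_dvr: "inverse (\<sigma> q) \<notin> dvr q"
  using maximal_ideal_iff[of q] q by (auto simp: maximal_ideal_of_def prime_elem_def)

lemma powi_in_dvr_iff: "\<sigma> q powi k \<in> dvr q \<longleftrightarrow> k \<ge> 0"
proof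
  assume *: "\<sigma> q powi k \<in> dvr q"
  show "k \<ge> 0"
  proof (rule ccontr)
    assume "\<not> k \<ge> 0"
    have "\<sigma> q \<noteq> 0" using q by auto
    then have "inverse (\<sigma> q) = \<sigma> q powi k * \<sigma> q powi (- 1 - k)"
      by (simp flip: power_int_add)
    also have "\<sigma> q powi (- 1 - k) = \<sigma> (q ^ nat (- 1 - k))"
      using \<open>\<not> k \<ge> 0\<close> by (simp add: power_int_def power)
    finally show False
      using mult_in_dvr[OF * in_dvr] inverse_prime_notin_dvr by metis
  qed
next
  assume "k \<ge> 0"
  then have "\<sigma> q powi k = \<sigma> (q ^ nat k)" by (simp add: power_int_def power)
  then show "\<sigma> q powi k \<in> dvr q" using in_dvr by metis
qed

text \<open>Any two uniformizers differ by a unit, so that the order does not depend on the choice.\<close>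

lemma ord_along_eq:
  assumes e: "e \<noteq> 0" "e \<in> dvr q" "inverse e \<in> dvr q"
  shows "ord_along (dvr q) (e * \<sigma> q powi k) = k"
  unfolding ord_along_def
proof (rule the_equality)
  have q0: "\<sigma> q \<noteq> 0" using q by auto
  show "\<exists>\<pi> e'. \<pi> \<in> dvr q \<and> maximal_ideal_of (dvr q) = {\<pi> * a |a. a \<in> dvr q} \<and>
      e' \<noteq> 0 \<and> e' \<in> dvr q \<and> inverse e' \<in> dvr q \<and> e * \<sigma> q powi k = e' * \<pi> powi k"
    using maximal_ideal_eq in_dvr e by blast
  fix l
  assume "\<exists>\<pi> e'. \<pi> \<in> dvr q \<and> maximal_ideal_of (dvr q) = {\<pi> * a |a. a \<in> dvr q} \<and>
      e' \<noteq> 0 \<and> e' \<in> dvr q \<and> inverse e' \<in> dvr q \<and> e * \<sigma> q powi k = e' * \<pi> powi l"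
  then obtain \<pi> e' where \<pi>: "\<pi> \<in> dvr q" "maximal_ideal_of (dvr q) = {\<pi> * a |a. a \<in> dvr q}"
    and e': "e' \<noteq> 0" "e' \<in> dvr q" "inverse e' \<in> dvr q" "e * \<sigma> q powi k = e' * \<pi> powi l"
    by blast
  have "\<sigma> q \<in> maximal_ideal_of (dvr q)" by simp
  then obtain c where c: "\<sigma> q = \<pi> * c" "c \<in> dvr q" using \<pi> by auto
  have "1 \<in> dvr q" using in_dvr[of 1] by (simp add: one)
  then have "\<pi> \<in> maximal_ideal_of (dvr q)" using \<pi> by force
  then obtain d where d: "\<pi> = \<sigma> q * d" "d \<in> dvr q" using maximal_ideal_eq by auto
  have "c * d = 1" using c(1) d(1) q0 by (metis mult.assoc mult_cancel_left1 mult.commute)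
  then have dc: "inverse d = c" "d \<noteq> 0" by (metis inverse_unique mult.commute, auto)
  then have dl: "d powi j \<in> dvr q" for j
  proof -
    have "x ^ n \<in> dvr q" if "x \<in> dvr q" for x n
      by (induction n) (use that \<open>1 \<in> dvr q\<close> mult_in_dvr in auto)
    then show ?thesis using dc c d by (auto simp: power_int_def)
  qed
  have eq: "e * \<sigma> q powi k = e' * d powi l * \<sigma> q powi l"
    using e' d by (simp add: power_int_mult_distrib)
  have "\<sigma> q powi (k - l) = inverse e * (e' * d powi l)"
    using eq e q0 by (simp add: power_int_diff field_simps)
  then have "\<sigma> q powi (k - l) \<in> dvr q" using mult_in_dvr e e' dl by metis
  moreover have "\<sigma> q powi (l - k) = inverse e' * (e * d powi (- l))"
    using eq e' q0 dc by (simp add: power_int_diff power_int_minus field_simps)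
  then have "\<sigma> q powi (l - k) \<in> dvr q" using mult_in_dvr e e' dl by metis
  ultimately show "l = k" by (simp add: powi_in_dvr_iff)
qed

text \<open>
  Sections are defined by lower bounds on orders; in this form, such a bound is a membership in
  the valuation ring, which is closed under sums and products.
\<close>

lemma ord_along_ge_iff:
  assumes "f \<noteq> 0"
  shows "k \<le> ord_along (dvr q) f \<longleftrightarrow> f * \<sigma> q powi (- k) \<in> dvr q"
proof -
  obtain e l where e: "e \<noteq> 0" "e \<in> dvr q" "inverse e \<in> dvr q" "f = e * \<sigma> q powi l"
    using dvr_decompose[OF assms] by blast
  have "\<sigma> q \<noteq> 0" using q by auto
  then have f: "f * \<sigma> q powi (- k) = e * \<sigma> q powi (l - k)"
    using e by (simp add: mult.assoc flip: power_int_add)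
  have "e * \<sigma> q powi (l - k) \<in> dvr q \<longleftrightarrow> \<sigma> q powi (l - k) \<in> dvr q"
    using mult_in_dvr[OF e(3), of "e * \<sigma> q powi (l - k)"] mult_in_dvr[OF e(2), of "\<sigma> q powi (l - k)"] e
    by (auto simp flip: mult.assoc)
  then have "f * \<sigma> q powi (- k) \<in> dvr q \<longleftrightarrow> k \<le> l" using f powi_in_dvr_iff by simp
  then show ?thesis using e ord_along_eq[of e l] by simp
qed

end

text \<open>
  A reduced denominator that is not a unit has a prime factor, along which the fraction has a
  pole.
\<close>

lemma in_range_if_in_all_dvr:
  assumes "\<And>q. prime_elem q \<Longrightarrow> f \<in> dvr q"
  shows "f \<in> range \<sigma>"
proof -
  obtain a0 b0 where ab0: "b0 \<noteq> 0" "f = \<sigma> a0 / \<sigma> b0" using frac by blast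
  define g where "g = gcd a0 b0"
  have "g \<noteq> 0" using ab0 by (simp add: g_def)
  then obtain a b where a: "a0 = a * g" and b: "b0 = b * g" and cop: "coprime a b"
    using gcd_coprime_exists[of a0 b0] unfolding g_def by blast
  have f: "b \<noteq> 0" "f = \<sigma> a / \<sigma> b" using ab0 a b \<open>g \<noteq> 0\<close> by (auto simp: mult)
  have "is_unit b"
  proof (rule ccontr)
    assume "\<not> is_unit b"
    then obtain p where p: "prime p" "p dvd b"
      using f(1) prime_divisor_exists by blast
    then have pe: "prime_elem p" by auto
    then obtain c d where cd: "\<sigma> a / \<sigma> b = \<sigma> c / \<sigma> d" "\<not> p dvd d"
      using assms[OF pe] f by (auto simp: dvr_def)
    then have "d \<noteq> 0" by auto
    then have "\<sigma> (a * d) = \<sigma> (c * b)" using cd f by (auto simp: frac_eq_eq mult)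
    then have "p dvd a" using p cd pe by (metis dvd_mult eq_iff prime_elem_dvd_mult_iff)
    then show False using cop p pe by (metis coprime_common_divisor not_prime_unit)
  qed
  then obtain c where "1 = b * c" by (auto elim: dvdE)
  then have "\<sigma> b * \<sigma> c = 1" by (metis mult one)
  then have "\<sigma> a / \<sigma> b = \<sigma> a * \<sigma> c" using f(1) by (metis divide_inverse inverse_unique)
  then have "f = \<sigma> (a * c)" using f by (simp add: mult)
  then show ?thesis by simp
qed

lemma maximal_ideal_mult:
  assumes "prime_elem q" "f \<in> maximal_ideal_of (dvr q)" "g \<in> dvr q"
  shows "f * g \<in> maximal_ideal_of (dvr q)"
  using assms mult_in_dvr unfolding maximal_ideal_eq[OF assms(1)] by (auto simp: mult.assoc)

lemma maximal_ideal_add: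
  assumes "prime_elem q" "f \<in> maximal_ideal_of (dvr q)" "g \<in> maximal_ideal_of (dvr q)"
  shows "f + g \<in> maximal_ideal_of (dvr q)"
  using assms add_in_dvr unfolding maximal_ideal_eq[OF assms(1)]
  by (auto simp flip: distrib_left)

text \<open>
  Consequently, a discrete valuation ring is not dominated by any other local ring of the field.
\<close>

lemma inverse_in_maximal_ideal:
  assumes q: "prime_elem q" and f: "f \<notin> dvr q"
  shows "inverse f \<in> maximal_ideal_of (dvr q)"
proof -
  have "f \<noteq> 0" using in_dvr[OF q, of 0] f by (auto simp: zero)
  then obtain e k where e: "e \<in> dvr q" "inverse e \<in> dvr q" "f = e * \<sigma> q powi k"
    using dvr_decompose[OF q] by metis
  have "\<not> 0 \<le> k" using f mult_in_dvr[OF q e(1)] powi_in_dvr_iff[OF q] e(3) by metis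
  then have "inverse f = \<sigma> (q ^ nat (- k)) * inverse e"
    by (simp add: e(3) power_int_def power power_inverse)
  moreover have "\<sigma> (q ^ nat (- k)) \<in> maximal_ideal_of (dvr q)"
    using q \<open>\<not> 0 \<le> k\<close> by (simp add: dvd_power)
  ultimately show ?thesis using maximal_ideal_mult[OF q] e(2) by simp
qed

lemma in_dvr_of_nonneg_ord:
  "prime_elem q \<Longrightarrow> f \<noteq> 0 \<Longrightarrow> 0 \<le> ord_along (dvr q) f \<longleftrightarrow> f \<in> dvr q"
  using ord_along_ge_iff[of q f 0] by simp

end

section \<open>Substitutions in plane polynomials\<close>

definition eval2 :: "(complex \<Rightarrow> 'b::comm_ring_1) \<Rightarrow> 'b \<Rightarrow> 'b \<Rightarrow> plane_poly \<Rightarrow> 'b" where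
  "eval2 h a b = eval_poly (eval_poly h a) b"

context
  fixes h :: "complex \<Rightarrow> 'b::comm_ring_1"
  assumes h: "ring_morphism h"
begin

lemma ring_morphism_eval2: "ring_morphism (eval2 h a b)"
  unfolding eval2_def by (intro ring_morphism.ring_morphism_eval_poly h)

lemma eval2_const: "eval2 h a b [:[:c:]:] = h c"
  and eval2_u: "eval2 h a b u_coord = a"
  and eval2_v: "eval2 h a b v_coord = b"
proof -
  note * = ring_morphism.ring_morphism_eval_poly[OF h]
  show "eval2 h a b [:[:c:]:] = h c" "eval2 h a b u_coord = a" "eval2 h a b v_coord = b"
    unfolding eval2_def u_coord_def v_coord_def
    by (simp_all add: ring_morphism.eval_poly_const[OF *] ring_morphism.eval_poly_var[OF *]
        ring_morphism.eval_poly_const[OF h] ring_morphism.eval_poly_var[OF h])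
qed

end

lemma ring_morphism_plane_unique:
  fixes f g :: "plane_poly \<Rightarrow> 'b::comm_ring_1"
  assumes "ring_morphism f" "ring_morphism g"
    and "\<And>c. f [:[:c:]:] = g [:[:c:]:]" "f u_coord = g u_coord" "f v_coord = g v_coord"
  shows "f p = g p"
proof (rule ring_morphism_poly_unique[OF assms(1,2)])
  fix c
  show "f [:c:] = g [:c:]"
    by (rule ring_morphism_poly_unique[OF ring_morphism_comp[OF assms(1) ring_morphism_const_poly]
          ring_morphism_comp[OF assms(2) ring_morphism_const_poly]])
      (use assms(3-) in \<open>simp_all add: u_coord_def\<close>)
qed (use assms in \<open>simp add: v_coord_def\<close>)

lemma plane_poly_induct [case_names const u v add mult]:
  fixes p :: plane_poly
  assumes const: "\<And>c. P [:[:c:]:]" and u: "P u_coord" and v: "P v_coord"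
    and add: "\<And>p q. P p \<Longrightarrow> P q \<Longrightarrow> P (p + q)" and mult: "\<And>p q. P p \<Longrightarrow> P q \<Longrightarrow> P (p * q)"
  shows "P p"
proof -
  have inner: "P [:c:]" for c
  proof (induction c)
    case 0
    then show ?case using const[of 0] by simp
  next
    case (pCons a p)
    have "[:pCons a p:] = [:[:a:]:] + u_coord * [:p:]" by (simp add: u_coord_def)
    then show ?case using add mult const u pCons by metis
  qed
  show ?thesis
  proof (induction p)
    case 0
    then show ?case using const[of 0] by simp
  next
    case (pCons a p)
    have "pCons a p = [:a:] + v_coord * p" by (simp add: v_coord_def)
    then show ?case using add mult inner v pCons by metis
  qed
qed

abbreviation const_plane :: "complex \<Rightarrow> plane_poly" where
  "const_plane c \<equiv> [:[:c:]:]"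

lemma ring_morphism_const_plane: "ring_morphism const_plane"
  by unfold_locales (simp_all add: one_pCons)

lemma ring_morphism_plane_fun: "ring_morphism plane_fun"
  by unfold_locales (simp_all add: plane_fun_def One_fract_def)

interpretation plane_fun: ring_morphism plane_fun
  by (rule ring_morphism_plane_fun)

lemma ring_morphism_plane_const: "ring_morphism plane_const"
  unfolding plane_const_def
  by (intro ring_morphism_comp[OF ring_morphism_plane_fun] ring_morphism_const_plane)

interpretation plane_const: ring_morphism plane_const
  by (rule ring_morphism_plane_const)

lemma plane_fun_eq_iff [simp]: "plane_fun a = plane_fun b \<longleftrightarrow> a = b"
  by (simp add: plane_fun_def eq_fract)

lemma plane_fun_eq_0_iff [simp]: "plane_fun a = 0 \<longleftrightarrow> a = 0"
  using plane_fun_eq_iff[of a 0] plane_fun.zero by simp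

lemma plane_field_quotient: "\<exists>a b. b \<noteq> 0 \<and> f = plane_fun a / plane_fun b"
proof (cases f rule: Fract_cases)
  case (Fract a b)
  then show ?thesis by (intro exI[of _ a] exI[of _ b]) (simp add: plane_fun_def)
qed

lemma uv_nonzero [simp]: "u_coord \<noteq> 0" "v_coord \<noteq> 0"
  by (auto simp: u_coord_def v_coord_def)

section \<open>Powers of the ideal of the origin\<close>

lemma origin_ideal_power_0 [simp]: "origin_ideal_power 0 = UNIV"
  by (auto simp: origin_ideal_power_def intro!: exI[of _ "\<lambda>_. _"])

text \<open>
  The recursion \<open>I\<^sup>n\<^sup>+\<^sup>1 = uI\<^sup>n + vI\<^sup>n\<close> replaces the sum over monomials by induction on the exponent.
\<close>

lemma origin_ideal_power_Suc:
  "origin_ideal_power (Suc n) =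
    {u_coord * a + v_coord * b | a b. a \<in> origin_ideal_power n \<and> b \<in> origin_ideal_power n}"
proof (intro equalityI subsetI)
  fix p assume "p \<in> origin_ideal_power (Suc n)"
  then obtain c where p: "p = (\<Sum>i\<le>Suc n. c i * u_coord ^ i * v_coord ^ (Suc n - i))"
    by (auto simp: origin_ideal_power_def)
  have p_eq: "p = v_coord * (c 0 * u_coord ^ 0 * v_coord ^ (n - 0)) +
      u_coord * (\<Sum>i\<le>n. c (Suc i) * u_coord ^ i * v_coord ^ (n - i))"
    unfolding p sum.atMost_Suc_shift by (simp add: sum_distrib_left mult_ac)
  have "c 0 * u_coord ^ 0 * v_coord ^ (n - 0) =
      (\<Sum>i\<le>n. (if i = 0 then c 0 else 0) * u_coord ^ i * v_coord ^ (n - i))"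
    by (subst sum.mono_neutral_right[of _ "{0}"]) auto
  then have "c 0 * u_coord ^ 0 * v_coord ^ (n - 0) \<in> origin_ideal_power n"
    unfolding origin_ideal_power_def by (intro CollectI exI conjI TrueI)
  moreover have "(\<Sum>i\<le>n. c (Suc i) * u_coord ^ i * v_coord ^ (n - i)) \<in> origin_ideal_power n"
    unfolding origin_ideal_power_def by (intro CollectI exI[of _ "\<lambda>i. c (Suc i)"]) simp
  ultimately show "p \<in> {u_coord * a + v_coord * b | a b.
      a \<in> origin_ideal_power n \<and> b \<in> origin_ideal_power n}"
    unfolding p_eq by (subst add.commute) blast
next
  fix p assume "p \<in> {u_coord * a + v_coord * b | a b.
      a \<in> origin_ideal_power n \<and> b \<in> origin_ideal_power n}"
  then obtain c d where p: "p = u_coord * (\<Sum>i\<le>n. c i * u_coord ^ i * v_coord ^ (n - i)) +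
      v_coord * (\<Sum>i\<le>n. d i * u_coord ^ i * v_coord ^ (n - i))"
    by (auto simp: origin_ideal_power_def)
  define c' where "c' i = (case i of 0 \<Rightarrow> 0 | Suc j \<Rightarrow> c j)" for i
  define d' where "d' i = (if i \<le> n then d i else 0)" for i
  have "u_coord * (\<Sum>i\<le>n. c i * u_coord ^ i * v_coord ^ (n - i)) =
      (\<Sum>i\<le>Suc n. c' i * u_coord ^ i * v_coord ^ (Suc n - i))"
    unfolding sum.atMost_Suc_shift by (simp add: sum_distrib_left c'_def mult_ac)
  moreover have "v_coord * (\<Sum>i\<le>n. d i * u_coord ^ i * v_coord ^ (n - i)) =
      (\<Sum>i\<le>Suc n. d' i * u_coord ^ i * v_coord ^ (Suc n - i))"
    by (simp add: sum_distrib_left d'_def mult_ac Suc_diff_le)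
  ultimately have "p = (\<Sum>i\<le>Suc n. (c' i + d' i) * u_coord ^ i * v_coord ^ (Suc n - i))"
    unfolding p by (simp only: ring_distribs sum.distrib)
  then show "p \<in> origin_ideal_power (Suc n)"
    unfolding origin_ideal_power_def by auto
qed

lemma origin_ideal_power_add:
  assumes "a \<in> origin_ideal_power n" "b \<in> origin_ideal_power n"
  shows "a + b \<in> origin_ideal_power n"
proof -
  obtain c d where "a = (\<Sum>i\<le>n. c i * u_coord ^ i * v_coord ^ (n - i))"
    "b = (\<Sum>i\<le>n. d i * u_coord ^ i * v_coord ^ (n - i))"
    using assms by (auto simp: origin_ideal_power_def)
  then have "a + b = (\<Sum>i\<le>n. (c i + d i) * u_coord ^ i * v_coord ^ (n - i))"
    by (simp only: ring_distribs sum.distrib)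
  then show ?thesis unfolding origin_ideal_power_def by auto
qed

lemma origin_ideal_power_absorb:
  assumes "a \<in> origin_ideal_power n"
  shows "r * a \<in> origin_ideal_power n"
proof -
  obtain c where "a = (\<Sum>i\<le>n. c i * u_coord ^ i * v_coord ^ (n - i))"
    using assms by (auto simp: origin_ideal_power_def)
  then have "r * a = (\<Sum>i\<le>n. (r * c i) * u_coord ^ i * v_coord ^ (n - i))"
    by (simp add: sum_distrib_left mult.assoc)
  then show ?thesis unfolding origin_ideal_power_def by auto
qed

lemma origin_ideal_power_mult:
  assumes "a \<in> origin_ideal_power n" "b \<in> origin_ideal_power m"
  shows "a * b \<in> origin_ideal_power (n + m)"
  using assms(1)
proof (induction n arbitrary: a)
  case 0
  then show ?case using assms(2) origin_ideal_power_absorb by simp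
next
  case (Suc n)
  then obtain c d where a: "a = u_coord * c + v_coord * d"
    and cd: "c \<in> origin_ideal_power n" "d \<in> origin_ideal_power n"
    unfolding origin_ideal_power_Suc by blast
  have "a * b = u_coord * (c * b) + v_coord * (d * b)" by (simp add: a algebra_simps)
  then show ?case
    using Suc.IH[OF cd(1)] Suc.IH[OF cd(2)] unfolding add_Suc origin_ideal_power_Suc by blast
qed

lemma coords_in_origin_ideal:
  "u_coord \<in> origin_ideal_power 1" "v_coord \<in> origin_ideal_power 1"
  unfolding One_nat_def origin_ideal_power_Suc
  by (auto intro: exI[of _ 0] exI[of _ 1])

lemma power_in_origin_ideal_power:
  "a \<in> origin_ideal_power 1 \<Longrightarrow> a ^ n \<in> origin_ideal_power n"
proof (induction n)
  case (Suc n)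
  then show ?case using origin_ideal_power_mult[of a 1 "a ^ n" n] by simp
qed simp

section \<open>Affine charts of the blow-up\<close>

text \<open>
  In a chart, the blow-up is again an affine plane, and the map to the plane is \<open>(u,v) \<mapsto> (u,uv)\<close> or
  \<open>(u,v) \<mapsto> (uv,v)\<close>. Here \<open>Q\<close> is the pullback of functions along this map, \<open>\<sigma>\<close> sends a polynomial in
  the coordinates of the chart to a rational function on the plane, and \<open>e\<close> is the equation of the
  exceptional divisor. The last assumption says that the map is an isomorphism where \<open>e\<close> does not
  vanish, with control on the numerator.
\<close>

locale blowup_chart =
  fixes \<sigma> :: "plane_poly \<Rightarrow> plane_field" and Q :: "plane_poly \<Rightarrow> plane_poly" and e :: plane_poly
  assumes \<sigma>: "ring_morphism \<sigma>" and Q: "ring_morphism Q"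
    and \<sigma>_Q: "\<sigma> (Q a) = plane_fun a"
    and Q_e: "Q e = e" and e_nonzero: "e \<noteq> 0"
    and Q_coords: "e dvd Q u_coord" "e dvd Q v_coord"
    and clear_denominators: "\<exists>n a'. a' \<in> origin_ideal_power n \<and> e ^ n * a = Q a'"
begin

sublocale Q: ring_morphism Q by (rule Q)

sublocale ufd_in_field \<sigma>
proof -
  interpret \<sigma>: ring_morphism \<sigma> by (rule \<sigma>)
  show "ufd_in_field \<sigma>"
  proof
    fix a assume a: "\<sigma> a = 0"
    obtain n a' where a': "e ^ n * a = Q a'" using clear_denominators by blast
    then have "plane_fun a' = 0" using \<sigma>_Q[of a'] a by (simp add: \<sigma>.mult flip: a')
    then have "e ^ n * a = 0" using a' Q.zero by simp
    then show "a = 0" using e_nonzero by simp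
  next
    fix f
    obtain a b where ab: "b \<noteq> 0" "f = plane_fun a / plane_fun b"
      using plane_field_quotient by blast
    then have "\<sigma> (Q b) \<noteq> 0" by (simp add: \<sigma>_Q)
    then have "Q b \<noteq> 0" using \<sigma>.zero by metis
    moreover have "f = \<sigma> (Q a) / \<sigma> (Q b)" using ab by (simp add: \<sigma>_Q)
    moreover note calculation
    then show "\<exists>a b. b \<noteq> 0 \<and> f = \<sigma> a / \<sigma> b" by blast
  qed
qed

lemma \<sigma>_e: "\<sigma> e = plane_fun e"
  using \<sigma>_Q[of e] by (simp add: Q_e)

lemma Q_origin_ideal_power: "a \<in> origin_ideal_power n \<Longrightarrow> e ^ n dvd Q a"
proof (induction n arbitrary: a)
  case (Suc n)
  then obtain c d where "a = u_coord * c + v_coord * d"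
    "c \<in> origin_ideal_power n" "d \<in> origin_ideal_power n"
    unfolding origin_ideal_power_Suc by blast
  then show ?case using Suc.IH Q_coords by (auto simp: Q.hom intro: dvd_add mult_dvd_mono)
qed simp

text \<open>
  The pullback of an element of \<open>I\<^sup>n\<close> is divisible by \<open>e\<^sup>n\<close>; conversely, the denominators of an element
  of the chart can be cleared with a numerator in \<open>I\<^sup>n\<close>.
\<close>

lemma rees_chart_eq: "rees_chart e = range \<sigma>"
proof (intro equalityI subsetI)
  fix f assume "f \<in> rees_chart e"
  then obtain a n where f: "f = plane_fun a / plane_fun e ^ n" "a \<in> origin_ideal_power n"
    by (auto simp: rees_chart_def)
  then obtain b where "Q a = e ^ n * b" using Q_origin_ideal_power by blast
  then have "plane_fun a = plane_fun e ^ n * \<sigma> b"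
    using \<sigma>_Q[of a] by (simp add: hom \<sigma>_e)
  then have "f = \<sigma> b" using f e_nonzero by simp
  then show "f \<in> range \<sigma>" by simp
next
  fix f assume "f \<in> range \<sigma>"
  then obtain a where f: "f = \<sigma> a" by blast
  obtain n a' where a': "a' \<in> origin_ideal_power n" "e ^ n * a = Q a'"
    using clear_denominators by blast
  then have "plane_fun a' = plane_fun e ^ n * \<sigma> a"
    using \<sigma>_Q[of a'] by (simp add: hom \<sigma>_e flip: a'(2))
  then have "f = plane_fun a' / plane_fun e ^ n" using f e_nonzero by simp
  then show "f \<in> rees_chart e" using a' by (auto simp: rees_chart_def)
qed

lemma center_dvr: "prime_elem q \<Longrightarrow> center_on_plane (dvr q) = {a. q dvd Q a}"
  by (simp add: center_on_plane_def flip: \<sigma>_Q)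

text \<open>
  As the blow-up is an isomorphism outside the exceptional divisor, the local ring of any other
  prime divisor is the local ring of the plane at its center. In particular it does not depend on
  the chart.
\<close>

lemma dvr_eq_localization_at_center:
  assumes q: "prime_elem q" "\<not> q dvd e"
  shows "dvr q = {plane_fun a / plane_fun b | a b. b \<notin> center_on_plane (dvr q)}"
proof (intro equalityI subsetI)
  fix f assume "f \<in> dvr q"
  then obtain a b where f: "f = \<sigma> a / \<sigma> b" "\<not> q dvd b" by (auto simp: dvr_def)
  obtain n a' where a': "e ^ n * a = Q a'" using clear_denominators by blast
  obtain m b' where b': "e ^ m * b = Q b'" using clear_denominators by blast
  have "plane_fun (e ^ m * a') = \<sigma> e ^ (m + n) * \<sigma> a"
    using \<sigma>_Q[of a'] by (simp add: plane_fun.hom \<sigma>_e hom power_add flip: a')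
  moreover have "plane_fun (e ^ n * b') = \<sigma> e ^ (m + n) * \<sigma> b"
    using \<sigma>_Q[of b'] by (simp add: plane_fun.hom \<sigma>_e hom power_add flip: b')
  ultimately have "f = plane_fun (e ^ m * a') / plane_fun (e ^ n * b')"
    using f e_nonzero by simp
  moreover have "Q (e ^ n * b') = e ^ n * (e ^ m * b)" by (simp add: Q.hom Q_e b')
  then have "\<not> q dvd Q (e ^ n * b')"
    using q f by (auto simp: prime_elem_dvd_mult_iff dest: prime_elem_dvd_power)
  ultimately show "f \<in> {plane_fun a / plane_fun b | a b. b \<notin> center_on_plane (dvr q)}"
    using center_dvr[OF q(1)] by blast
next
  fix f assume "f \<in> {plane_fun a / plane_fun b | a b. b \<notin> center_on_plane (dvr q)}"
  then obtain a b where "f = \<sigma> (Q a) / \<sigma> (Q b)" "\<not> q dvd Q b"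
    using center_dvr[OF q(1)] by (auto simp: \<sigma>_Q)
  then show "f \<in> dvr q" by (auto simp: dvr_def)
qed

end

definition "pu = plane_fun u_coord"
definition "pv = plane_fun v_coord"

lemma puv_nonzero [simp]: "pu \<noteq> 0" "pv \<noteq> 0"
  by (simp_all add: pu_def pv_def)

lemma blowup_chartI:
  assumes e: "e = u_coord \<or> e = v_coord" and Qe: "Q e = e"
    and Q: "ring_morphism Q" "\<And>c. Q (const_plane c) = const_plane c"
    and \<sigma>: "ring_morphism \<sigma>" "\<And>c. \<sigma> (const_plane c) = plane_const c"
    and \<sigma>Q: "\<sigma> (Q u_coord) = pu" "\<sigma> (Q v_coord) = pv"
    and eq: "Q u_coord = e * u_coord \<and> Q v_coord = v_coord \<or>
      Q u_coord = u_coord \<and> Q v_coord = e * v_coord"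
  shows "blowup_chart \<sigma> Q e"
proof
  interpret Q: ring_morphism Q by fact
  interpret \<sigma>: ring_morphism \<sigma> by fact
  show "\<sigma> (x + y) = \<sigma> x + \<sigma> y" "\<sigma> (x * y) = \<sigma> x * \<sigma> y" "\<sigma> 1 = 1"
    "Q (x + y) = Q x + Q y" "Q (x * y) = Q x * Q y" "Q 1 = 1" for x y
    by (simp_all add: Q.hom \<sigma>.hom)
  show "Q e = e" by fact
  show "e \<noteq> 0" using e by auto
  show "e dvd Q u_coord" "e dvd Q v_coord" using e eq Qe by auto
  show "\<sigma> (Q a) = plane_fun a" for a
    by (rule ring_morphism_plane_unique[OF ring_morphism_comp[OF \<sigma>(1) Q(1)] ring_morphism_plane_fun])
      (simp_all add: Q \<sigma> \<sigma>Q plane_const_def pu_def pv_def)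
  have eI: "e \<in> origin_ideal_power 1" using e coords_in_origin_ideal by auto
  show "\<exists>n a'. a' \<in> origin_ideal_power n \<and> e ^ n * a = Q a'" for a
  proof (induction a rule: plane_poly_induct)
    case (const c)
    show ?case by (intro exI[of _ 0] exI[of _ "const_plane c"]) (simp add: Q)
  next
    case u
    show ?case
      using eq
    proof
      assume "Q u_coord = e * u_coord \<and> Q v_coord = v_coord"
      then show ?thesis
        using coords_in_origin_ideal(1)
        by (intro exI[of _ 1] exI[of _ u_coord]) simp
    next
      assume "Q u_coord = u_coord \<and> Q v_coord = e * v_coord"
      then show ?thesis by (intro exI[of _ 0] exI[of _ u_coord]) simp
    qed
  next
    case v
    show ?case
      using eq
    proof
      assume "Q u_coord = u_coord \<and> Q v_coord = e * v_coord"
      then show ?thesis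
        using coords_in_origin_ideal(2)
        by (intro exI[of _ 1] exI[of _ v_coord]) simp
    next
      assume "Q u_coord = e * u_coord \<and> Q v_coord = v_coord"
      then show ?thesis by (intro exI[of _ 0] exI[of _ v_coord]) simp
    qed
  next
    case (add p q)
    then obtain n p' m q' where *: "p' \<in> origin_ideal_power n" "e ^ n * p = Q p'"
      "q' \<in> origin_ideal_power m" "e ^ m * q = Q q'" by blast
    have "e ^ (n + m) * (p + q) = (e ^ n * p) * e ^ m + e ^ n * (e ^ m * q)"
      by (simp add: power_add algebra_simps)
    also have "\<dots> = Q (p' * e ^ m + e ^ n * q')"
      by (simp only: * Q.hom Qe)
    finally have "e ^ (n + m) * (p + q) = Q (p' * e ^ m + e ^ n * q')" .
    with *(1,3) show ?case
      using power_in_origin_ideal_power[OF eI]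
      by (metis origin_ideal_power_add origin_ideal_power_mult)
  next
    case (mult p q)
    then obtain n p' m q' where *: "p' \<in> origin_ideal_power n" "e ^ n * p = Q p'"
      "q' \<in> origin_ideal_power m" "e ^ m * q = Q q'" by blast
    have "e ^ (n + m) * (p * q) = (e ^ n * p) * (e ^ m * q)"
      by (simp add: power_add algebra_simps)
    also have "\<dots> = Q (p' * q')" by (simp only: * Q.hom)
    finally have "e ^ (n + m) * (p * q) = Q (p' * q')" .
    with *(1,3) show ?case by (metis origin_ideal_power_mult)
  qed
qed

definition chart_u :: "plane_poly \<Rightarrow> plane_field" where
  "chart_u = eval2 plane_const pu (pv / pu)"

definition pullback_u :: "plane_poly \<Rightarrow> plane_poly" where
  "pullback_u = eval2 const_plane u_coord (u_coord * v_coord)"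

definition chart_v :: "plane_poly \<Rightarrow> plane_field" where
  "chart_v = eval2 plane_const (pu / pv) pv"

definition pullback_v :: "plane_poly \<Rightarrow> plane_poly" where
  "pullback_v = eval2 const_plane (v_coord * u_coord) v_coord"

lemmas chart_simps =
  eval2_const[OF ring_morphism_plane_const] eval2_u[OF ring_morphism_plane_const]
  eval2_v[OF ring_morphism_plane_const] eval2_const[OF ring_morphism_const_plane]
  eval2_u[OF ring_morphism_const_plane] eval2_v[OF ring_morphism_const_plane]
  ring_morphism.mult[OF ring_morphism_eval2[OF ring_morphism_plane_const]]

interpretation U: blowup_chart chart_u pullback_u u_coord
  by (rule blowup_chartI)
    (simp_all add: chart_u_def pullback_u_def chart_simps ring_morphism_eval2
      ring_morphism_plane_const ring_morphism_const_plane)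

interpretation V: blowup_chart chart_v pullback_v v_coord
  by (rule blowup_chartI)
    (simp_all add: chart_v_def pullback_v_def chart_simps ring_morphism_eval2
      ring_morphism_plane_const ring_morphism_const_plane)

lemma prime_divisors_blowup:
  "prime_divisors blowup_plane = {U.dvr q | q. prime_elem q} \<union> {V.dvr q | q. prime_elem q}"
  unfolding U.prime_divisors_chart[symmetric] V.prime_divisors_chart[symmetric]
  by (auto simp: prime_divisors_def blowup_plane_def U.rees_chart_eq V.rees_chart_eq)

section \<open>Graphs over the \<open>v\<close>-axis\<close>

text \<open>
  Polynomials in \<open>v\<close> alone; they are the representatives modulo the equation \<open>u - c(v)\<close> of a graph.
\<close>

definition lift_v :: "complex poly \<Rightarrow> plane_poly" where
  "lift_v = eval_poly const_plane v_coord"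

interpretation lift_v: ring_morphism lift_v
  unfolding lift_v_def by (intro ring_morphism.ring_morphism_eval_poly ring_morphism_const_plane)

lemma lift_v_const: "lift_v [:c:] = const_plane c"
  and lift_v_var: "lift_v [:0, 1:] = v_coord"
  by (simp_all add: lift_v_def ring_morphism.eval_poly_const ring_morphism.eval_poly_var
      ring_morphism_const_plane)

definition graph :: "complex poly \<Rightarrow> plane_poly" where
  "graph c = u_coord - lift_v c"

definition restrict_graph :: "complex poly \<Rightarrow> plane_poly \<Rightarrow> complex poly" where
  "restrict_graph c = eval2 (\<lambda>a. [:a:]) c [:0, 1:]"

interpretation restrict_graph: ring_morphism "restrict_graph c" for c
  unfolding restrict_graph_def by (intro ring_morphism_eval2 ring_morphism_const_poly)

lemma restrict_graph_simps:
  "restrict_graph c (const_plane a) = [:a:]" "restrict_graph c u_coord = c"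
  "restrict_graph c v_coord = [:0, 1:]"
  by (simp_all add: restrict_graph_def eval2_const eval2_u eval2_v ring_morphism_const_poly)

lemma restrict_graph_lift_v [simp]: "restrict_graph c (lift_v a) = a"
  by (rule ring_morphism_poly_unique[OF ring_morphism_comp[OF
          restrict_graph.ring_morphism_axioms lift_v.ring_morphism_axioms] ring_morphism_ident])
    (simp_all add: lift_v_const lift_v_var restrict_graph_simps)

text \<open>
  Modulo \<open>u - c(v)\<close> every polynomial becomes a polynomial in \<open>v\<close>. Divisibility by \<open>u - c(v)\<close> is
  therefore the vanishing of the restriction to the graph, and \<open>u - c(v)\<close> is prime because the
  restriction takes values in a domain.
\<close>

lemma graph_dvd_diff: "graph c dvd p - lift_v (restrict_graph c p)"
proof (induction p rule: plane_poly_induct)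
  case (add p q)
  have "p + q - lift_v (restrict_graph c (p + q)) =
      (p - lift_v (restrict_graph c p)) + (q - lift_v (restrict_graph c q))"
    by (simp add: restrict_graph.hom lift_v.hom)
  then show ?case using add by (metis dvd_add)
next
  case (mult p q)
  have "p * q - lift_v (restrict_graph c (p * q)) =
      (p - lift_v (restrict_graph c p)) * q + lift_v (restrict_graph c p) * (q - lift_v (restrict_graph c q))"
    by (simp add: restrict_graph.hom lift_v.hom algebra_simps)
  then show ?case using mult by (metis dvd_add dvd_mult dvd_mult2)
qed (simp_all add: restrict_graph_simps lift_v_const lift_v_var graph_def)

lemma restrict_graph_graph [simp]: "restrict_graph c (graph c) = 0"
  by (simp add: graph_def restrict_graph.hom restrict_graph_simps)

lemma graph_dvd_iff: "graph c dvd p \<longleftrightarrow> restrict_graph c p = 0"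
  using graph_dvd_diff[of c p] restrict_graph.dvd[of "graph c" p c]
  by (auto simp: lift_v.zero)

lemma prime_elem_graph: "prime_elem (graph c)"
proof (rule prime_elemI)
  show "graph c \<noteq> 0"
    by (auto simp: graph_def dest!: arg_cong[of _ _ "restrict_graph (c + 1)"]
        simp: restrict_graph.hom restrict_graph_simps)
  show "\<not> is_unit (graph c)" by (simp add: graph_dvd_iff restrict_graph.one)
qed (simp add: graph_dvd_iff restrict_graph.mult)

lemma v_coord_dvd_iff: "v_coord dvd p \<longleftrightarrow> coeff p 0 = 0"
  using poly_eq_0_iff_dvd[of p 0] by (simp add: v_coord_def poly_0_coeff_0)

lemma prime_elem_v_coord: "prime_elem v_coord"
  by (rule prime_elemI) (simp_all add: v_coord_dvd_iff coeff_mult)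

lemma u_coord_eq_graph: "u_coord = graph 0"
  by (simp add: graph_def lift_v.zero)

lemma prime_elem_u_coord: "prime_elem u_coord"
  using prime_elem_graph[of 0] by (simp add: u_coord_eq_graph)

lemma pullback_simps:
  "pullback_v u_coord = v_coord * u_coord" "pullback_v v_coord = v_coord"
  "pullback_v (const_plane a) = const_plane a"
  "pullback_u u_coord = u_coord" "pullback_u v_coord = u_coord * v_coord"
  "pullback_u (const_plane a) = const_plane a"
  by (simp_all add: pullback_v_def pullback_u_def chart_simps)

lemma pullback_v_lift_v: "pullback_v (lift_v a) = lift_v a"
  by (rule ring_morphism_poly_unique[OF ring_morphism_comp[OF
          V.Q lift_v.ring_morphism_axioms] lift_v.ring_morphism_axioms])
    (simp_all add: lift_v_const lift_v_var pullback_simps)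

lemma pullback_v_graph: "pullback_v (graph ([:0, 1:] * c)) = v_coord * graph c"
  by (simp add: graph_def V.Q.hom pullback_v_lift_v lift_v.mult lift_v_var pullback_simps
      right_diff_distrib del: mult_pCons_left)

text \<open>
  In the chart with coordinates \<open>u/v\<close> and \<open>v\<close>, the strict transform of \<open>u = v c(v)\<close> is \<open>u/v = c(v)\<close>.
  Both curves of the proposition are of this form, with \<open>c = 0\<close> and \<open>c = -1 - v\<close>.
\<close>

lemma center_graph:
  "center_on_plane (V.dvr (graph c)) = {p. graph ([:0, 1:] * c) dvd p}"
proof -
  have "graph c dvd pullback_v p \<longleftrightarrow> graph ([:0, 1:] * c) dvd p" for p
  proof -
    define a where "a = restrict_graph ([:0, 1:] * c) p"
    obtain r where "p - lift_v a = graph ([:0, 1:] * c) * r"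
      using graph_dvd_diff unfolding a_def by (rule dvdE)
    then have "p = graph ([:0, 1:] * c) * r + lift_v a" by (simp add: algebra_simps)
    then have "pullback_v p = graph c * (v_coord * pullback_v r) + lift_v a"
      by (simp only: V.Q.add V.Q.mult pullback_v_graph pullback_v_lift_v) (simp only: mult_ac)
    then have "graph c dvd pullback_v p \<longleftrightarrow> graph c dvd lift_v a"
      by (simp add: dvd_add_right_iff)
    also have "\<dots> \<longleftrightarrow> a = 0" by (simp add: graph_dvd_iff)
    finally show ?thesis unfolding a_def by (simp only: graph_dvd_iff)
  qed
  then show ?thesis by (simp add: V.center_dvr prime_elem_graph)
qed

section \<open>The strict transforms and the exceptional divisor\<close>

abbreviation (input) curve :: plane_poly where
  "curve \<equiv> u_coord + v_coord + v_coord ^ 2"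

text \<open>
  The equation \<open>u/v + 1 + v\<close> of \<open>D\<^sub>3\<close> in the chart with coordinates \<open>u/v\<close> and \<open>v\<close>.
\<close>

definition curve_v :: plane_poly where
  "curve_v = graph [:-1, -1:]"

lemma lift_v_pCons: "lift_v (pCons a p) = const_plane a + v_coord * lift_v p"
  unfolding lift_v_def by (rule ring_morphism.eval_poly_pCons[OF ring_morphism_const_plane])

lemma curve_eq_graph: "curve = graph ([:0, 1:] * [:-1, -1:])"
proof -
  have "[:-1, -1:] = - 1 - [:0, 1::complex:]" by (simp add: one_pCons)
  then have *: "lift_v [:-1, -1:] = - 1 - v_coord"
    by (simp only: lift_v.hom lift_v_var)
  show ?thesis
    unfolding graph_def lift_v.mult lift_v_var * by (simp add: algebra_simps power2_eq_square)
qed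

lemma pullback_v_curve: "pullback_v curve = v_coord * curve_v"
  unfolding curve_eq_graph pullback_v_graph curve_v_def ..

lemma prime_elem_curve_v: "prime_elem curve_v"
  unfolding curve_v_def by (rule prime_elem_graph)

lemma u_coord_dvd_iff: "u_coord dvd p \<longleftrightarrow> restrict_graph 0 p = 0"
  unfolding u_coord_eq_graph by (rule graph_dvd_iff)

lemma not_dvd_coords:
  "\<not> u_coord dvd v_coord" "\<not> v_coord dvd u_coord" "\<not> curve_v dvd u_coord" "\<not> curve_v dvd v_coord"
  "\<not> u_coord dvd curve_v" "\<not> v_coord dvd curve_v" "\<not> curve dvd u_coord" "\<not> curve dvd v_coord"
  "\<not> curve_v dvd u_coord * v_coord" "\<not> u_coord dvd v_coord * curve_v"
proof -
  show 1: "\<not> u_coord dvd v_coord" "\<not> curve_v dvd u_coord" "\<not> curve_v dvd v_coord"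
    "\<not> u_coord dvd curve_v"
    unfolding u_coord_dvd_iff curve_v_def graph_dvd_iff
    by (simp_all add: graph_def restrict_graph.hom restrict_graph_simps)
  show "\<not> curve dvd u_coord" "\<not> curve dvd v_coord"
    unfolding curve_eq_graph graph_dvd_iff by (simp_all add: restrict_graph_simps)
  show "\<not> v_coord dvd u_coord" "\<not> v_coord dvd curve_v"
    unfolding curve_v_def graph_def v_coord_dvd_iff
    by (simp_all add: lift_v_pCons lift_v.zero)
      (simp_all add: u_coord_def v_coord_def)
  show "\<not> curve_v dvd u_coord * v_coord" "\<not> u_coord dvd v_coord * curve_v"
    using 1 prime_elem_curve_v prime_elem_u_coord by (simp_all add: prime_elem_dvd_mult_iff)
qed

text \<open>
  The equation of the exceptional divisor divides the pullbacks of both coordinates, so a prime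
  divisor with a smaller center is not exceptional.
\<close>

lemma prime_divisor_eq_localization_at_center:
  assumes "L \<in> prime_divisors blowup_plane"
    and "\<not> (u_coord \<in> center_on_plane L \<and> v_coord \<in> center_on_plane L)"
  shows "L = {plane_fun a / plane_fun b | a b. b \<notin> center_on_plane L}"
proof -
  consider q where "prime_elem q" "L = U.dvr q" | q where "prime_elem q" "L = V.dvr q"
    using assms(1) by (auto simp: prime_divisors_blowup)
  then show ?thesis
  proof cases
    case 1
    then have "\<not> q dvd u_coord"
      using assms(2) by (auto simp: U.center_dvr pullback_simps)
    then show ?thesis using U.dvr_eq_localization_at_center 1 by simp
  next
    case 2
    then have "\<not> q dvd v_coord"
      using assms(2) by (auto simp: V.center_dvr pullback_simps)
    then show ?thesis using V.dvr_eq_localization_at_center 2 by simp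
  qed
qed

lemma prime_divisor_determined_by_center:
  assumes "L \<in> prime_divisors blowup_plane" "L' \<in> prime_divisors blowup_plane"
    and "center_on_plane L = center_on_plane L'"
    and "\<not> (u_coord \<in> center_on_plane L \<and> v_coord \<in> center_on_plane L)"
  shows "L = L'"
  using prime_divisor_eq_localization_at_center[OF assms(1,4)]
    prime_divisor_eq_localization_at_center[OF assms(2)] assms(3,4) by simp

lemma strict_transform_graph:
  "strict_transform (graph ([:0, 1:] * c)) = V.dvr (graph c)"
  unfolding strict_transform_def
proof (rule the_equality)
  let ?C = "{a. graph ([:0, 1:] * c) dvd a}"
  have "v_coord \<notin> ?C" by (simp add: graph_dvd_iff restrict_graph_simps)
  moreover have L: "V.dvr (graph c) \<in> prime_divisors blowup_plane \<and> center_on_plane (V.dvr (graph c)) = ?C"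
    using prime_elem_graph center_graph by (auto simp: prime_divisors_blowup)
  ultimately show "L = V.dvr (graph c)"
    if "L \<in> prime_divisors blowup_plane \<and> center_on_plane L = ?C" for L
    using prime_divisor_determined_by_center[of L "V.dvr (graph c)"] that by blast
  show "V.dvr (graph c) \<in> prime_divisors blowup_plane \<and> center_on_plane (V.dvr (graph c)) = ?C"
    by (rule L)
qed

lemma strict_transform_u: "strict_transform u_coord = V.dvr u_coord"
  using strict_transform_graph[of 0] by (simp add: u_coord_eq_graph)

lemma strict_transform_curve: "strict_transform curve = V.dvr curve_v"
  unfolding curve_eq_graph strict_transform_graph curve_v_def ..

lemma center_D2: "center_on_plane (V.dvr u_coord) = {a. u_coord dvd a}"
  using center_graph[of 0] by (simp add: u_coord_eq_graph)

lemma center_D3: "center_on_plane (V.dvr curve_v) = {a. curve dvd a}"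
  unfolding curve_eq_graph curve_v_def by (rule center_graph)

lemma center_E: "center_on_plane (V.dvr v_coord) = origin_ideal_power 1"
proof -
  have "a \<in> origin_ideal_power 1" if "v_coord dvd pullback_v a" for a
  proof -
    have "\<exists>c r s. a = const_plane c + (u_coord * r + v_coord * s)"
    proof (cases a)
      case (pCons p s)
      obtain c r where "p = pCons c r" by (cases p)
      then have "a = const_plane c + (u_coord * [:r:] + v_coord * s)"
        using pCons by (simp add: u_coord_def v_coord_def)
      then show ?thesis by blast
    qed
    then obtain c r s where a: "a = const_plane c + (u_coord * r + v_coord * s)" by blast
    have "pullback_v a = const_plane c + v_coord * (u_coord * pullback_v r + pullback_v s)"
      unfolding a V.Q.add V.Q.mult pullback_simps by (simp add: algebra_simps)
    then have "v_coord dvd const_plane c"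
      using that by (simp add: dvd_add_left_iff)
    then have "a = u_coord * r + v_coord * s" by (simp add: v_coord_dvd_iff a)
    then show ?thesis
      unfolding One_nat_def origin_ideal_power_Suc by auto
  qed
  then show ?thesis
    using V.Q_origin_ideal_power[of _ 1] by (auto simp: V.center_dvr prime_elem_v_coord)
qed

text \<open>
  Passing from \<open>v/u\<close> to its inverse \<open>u/v\<close> reverses the coefficients of a polynomial.
\<close>

lemma eval_poly_reflect:
  assumes "x \<noteq> 0"
  shows "eval_poly plane_const x (reflect_poly c) = x ^ degree c * eval_poly plane_const (inverse x) c"
proof -
  have "plane_const a = 0 \<longleftrightarrow> a = 0" for a by (simp add: plane_const_def)
  then have "degree (map_poly plane_const c) = degree c" by (intro degree_map_poly) simp
  then have "map_poly plane_const (reflect_poly c) = reflect_poly (map_poly plane_const c)"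
    by (intro poly_eqI) (simp add: coeff_map_poly coeff_reflect_poly plane_const.zero)
  then show ?thesis
    unfolding eval_poly_def using poly_reflect_poly_nz[OF assms, of "map_poly plane_const c"]
    by (simp add: \<open>degree (map_poly plane_const c) = degree c\<close>)
qed

lemma chart_u_simps: "chart_u u_coord = pu" "chart_u v_coord = pv / pu"
    "chart_u (const_plane c) = plane_const c"
  and chart_v_simps: "chart_v u_coord = pu / pv" "chart_v v_coord = pv"
    "chart_v (const_plane c) = plane_const c"
  by (simp_all add: chart_u_def chart_v_def chart_simps)

text \<open>
  The exceptional divisor has the equation \<open>u\<close> in one chart and \<open>v\<close> in the other. A valuation ring
  that is dominated by another local ring of its field is equal to it, so it suffices to show that
  the second local ring dominates the first one. The point is that \<open>b(u,v/u)\<close> is a unit of the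
  second ring if \<open>u\<close> does not divide \<open>b\<close>: modulo \<open>u\<close>, it is a nonzero polynomial in \<open>v/u\<close>, and after multiplication
  by a power of the unit \<open>x = u/v\<close> it becomes a nonzero polynomial in \<open>x\<close> alone, which \<open>v\<close> does not
  divide.
\<close>

lemma exceptional_charts: "U.dvr u_coord = V.dvr v_coord"
proof -
  let ?L = "V.dvr v_coord" and ?m = "maximal_ideal_of (V.dvr v_coord)"
  note Vd = V.in_dvr[OF prime_elem_v_coord] V.mult_in_dvr[OF prime_elem_v_coord]
    V.add_in_dvr[OF prime_elem_v_coord] V.inverse_in_dvr[OF prime_elem_v_coord]
  define x where "x = chart_v u_coord"
  have x: "x \<noteq> 0" "x \<in> ?L" "inverse x \<in> ?L"
    using Vd not_dvd_coords by (simp_all add: x_def)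
  have pu: "pu = chart_v (v_coord * u_coord)"
    by (simp add: V.mult chart_v_simps)
  have pum: "pu \<in> ?m"
    unfolding pu by (subst V.maximal_ideal_iff[OF prime_elem_v_coord]) simp
  have in_L: "chart_u a \<in> ?L" for a
  proof (induction a rule: plane_poly_induct)
    case (const c)
    then show ?case using Vd(1)[of "const_plane c"] by (simp add: chart_u_simps chart_v_simps)
  next
    case u
    then show ?case unfolding chart_u_simps pu by (rule Vd(1))
  next
    case v
    then show ?case using x(3) by (simp add: chart_u_simps x_def chart_v_simps)
  qed (use Vd in \<open>auto simp: U.hom\<close>)
  have unit: "chart_u b \<notin> ?m" if b: "\<not> u_coord dvd b" for b
  proof
    assume bm: "chart_u b \<in> ?m"
    define c where "c = restrict_graph 0 b"
    have "c \<noteq> 0" using b by (simp add: c_def u_coord_eq_graph graph_dvd_iff)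
    obtain r where "b - lift_v c = u_coord * r"
      using graph_dvd_diff[of 0 b] unfolding c_def u_coord_eq_graph[symmetric] by (rule dvdE)
    then have "lift_v c = b + u_coord * (- r)" by (simp add: algebra_simps)
    then have "chart_u (lift_v c) = chart_u b + pu * chart_u (- r)"
      by (simp only: U.add U.mult chart_u_simps)
    then have *: "chart_u (lift_v c) \<in> ?m"
      using bm V.maximal_ideal_add V.maximal_ideal_mult prime_elem_v_coord pum in_L by metis
    have "chart_u (lift_v c) = eval_poly plane_const (inverse x) c"
      by (rule ring_morphism_poly_unique[OF ring_morphism_comp[OF U.\<sigma> lift_v.ring_morphism_axioms]
            plane_const.ring_morphism_eval_poly])
        (simp_all add: lift_v_const lift_v_var chart_u_simps x_def chart_v_simps
          plane_const.eval_poly_const plane_const.eval_poly_var)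
    then have "chart_u (lift_v c) * x ^ degree c = eval_poly plane_const x (reflect_poly c)"
      using eval_poly_reflect[OF x(1), of c] by (simp add: mult.commute)
    also have "\<dots> = chart_v [:reflect_poly c:]"
      unfolding chart_v_def eval2_def
      by (subst ring_morphism.eval_poly_const[OF plane_const.ring_morphism_eval_poly])
        (simp add: x_def chart_v_simps)
    also have "\<dots> \<notin> ?m"
      using \<open>c \<noteq> 0\<close> prime_elem_v_coord by (simp add: v_coord_dvd_iff)
    finally have "chart_u (lift_v c) * x ^ degree c \<notin> ?m" .
    moreover have "x ^ k \<in> ?L" for k
      using Vd(1)[of "u_coord ^ k"] by (simp add: V.power x_def)
    ultimately show False using * V.maximal_ideal_mult[OF prime_elem_v_coord] by blast
  qed
  have sub: "U.dvr u_coord \<subseteq> ?L"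
  proof
    fix f assume "f \<in> U.dvr u_coord"
    then obtain a b where f: "f = chart_u a / chart_u b" "\<not> u_coord dvd b"
      by (auto simp: U.dvr_def)
    then have "inverse (chart_u b) \<in> ?L"
      using unit[OF f(2)] in_L[of b] by (auto simp: maximal_ideal_of_def)
    then show "f \<in> ?L" using Vd(2) in_L f by (simp add: divide_inverse)
  qed
  have "f \<in> U.dvr u_coord" if f: "f \<in> ?L" for f
  proof (rule ccontr)
    assume nf: "f \<notin> U.dvr u_coord"
    then have "inverse f \<in> maximal_ideal_of (U.dvr u_coord)"
      by (rule U.inverse_in_maximal_ideal[OF prime_elem_u_coord])
    then obtain a where "inverse f = pu * a" "a \<in> U.dvr u_coord"
      unfolding U.maximal_ideal_eq[OF prime_elem_u_coord] chart_u_simps by blast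
    then have "inverse f \<in> ?m"
      using V.maximal_ideal_mult[OF prime_elem_v_coord pum] sub by auto
    moreover have "f \<noteq> 0"
      using nf U.in_dvr[OF prime_elem_u_coord, of 0] by (auto simp: U.zero)
    ultimately have "inverse f \<noteq> 0" "inverse (inverse f) \<notin> ?L"
      by (auto simp: maximal_ideal_of_def)
    then show False using f by simp
  qed
  with sub show ?thesis by blast
qed

lemma exceptional_divisor_eq: "exceptional_divisor = V.dvr v_coord"
  unfolding exceptional_divisor_def
proof (rule the_equality)
  show "V.dvr v_coord \<in> prime_divisors blowup_plane \<and>
      center_on_plane (V.dvr v_coord) = origin_ideal_power 1"
    using prime_elem_v_coord center_E by (auto simp: prime_divisors_blowup)
  fix L assume L: "L \<in> prime_divisors blowup_plane \<and> center_on_plane L = origin_ideal_power 1"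
  then have coords: "u_coord \<in> center_on_plane L" "v_coord \<in> center_on_plane L"
    using coords_in_origin_ideal by auto
  consider q where "prime_elem q" "L = U.dvr q" | q where "prime_elem q" "L = V.dvr q"
    using L by (auto simp: prime_divisors_blowup)
  then show "L = V.dvr v_coord"
  proof cases
    case 1
    then have "q dvd u_coord" using coords by (simp add: U.center_dvr pullback_simps)
    then show ?thesis
      using 1 U.dvr_assoc prime_elem_u_coord exceptional_charts by metis
  next
    case 2
    then have "q dvd v_coord" using coords by (simp add: V.center_dvr pullback_simps)
    then show ?thesis using 2 V.dvr_assoc prime_elem_v_coord by metis
  qed
qed

text \<open>
  Over the complex numbers, \<open>a(g)\<close> is a product of linear factors in \<open>g\<close>.
\<close>

lemma prime_divides_value_imp_divides_linear:
  assumes q: "prime_elem q" and "a \<noteq> 0" "q dvd eval_poly const_plane g a"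
  shows "\<exists>c. q dvd g - const_plane c"
  using assms(2,3)
proof (induction "degree a" arbitrary: a rule: less_induct)
  case less
  interpret ev: ring_morphism "eval_poly const_plane g"
    by (rule ring_morphism.ring_morphism_eval_poly[OF ring_morphism_const_plane])
  show ?case
  proof (cases "degree a = 0")
    case True
    then obtain c where a: "a = [:c:]" by (rule degree_eq_zeroE)
    then have "q dvd const_plane c"
      using less.prems by (simp add: ring_morphism.eval_poly_const ring_morphism_const_plane)
    moreover have "const_plane c dvd 1"
      using a less.prems by (simp add: is_unit_const_poly_iff dvd_field_iff)
    ultimately have "q dvd 1" by (rule dvd_trans)
    with q show ?thesis by (simp add: prime_elem_def)
  next
    case False
    then have "\<not> constant (poly a)" by (simp add: constant_degree)
    then obtain z where "poly a z = 0" using fundamental_theorem_of_algebra by blast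
    then obtain b where b: "a = [:-z, 1:] * b" by (auto simp: poly_eq_0_iff_dvd)
    then have "b \<noteq> 0" using less.prems by auto
    have "eval_poly const_plane g [:-z, 1:] = g - const_plane z"
      unfolding ring_morphism.eval_poly_pCons[OF ring_morphism_const_plane]
        ring_morphism.eval_poly_0[OF ring_morphism_const_plane]
      by (simp flip: one_pCons)
    then have "q dvd (g - const_plane z) * eval_poly const_plane g b"
      using less.prems(2) unfolding b ev.mult by simp
    moreover have "degree b < degree a"
      unfolding b using \<open>b \<noteq> 0\<close> by (subst degree_mult_eq) auto
    ultimately show ?thesis
      using less.hyps \<open>b \<noteq> 0\<close> q by (auto simp: prime_elem_dvd_mult_iff)
  qed
qed

text \<open>
  In the chart with coordinates \<open>u\<close> and \<open>v/u\<close>, the strict transform of the curve has the equation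
  \<open>w' = 1 + v + uv\<^sup>2\<close>, which is not a graph over the \<open>v\<close>-axis. Instead of proving it irreducible, it is
  shown that every prime factor \<open>q\<close> has the curve as its center. Otherwise the center
  contains a nonzero polynomial in \<open>v\<close> alone, so that \<open>q\<close> divides \<open>uv - c\<close> for some constant \<open>c\<close>.
  Together with \<open>w'\<close> this fixes the value of \<open>v\<close>, and then that of \<open>u\<close>, so that \<open>q\<close> would have
  only one zero.
\<close>

lemma center_chart_u_over_curve:
  assumes q: "prime_elem q" "\<not> q dvd u_coord" "q dvd pullback_u curve"
  shows "center_on_plane (U.dvr q) = {a. curve dvd a}"
proof -
  define w' where "w' = 1 + v_coord + u_coord * v_coord ^ 2"
  have "pullback_u curve = u_coord * w'"
    by (simp add: U.Q.hom pullback_simps w'_def algebra_simps power2_eq_square)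
  then have w': "q dvd w'" using q by (simp add: prime_elem_dvd_mult_iff)
  have "curve dvd a" if a: "q dvd pullback_u a" for a
  proof (rule ccontr)
    assume "\<not> curve dvd a"
    define f where "f = restrict_graph ([:0, 1:] * [:-1, -1:]) a"
    have "f \<noteq> 0"
      using \<open>\<not> curve dvd a\<close> unfolding curve_eq_graph graph_dvd_iff f_def .
    obtain r where "a - lift_v f = curve * r"
      using graph_dvd_diff unfolding f_def curve_eq_graph by (rule dvdE)
    then have "lift_v f = a - curve * r" by (simp add: algebra_simps)
    then have "pullback_u (lift_v f) = pullback_u a - pullback_u curve * pullback_u r"
      by (simp only: U.Q.diff U.Q.mult)
    then have "q dvd pullback_u (lift_v f)" using a q by simp
    moreover have "pullback_u (lift_v f) = eval_poly const_plane (u_coord * v_coord) f"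
      by (rule ring_morphism_poly_unique[OF ring_morphism_comp[OF U.Q lift_v.ring_morphism_axioms]
            ring_morphism.ring_morphism_eval_poly[OF ring_morphism_const_plane]])
        (simp_all add: lift_v_const lift_v_var pullback_simps
          ring_morphism.eval_poly_const ring_morphism.eval_poly_var ring_morphism_const_plane)
    ultimately obtain c where c: "q dvd u_coord * v_coord - const_plane c"
      using prime_divides_value_imp_divides_linear[OF q(1) \<open>f \<noteq> 0\<close>] by auto
    \<comment> \<open>The product \<open>uv\<close> is replaced by \<open>c\<close> in \<open>w'\<close>, which eliminates \<open>u\<close>.\<close>
    let ?s = "1 + const_plane (1 + c) * v_coord"
    have cc: "const_plane (1 + c) = 1 + const_plane c" by (simp add: one_pCons)
    have "?s = w' - v_coord * (u_coord * v_coord - const_plane c)"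
      unfolding cc w'_def by (simp add: algebra_simps power2_eq_square)
    then have s: "q dvd ?s" using w' c by simp
    show False
    proof (cases "c = -1")
      case True
      then show ?thesis using s q by (simp add: prime_elem_def)
    next
      case False
      \<comment> \<open>Modulo \<open>q\<close>, the inverse of \<open>v\<close> is \<open>-(1 + c)\<close>, so \<open>u\<close> is congruent to \<open>-(1 + c)c\<close>.\<close>
      define d where "d = - ((1 + c) * c)"
      have "const_plane d = - (const_plane (1 + c) * const_plane c)"
        by (simp add: d_def)
      then have "graph [:d:] = u_coord * ?s - const_plane (1 + c) * (u_coord * v_coord - const_plane c)"
        unfolding graph_def lift_v_const by (simp only: algebra_simps) simp
      then have "q dvd graph [:d:]" using s c by (metis dvd_diff dvd_mult)
      then have "graph [:d:] dvd q"
        using prime_elem_graph[of "[:d:]"] q(1)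
        by (meson irreducibleD' prime_elem_def prime_elem_imp_irreducible)
      then have "graph [:d:] dvd ?s" using s by (rule dvd_trans)
      then have "restrict_graph [:d:] ?s = 0" by (simp only: graph_dvd_iff)
      moreover have "restrict_graph [:d:] ?s = [:1, 1 + c:]"
        unfolding restrict_graph.hom restrict_graph_simps by (simp add: one_pCons)
      ultimately show False by simp
    qed
  qed
  moreover have "q dvd pullback_u a" if "curve dvd a" for a
    using that q(3) U.Q.dvd dvd_trans by blast
  ultimately show ?thesis using U.center_dvr[OF q(1)] by blast
qed

text \<open>
  Along all prime divisors but three, \<open>u\<close> and \<open>w\<close> are units.
\<close>

lemma prime_divisor_cases:
  assumes L: "L \<in> prime_divisors blowup_plane"
  obtains "L = V.dvr v_coord" | "L = V.dvr u_coord" | "L = V.dvr curve_v"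
  | "u_coord \<notin> center_on_plane L" "curve \<notin> center_on_plane L"
proof -
  consider q where "prime_elem q" "L = U.dvr q" | q where "prime_elem q" "L = V.dvr q"
    using L by (auto simp: prime_divisors_blowup)
  then show thesis
  proof cases
    case 1
    show thesis
    proof (cases "q dvd u_coord")
      case True
      then show thesis using 1 U.dvr_assoc prime_elem_u_coord exceptional_charts that(1) by metis
    next
      case False
      then have u: "u_coord \<notin> center_on_plane L" using 1 by (simp add: U.center_dvr pullback_simps)
      show thesis
      proof (cases "q dvd pullback_u curve")
        case True
        then have C: "center_on_plane L = {a. curve dvd a}"
          using center_chart_u_over_curve 1 False by simp
        have "V.dvr curve_v \<in> prime_divisors blowup_plane"
          using prime_elem_curve_v by (auto simp: prime_divisors_blowup)
        then have "L = V.dvr curve_v"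
          using prime_divisor_determined_by_center[OF L] C center_D3 u by simp
        then show thesis by (rule that(3))
      next
        case False
        then show thesis using that(4) u 1 by (simp add: U.center_dvr)
      qed
    qed
  next
    case 2
    show thesis
    proof (cases "q dvd v_coord \<or> q dvd u_coord \<or> q dvd curve_v")
      case True
      then show thesis
        using 2 V.dvr_assoc prime_elem_u_coord prime_elem_v_coord prime_elem_curve_v that(1-3) by metis
    next
      case False
      then show thesis
        using 2 that(4)
        by (auto simp: V.center_dvr pullback_v_curve pullback_simps(1) prime_elem_dvd_mult_iff)
    qed
  qed
qed

section \<open>Sections of the evaluated polyhedral divisor\<close>

definition pw :: plane_field where
  "pw = plane_fun curve"

definition russell_divisor :: "plane_field polyhedral_divisor" where
  "russell_divisor = [({1/2}, V.dvr curve_v), ({-1/3}, V.dvr u_coord), ({0..1/6}, V.dvr v_coord)]"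

lemma divisors_distinct:
  "V.dvr curve_v \<noteq> V.dvr u_coord" "V.dvr curve_v \<noteq> V.dvr v_coord" "V.dvr u_coord \<noteq> V.dvr v_coord"
proof -
  have "V.dvr q \<noteq> V.dvr p" if "prime_elem q" "prime_elem p" "\<not> q dvd p" for p q
    using V.maximal_ideal_iff[OF that(2), of p] V.maximal_ideal_iff[OF that(1), of p] that(3) by auto
  then show "V.dvr curve_v \<noteq> V.dvr u_coord" "V.dvr curve_v \<noteq> V.dvr v_coord"
    "V.dvr u_coord \<noteq> V.dvr v_coord"
    using prime_elem_curve_v prime_elem_u_coord prime_elem_v_coord not_dvd_coords by metis+
qed

lemma floor_evaluate_russell:
  "\<lfloor>evaluate russell_divisor n L\<rfloor> =
    (if L = V.dvr curve_v then n div 2 else if L = V.dvr u_coord then (- n) div 3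
     else if L = V.dvr v_coord then min 0 (n div 6) else 0)"
proof -
  have point: "(LEAST m. m \<in> (\<lambda>q. of_int n * q) ` {r}) = of_int n * (r::rat)" for r
    by (rule Least_equality) auto
  have interval: "(LEAST m. m \<in> (\<lambda>q. of_int n * q) ` {0..1/6::rat}) = min 0 (of_int n / 6)"
  proof (rule Least_equality)
    show "min 0 (of_int n / 6) \<in> (\<lambda>q. of_int n * q) ` {0..1/6::rat}"
    proof (cases "n \<ge> 0")
      case True
      then show ?thesis by (intro image_eqI[of _ _ 0]) auto
    next
      case False
      then show ?thesis by (intro image_eqI[of _ _ "1/6"]) auto
    qed
    fix y assume "y \<in> (\<lambda>q. of_int n * q) ` {0..1/6::rat}"
    then obtain q where q: "y = of_int n * q" "0 \<le> q" "q \<le> 1/6"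
      by (elim imageE) (simp only: atLeastAtMost_iff)
    show "min 0 (of_int n / 6) \<le> y"
    proof (cases "n \<ge> 0")
      case True
      then show ?thesis using q by (simp add: min_def)
    next
      case False
      then have "of_int n * (1/6) \<le> of_int n * q"
        using q by (intro mult_left_mono_neg) auto
      then show ?thesis using q by (simp add: min_def)
    qed
  qed
  define a b c :: rat where abc: "a = of_int n * (1/2)" "b = of_int n * (-1/3)" "c = min 0 (of_int n / 6)"
  have floors: "\<lfloor>a\<rfloor> = n div 2" "\<lfloor>b\<rfloor> = (- n) div 3" "\<lfloor>c\<rfloor> = min 0 (n div 6)"
  proof -
    show "\<lfloor>a\<rfloor> = n div 2"
      using floor_divide_of_int_eq[of n 2, where 'a = rat] by (simp add: abc)
    show "\<lfloor>b\<rfloor> = (- n) div 3"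
      using floor_divide_of_int_eq[of "- n" 3, where 'a = rat] by (simp add: abc)
    show "\<lfloor>c\<rfloor> = min 0 (n div 6)"
      using floor_divide_of_int_eq[of n 6, where 'a = rat]
      by (cases "n \<ge> 0") (auto simp: min_def abc)
  qed
  have ev: "evaluate russell_divisor n L = (if V.dvr curve_v = L then a else 0) +
      ((if V.dvr u_coord = L then b else 0) + (if V.dvr v_coord = L then c else 0))"
    unfolding abc by (simp only: evaluate_def russell_divisor_def list.map sum_list.Cons
        sum_list.Nil prod.case point interval add_0_right)
  consider "L = V.dvr curve_v" | "L = V.dvr u_coord" | "L = V.dvr v_coord"
    | "L \<noteq> V.dvr curve_v" "L \<noteq> V.dvr u_coord" "L \<noteq> V.dvr v_coord" by metis
  then show ?thesis
    unfolding ev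
    by cases (use divisors_distinct divisors_distinct[symmetric] in \<open>simp_all add: floors\<close>)
qed

lemma plane_monom_induct [case_names add monom]:
  fixes p :: plane_poly
  assumes add: "\<And>p q. P p \<Longrightarrow> P q \<Longrightarrow> P (p + q)" and monom: "\<And>a i j. P (monom (monom a i) j)"
  shows "P p"
proof (induction p rule: poly_monom_induct)
  case (monom q j)
  show ?case
    by (induction q rule: poly_monom_induct) (use assms in \<open>auto simp flip: add_monom\<close>)
qed (use add in auto)

lemma monom_monom_eq: "monom (monom a i) j = const_plane a * u_coord ^ i * v_coord ^ j"
proof -
  interpret c: ring_morphism "\<lambda>c. [:c:]" for c :: "'z::comm_ring_1" by (rule ring_morphism_const_poly)
  show ?thesis
    unfolding monom_eq_mult u_coord_def v_coord_def
    unfolding c.mult c.power by (rule refl)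
qed

lemma coeff_pullback_v:
  "coeff (coeff (pullback_v p) m) i = (if i \<le> m then coeff (coeff p (m - i)) i else 0)"
proof (induction p rule: plane_monom_induct)
  case (add p q)
  then show ?case by (simp add: V.Q.add)
next
  case (monom a k j)
  have "pullback_v (monom (monom a k) j) = monom (monom a k) (k + j)"
    unfolding monom_monom_eq V.Q.mult V.Q.power pullback_simps
    by (simp add: power_mult_distrib power_add mult_ac)
  then show ?case by auto
qed

lemma v_power_dvd_iff: "v_coord ^ k dvd p \<longleftrightarrow> (\<forall>m<k. coeff p m = 0)"
proof -
  have "v_coord ^ k = monom 1 k"
    by (induction k) (simp_all add: v_coord_def monom_Suc)
  then show ?thesis by (simp add: monom_1_dvd_iff')
qed

text \<open>
  The pullback turns \<open>u\<^sup>iv\<^sup>j\<close> into \<open>u\<^sup>iv\<^sup>i\<^sup>+\<^sup>j\<close>, and different monomials stay different. Hence the order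
  along the exceptional divisor is the multiplicity at the origin.
\<close>

lemma v_power_dvd_pullback_v_iff:
  "v_coord ^ k dvd pullback_v p \<longleftrightarrow> (\<forall>i j. coeff (coeff p j) i \<noteq> 0 \<longrightarrow> k \<le> i + j)"
proof
  assume *: "v_coord ^ k dvd pullback_v p"
  show "\<forall>i j. coeff (coeff p j) i \<noteq> 0 \<longrightarrow> k \<le> i + j"
  proof (intro allI impI)
    fix i j assume "coeff (coeff p j) i \<noteq> 0"
    then have "coeff (coeff (pullback_v p) (i + j)) i \<noteq> 0" by (simp add: coeff_pullback_v)
    then have "coeff (pullback_v p) (i + j) \<noteq> 0" by auto
    then show "k \<le> i + j" using * by (auto simp: v_power_dvd_iff not_le[symmetric])
  qed
next
  assume *: "\<forall>i j. coeff (coeff p j) i \<noteq> 0 \<longrightarrow> k \<le> i + j"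
  have "coeff (pullback_v p) m = 0" if "m < k" for m
  proof (rule poly_eqI)
    fix i
    have "i + (m - i) = m" if "i \<le> m" using that by simp
    then show "coeff (coeff (pullback_v p) m) i = coeff 0 i"
      using *[rule_format, of "m - i" i] \<open>m < k\<close> unfolding coeff_pullback_v
      by (cases "i \<le> m") auto
  qed
  then show "v_coord ^ k dvd pullback_v p" by (simp add: v_power_dvd_iff)
qed

text \<open>
  The function \<open>u\<^sup>a w\<^sup>-\<^sup>b\<close> with \<open>a = \<lceil>n/3\<rceil>\<close> and \<open>b = \<lfloor>n/2\<rfloor>\<close>. Its orders along \<open>D\<^sub>2\<close> and \<open>D\<^sub>3\<close> are the least ones
  that sections in degree \<open>n\<close> may have.
\<close>

definition degree_frame :: "int \<Rightarrow> plane_field" where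
  "degree_frame n = pu powi (- ((- n) div 3)) * pw powi (- (n div 2))"

text \<open>
  As \<open>u\<close> and \<open>w\<close> have order 1 along \<open>E\<close>, the frame has order \<open>a - b\<close> there and the condition along \<open>E\<close>
  asks for multiplicity at least \<open>b - a - \<lfloor>min 0 (n/6)\<rfloor>\<close> at the origin. For \<open>n \<ge> 0\<close> this is the bound
  below. For \<open>n < 0\<close> both bounds are at most 0 and hence hold for all polynomials.
\<close>

definition homogeneous_part :: "int \<Rightarrow> plane_field set" where
  "homogeneous_part n = {degree_frame n * plane_fun b | b.
    \<forall>i j. coeff (coeff b j) i \<noteq> 0 \<longrightarrow> n div 2 + (- n) div 3 \<le> int i + int j}"

lemma pw_nonzero [simp]: "pw \<noteq> 0"
  unfolding pw_def curve_eq_graph using prime_elem_graph by (auto simp: prime_elem_def)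

lemma degree_frame_nonzero [simp]: "degree_frame n \<noteq> 0"
  by (simp add: degree_frame_def)

lemma pu_chart_v: "pu = chart_v u_coord * chart_v v_coord"
  by (simp add: chart_v_simps)

lemma pw_chart_v: "pw = chart_v v_coord * chart_v curve_v"
  by (simp add: pw_def V.\<sigma>_Q[symmetric] pullback_v_curve V.mult)

lemma curve_v_nonzero [simp]: "curve_v \<noteq> 0"
  using prime_elem_curve_v by auto

lemma chart_v_nonzero: "chart_v v_coord \<noteq> 0" "chart_v u_coord \<noteq> 0" "chart_v curve_v \<noteq> 0"
  by simp_all

text \<open>
  In the chart with coordinates \<open>u/v\<close> and \<open>v\<close>, where \<open>D\<^sub>2\<close>, \<open>D\<^sub>3\<close> and \<open>E\<close> are all visible, the orders
  along the three divisors can be read off.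
\<close>

lemma degree_frame_chart_v:
  "degree_frame n = chart_v u_coord powi (- ((- n) div 3)) * chart_v curve_v powi (- (n div 2)) *
    chart_v v_coord powi (- (n div 2 + (- n) div 3))"
proof -
  have "degree_frame n = chart_v u_coord powi (- ((- n) div 3)) * chart_v curve_v powi (- (n div 2)) *
    (chart_v v_coord powi (- ((- n) div 3)) * chart_v v_coord powi (- (n div 2)))"
    unfolding degree_frame_def pu_chart_v pw_chart_v by (simp add: power_int_mult_distrib)
  also have "chart_v v_coord powi (- ((- n) div 3)) * chart_v v_coord powi (- (n div 2)) =
      chart_v v_coord powi (- (n div 2 + (- n) div 3))"
    by (subst power_int_add[symmetric]) (auto simp: algebra_simps)
  finally show ?thesis .
qed

lemma powi_cancel: "(a::'a::field) \<noteq> 0 \<Longrightarrow> a powi k * a powi l = a powi (k + l)"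
  by (simp add: power_int_add)

text \<open>
  Along a prime divisor other than \<open>D\<^sub>2\<close>, \<open>D\<^sub>3\<close> and \<open>E\<close> the frame is a unit. Along \<open>D\<^sub>2\<close> and
  \<open>D\<^sub>3\<close> it attains the bound, and along \<open>E\<close> the bound follows from the multiplicity of the polynomial
  at the origin.
\<close>

lemma homogeneous_part_subset_sections:
  assumes "f \<in> homogeneous_part n"
  shows "f \<in> sections blowup_plane (evaluate russell_divisor n)"
proof (cases "f = 0")
  case False
  obtain b where f: "f = degree_frame n * plane_fun b"
    and b: "\<And>i j. coeff (coeff b j) i \<noteq> 0 \<Longrightarrow> n div 2 + (- n) div 3 \<le> int i + int j"
    using assms by (auto simp: homogeneous_part_def)
  define k where "k = nat (n div 2 + (- n) div 3)"
  have "v_coord ^ k dvd pullback_v b"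
    unfolding v_power_dvd_pullback_v_iff using b by (fastforce simp: k_def)
  then obtain b' where b': "pullback_v b = v_coord ^ k * b'" by (rule dvdE)
  let ?x = "chart_v u_coord" and ?y = "chart_v v_coord" and ?z = "chart_v curve_v"
  have fb: "plane_fun b = chart_v (pullback_v b)" by (simp add: V.\<sigma>_Q)
  have "0 \<le> ord_along L f + \<lfloor>evaluate russell_divisor n L\<rfloor>"
    if L: "L \<in> prime_divisors blowup_plane" for L
    using L
  proof (cases rule: prime_divisor_cases)
    case 1
    note q = prime_elem_v_coord
    note dvr = V.mult_in_dvr[OF q] V.in_dvr[OF q] V.powi_in_dvr[OF q]
    define l where "l = int k - (n div 2 + (- n) div 3) + min 0 (n div 6)"
    \<comment> \<open>This is \<open>n/2 - n/3 = n/6\<close>, with the rounding taken into account.\<close>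
    have "2 * (n div 2) \<le> n" "3 * ((- n) div 3) \<le> - n" "n - 5 \<le> 6 * (n div 6)"
      by linarith+
    then have "n div 2 + (- n) div 3 \<le> n div 6" by linarith
    then have "l \<ge> 0" unfolding l_def k_def by linarith
    have "f * ?y powi (- (- min 0 (n div 6))) = ?x powi (- ((- n) div 3)) * ?z powi (- (n div 2)) *
        (?y powi (- (n div 2 + (- n) div 3)) * ?y powi int k * ?y powi min 0 (n div 6)) * chart_v b'"
      unfolding f fb degree_frame_chart_v b' by (simp add: V.mult V.power)
    also have "?y powi (- (n div 2 + (- n) div 3)) * ?y powi int k * ?y powi min 0 (n div 6) = ?y powi l"
      unfolding powi_cancel[OF chart_v_nonzero(1)] by (simp add: l_def algebra_simps)
    finally have "f * ?y powi (- (- min 0 (n div 6))) \<in> V.dvr v_coord"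
      using \<open>l \<ge> 0\<close> not_dvd_coords V.powi_in_dvr_iff[OF q] by (simp add: dvr)
    then have "- min 0 (n div 6) \<le> ord_along L f"
      unfolding 1 by (subst V.ord_along_ge_iff[OF q False])
    then show ?thesis using 1 divisors_distinct by (simp add: floor_evaluate_russell)
  next
    case 2
    note q = prime_elem_u_coord
    note dvr = V.mult_in_dvr[OF q] V.in_dvr[OF q] V.powi_in_dvr[OF q]
    have "f * ?x powi (- (- ((- n) div 3))) = ?z powi (- (n div 2)) *
        ?y powi (- (n div 2 + (- n) div 3)) * chart_v (pullback_v b) *
        (?x powi (- ((- n) div 3)) * ?x powi ((- n) div 3))"
      unfolding f fb degree_frame_chart_v by simp
    also have "\<dots> \<in> V.dvr u_coord"
      unfolding powi_cancel[OF chart_v_nonzero(2)] using not_dvd_coords by (simp add: dvr)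
    finally have "- ((- n) div 3) \<le> ord_along L f"
      unfolding 2 by (subst V.ord_along_ge_iff[OF q False])
    then show ?thesis using 2 divisors_distinct by (simp add: floor_evaluate_russell)
  next
    case 3
    note q = prime_elem_curve_v
    note dvr = V.mult_in_dvr[OF q] V.in_dvr[OF q] V.powi_in_dvr[OF q]
    have "f * ?z powi (- (- (n div 2))) = ?x powi (- ((- n) div 3)) *
        ?y powi (- (n div 2 + (- n) div 3)) * chart_v (pullback_v b) *
        (?z powi (- (n div 2)) * ?z powi (n div 2))"
      unfolding f fb degree_frame_chart_v by simp
    also have "\<dots> \<in> V.dvr curve_v"
      unfolding powi_cancel[OF chart_v_nonzero(3)] using not_dvd_coords by (simp add: dvr)
    finally have "- (n div 2) \<le> ord_along L f"
      unfolding 3 by (subst V.ord_along_ge_iff[OF q False])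
    then show ?thesis using 3 divisors_distinct by (simp add: floor_evaluate_russell)
  next
    case 4
    have *: "L \<noteq> V.dvr v_coord" "L \<noteq> V.dvr u_coord" "L \<noteq> V.dvr curve_v"
      using 4 coords_in_origin_ideal center_E center_D2 center_D3 by auto
    consider q where "prime_elem q" "L = U.dvr q" | q where "prime_elem q" "L = V.dvr q"
      using L by (auto simp: prime_divisors_blowup)
    then have "0 \<le> ord_along L f"
    proof cases
      case 1
      note dvr = U.mult_in_dvr[OF 1(1)] U.in_dvr[OF 1(1)] U.powi_in_dvr[OF 1(1)]
      have "f \<in> U.dvr q"
        unfolding f degree_frame_def pu_def pw_def U.\<sigma>_Q[symmetric]
        using 4 1 by (intro dvr) (simp_all add: U.center_dvr)
      then show ?thesis using 1 False by (simp add: U.in_dvr_of_nonneg_ord)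
    next
      case 2
      note dvr = V.mult_in_dvr[OF 2(1)] V.in_dvr[OF 2(1)] V.powi_in_dvr[OF 2(1)]
      have "f \<in> V.dvr q"
        unfolding f degree_frame_def pu_def pw_def V.\<sigma>_Q[symmetric]
        using 4 2 by (intro dvr) (simp_all add: V.center_dvr)
      then show ?thesis using 2 False by (simp add: V.in_dvr_of_nonneg_ord)
    qed
    then show ?thesis using * by (simp add: floor_evaluate_russell)
  qed
  then show ?thesis by (simp add: sections_def)
qed (simp add: sections_def)

lemma pullback_u_dvd_iff: "v_coord dvd pullback_u a \<longleftrightarrow> v_coord dvd a"
proof -
  obtain c r where a: "a = pCons c r" by (cases a)
  have "pullback_u [:c:] = [:c:]"
    by (rule ring_morphism_poly_unique[OF ring_morphism_comp[OF U.Q ring_morphism_const_poly]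
          ring_morphism_const_poly]) (simp_all add: pullback_simps flip: u_coord_def)
  moreover have "a = [:c:] + v_coord * r" by (simp add: a v_coord_def)
  ultimately have "pullback_u a = [:c:] + v_coord * (u_coord * pullback_u r)"
    by (simp only: U.Q.hom pullback_simps mult_ac)
  then have "v_coord dvd pullback_u a \<longleftrightarrow> v_coord dvd [:c:]"
    by (simp add: dvd_add_left_iff)
  also have "\<dots> \<longleftrightarrow> v_coord dvd a" by (simp add: v_coord_dvd_iff a)
  finally show ?thesis .
qed

text \<open>
  The strict transform of the \<open>u\<close>-axis \<open>v = 0\<close> is the only prime divisor missing from the chart
  with coordinates \<open>u/v\<close> and \<open>v\<close>. Its local ring detects the remaining denominators, which are powers of \<open>v\<close>.
\<close>

lemma v_power_dvd_of_regular:
  "plane_fun a / pv ^ m \<in> U.dvr v_coord \<Longrightarrow> v_coord ^ m dvd a"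
proof (induction m)
  case (Suc m)
  note q = prime_elem_v_coord
  have pv: "pv = chart_u (u_coord * v_coord)" by (simp add: U.mult chart_u_simps)
  have "plane_fun a / pv ^ m = plane_fun a / pv ^ Suc m * pv" by simp
  also have "\<dots> \<in> U.dvr v_coord"
    unfolding pv using Suc.prems pv by (intro U.mult_in_dvr U.in_dvr q) simp
  finally obtain a' where a': "a = v_coord ^ m * a'" using Suc.IH by (auto elim: dvdE)
  have "plane_fun a' = pv * (plane_fun a / pv ^ Suc m)"
    by (simp add: a' plane_fun.hom flip: pv_def)
  also have "\<dots> \<in> maximal_ideal_of (U.dvr v_coord)"
  proof (rule U.maximal_ideal_mult[OF q])
    show "pv \<in> maximal_ideal_of (U.dvr v_coord)"
      unfolding pv by (subst U.maximal_ideal_iff[OF q]) simp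
  qed (rule Suc.prems)
  finally have "v_coord dvd a'"
    using pullback_u_dvd_iff[of a'] q by (simp flip: U.\<sigma>_Q)
  then show ?case by (auto simp: a')
qed simp

text \<open>
  After removing the prescribed orders along \<open>D\<^sub>2\<close>, \<open>D\<^sub>3\<close> and \<open>E\<close>, a section has no pole in the chart
  with coordinates \<open>u/v\<close> and \<open>v\<close>, so it is a polynomial \<open>r\<close> in them. After division by the frame,
  the section is therefore \<open>r\<close> times a power of \<open>v\<close>, and its denominator is a power of \<open>v\<close> as well.
  There is no denominator, because the section has no pole along the strict transform of \<open>v = 0\<close>.
\<close>

lemma sections_subset_homogeneous_part:
  assumes "f \<in> sections blowup_plane (evaluate russell_divisor n)"
  shows "f \<in> homogeneous_part n"
proof (cases "f = 0")
  case True
  then have "f = degree_frame n * plane_fun 0" by (simp add: plane_fun.zero)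
  then show ?thesis unfolding homogeneous_part_def by (intro CollectI exI[of _ 0]) simp
next
  case False
  have ord: "- \<lfloor>evaluate russell_divisor n L\<rfloor> \<le> ord_along L f"
    if "L \<in> prime_divisors blowup_plane" for L
  proof -
    have "0 \<le> ord_along L f + \<lfloor>evaluate russell_divisor n L\<rfloor>"
      using assms that False unfolding sections_def by blast
    then show ?thesis by linarith
  qed
  have inV: "V.dvr q \<in> prime_divisors blowup_plane" if "prime_elem q" for q
    using that by (auto simp: prime_divisors_blowup)
  let ?x = "chart_v u_coord" and ?y = "chart_v v_coord" and ?z = "chart_v curve_v"
  define e where "e = min 0 (n div 6)"
  \<comment> \<open>The factors remove the orders that a section may have along the three divisors.\<close>
  define g where "g = f * ?x powi ((- n) div 3) * ?z powi (n div 2) * ?y powi e"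
  have "g \<in> V.dvr q" if q: "prime_elem q" for q
  proof -
    note dvr = V.mult_in_dvr[OF q] V.powi_in_dvr[OF q]
    consider "V.dvr q = V.dvr u_coord" | "V.dvr q = V.dvr v_coord" | "V.dvr q = V.dvr curve_v"
      | "V.dvr q \<noteq> V.dvr u_coord" "V.dvr q \<noteq> V.dvr v_coord" "V.dvr q \<noteq> V.dvr curve_v" by metis
    then show ?thesis
    proof cases
      case 1
      note q = prime_elem_u_coord
      have "f * ?x powi (- (- ((- n) div 3))) \<in> V.dvr u_coord"
        using ord[OF inV[OF q]] divisors_distinct
        by (subst V.ord_along_ge_iff[OF q False, symmetric]) (simp add: floor_evaluate_russell)
      then show ?thesis
        unfolding 1 g_def using not_dvd_coords
        by (simp add: V.mult_in_dvr[OF q] V.powi_in_dvr[OF q])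
    next
      case 2
      note q = prime_elem_v_coord
      have "f * ?y powi (- (- e)) \<in> V.dvr v_coord"
        using ord[OF inV[OF q]] divisors_distinct
        by (subst V.ord_along_ge_iff[OF q False, symmetric]) (simp add: floor_evaluate_russell e_def)
      then have "f * ?y powi (- (- e)) * ?x powi ((- n) div 3) * ?z powi (n div 2) \<in> V.dvr v_coord"
        using not_dvd_coords by (simp add: V.mult_in_dvr[OF q] V.powi_in_dvr[OF q])
      then show ?thesis unfolding 2 g_def by (simp add: mult_ac)
    next
      case 3
      note q = prime_elem_curve_v
      have "f * ?z powi (- (- (n div 2))) \<in> V.dvr curve_v"
        using ord[OF inV[OF q]] divisors_distinct
        by (subst V.ord_along_ge_iff[OF q False, symmetric]) (simp add: floor_evaluate_russell)
      then have "f * ?z powi (- (- (n div 2))) * ?x powi ((- n) div 3) * ?y powi e \<in> V.dvr curve_v"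
        using not_dvd_coords by (simp add: V.mult_in_dvr[OF q] V.powi_in_dvr[OF q])
      then show ?thesis unfolding 3 g_def by (simp add: mult_ac)
    next
      case 4
      then have "\<not> q dvd u_coord" "\<not> q dvd v_coord" "\<not> q dvd curve_v"
        using V.dvr_assoc[OF q] prime_elem_u_coord prime_elem_v_coord prime_elem_curve_v by blast+
      moreover have "f \<in> V.dvr q"
        using ord[OF inV[OF q]] 4 q False
        by (subst V.in_dvr_of_nonneg_ord[symmetric]) (simp_all add: floor_evaluate_russell)
      ultimately show ?thesis unfolding g_def by (intro dvr)
    qed
  qed
  then have "g \<in> range chart_v" by (rule V.in_range_if_in_all_dvr)
  then obtain r where r: "g = chart_v r" by blast
  define l where "l = n div 2 + (- n) div 3 - e"
  define h where "h = ?y powi l * chart_v r"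
  have "degree_frame n * h = f * (?x powi (- ((- n) div 3)) * ?x powi ((- n) div 3)) *
      (?z powi (- (n div 2)) * ?z powi (n div 2)) *
      (?y powi (- (n div 2 + (- n) div 3)) * ?y powi l * ?y powi e)"
    unfolding h_def degree_frame_chart_v r[symmetric] g_def by simp
  also have "\<dots> = f"
    by (simp add: powi_cancel l_def)
  finally have f: "f = degree_frame n * h" ..
  obtain m s where s: "v_coord ^ m * r = pullback_v s" using V.clear_denominators by blast
  have rs: "chart_v r = plane_fun s * ?y powi (- int m)"
  proof -
    have "plane_fun s = ?y ^ m * chart_v r"
      unfolding V.\<sigma>_Q[symmetric] s[symmetric] V.mult V.power ..
    then show ?thesis by (simp add: power_int_minus field_simps)
  qed
  have "\<exists>b. h = plane_fun b"
  proof (cases "l - int m \<ge> 0")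
    case True
    have "h = ?y powi (l - int m) * plane_fun s"
      unfolding h_def rs by (simp add: power_int_diff power_int_minus field_simps)
    also have "\<dots> = plane_fun (v_coord ^ nat (l - int m) * s)"
      using True by (simp add: plane_fun.hom power_int_def chart_v_simps pv_def)
    finally show ?thesis by blast
  next
    case False
    define t where "t = nat (int m - l)"
    have "h = ?y powi (- int t) * plane_fun s"
      unfolding h_def rs using False
      by (simp add: t_def power_int_diff power_int_minus field_simps)
    then have ht: "h = plane_fun s / pv ^ t"
      by (simp add: chart_v_simps power_int_minus divide_inverse)
    note q = prime_elem_v_coord
    have L: "U.dvr v_coord \<in> prime_divisors blowup_plane"
      using q by (auto simp: prime_divisors_blowup)
    have cu: "u_coord \<notin> center_on_plane (U.dvr v_coord)"
      "v_coord \<in> center_on_plane (U.dvr v_coord)"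
      using not_dvd_coords q by (simp_all add: U.center_dvr pullback_simps)
    then have ne: "U.dvr v_coord \<noteq> V.dvr v_coord" "U.dvr v_coord \<noteq> V.dvr u_coord"
      "U.dvr v_coord \<noteq> V.dvr curve_v"
      using coords_in_origin_ideal center_E center_D2 center_D3 not_dvd_coords by auto
    then have "0 \<le> ord_along (U.dvr v_coord) f"
      using ord[OF L] by (simp add: floor_evaluate_russell)
    then have "f \<in> U.dvr v_coord" using q \<open>f \<noteq> 0\<close> by (simp add: U.in_dvr_of_nonneg_ord)
    have "\<not> v_coord dvd pullback_u u_coord"
      using cu q by (simp add: U.center_dvr)
    moreover have "\<not> v_coord dvd pullback_u curve"
      using pullback_u_dvd_iff[of curve] not_dvd_coords
      by (simp add: dvd_add_left_iff power2_eq_square)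
    ultimately have "f * pu powi ((- n) div 3) * pw powi (n div 2) \<in> U.dvr v_coord"
      using \<open>f \<in> U.dvr v_coord\<close>
      unfolding pu_def pw_def U.\<sigma>_Q[symmetric]
      by (intro U.mult_in_dvr[OF q] U.powi_in_dvr[OF q])
    moreover have "f * pu powi ((- n) div 3) * pw powi (n div 2) = h *
        (pu powi (- ((- n) div 3)) * pu powi ((- n) div 3)) * (pw powi (- (n div 2)) * pw powi (n div 2))"
      unfolding f degree_frame_def by simp
    then have "f * pu powi ((- n) div 3) * pw powi (n div 2) = h"
      by (simp add: powi_cancel)
    ultimately have "v_coord ^ t dvd s" using ht v_power_dvd_of_regular by simp
    then obtain b where "s = v_coord ^ t * b" by (rule dvdE)
    then have "h = plane_fun b" by (simp add: ht plane_fun.hom flip: pv_def)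
    then show ?thesis by blast
  qed
  then obtain b where b: "h = plane_fun b" by blast
  have "n div 2 + (- n) div 3 \<le> int i + int j" if ij: "coeff (coeff b j) i \<noteq> 0" for i j
  proof (cases "n div 2 + (- n) div 3 \<ge> 0")
    case True
    define k where "k = nat (n div 2 + (- n) div 3)"
    have "l \<ge> 0" using True by (simp add: l_def e_def)
    then have "chart_v (pullback_v b) = chart_v (v_coord ^ nat l * r)"
      unfolding V.\<sigma>_Q b[symmetric] h_def by (simp add: V.hom power_int_def)
    then have "pullback_v b = v_coord ^ nat l * r" by simp
    moreover have "k \<le> nat l" unfolding k_def l_def e_def by (intro nat_mono) simp
    ultimately have "v_coord ^ k dvd pullback_v b" by (simp add: le_imp_power_dvd)
    then have "k \<le> i + j" using ij by (simp add: v_power_dvd_pullback_v_iff)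
    then show ?thesis unfolding k_def by linarith
  qed simp
  then show ?thesis unfolding homogeneous_part_def using f b by blast
qed

lemma sections_russell:
  "sections blowup_plane (evaluate russell_divisor n) = homogeneous_part n"
  using sections_subset_homogeneous_part homogeneous_part_subset_sections by blast

section \<open>Polynomials in four variables\<close>

type_synonym space_poly = "complex poly poly poly poly"

definition eval4 :: "(complex \<Rightarrow> 'b::comm_ring_1) \<Rightarrow> 'b \<Rightarrow> 'b \<Rightarrow> 'b \<Rightarrow> 'b \<Rightarrow> space_poly \<Rightarrow> 'b" where
  "eval4 h x y z t = eval_poly (eval_poly (eval_poly (eval_poly h x) y) t) z"

abbreviation const_space :: "complex \<Rightarrow> space_poly" where
  "const_space c \<equiv> [:[:[:[:c:]:]:]:]"

definition x_coord :: space_poly where "x_coord = [:[:[:[:0, 1:]:]:]:]"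
definition y_coord :: space_poly where "y_coord = [:[:[:0, 1:]:]:]"
definition z_coord :: space_poly where "z_coord = [:0, 1:]"
definition t_coord :: space_poly where "t_coord = [:[:0, 1:]:]"

lemma ring_morphism_const_space: "ring_morphism const_space"
  by unfold_locales (simp_all add: one_pCons)

context
  fixes h :: "complex \<Rightarrow> 'b::comm_ring_1"
  assumes h: "ring_morphism h"
begin

lemma ring_morphism_eval4: "ring_morphism (eval4 h x y z t)"
  unfolding eval4_def by (intro ring_morphism.ring_morphism_eval_poly h)

lemma eval4_simps:
  "eval4 h x y z t (const_space c) = h c" "eval4 h x y z t x_coord = x"
  "eval4 h x y z t y_coord = y" "eval4 h x y z t z_coord = z" "eval4 h x y z t t_coord = t"
proof -
  note 1 = ring_morphism.ring_morphism_eval_poly[OF h]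
  note 2 = ring_morphism.ring_morphism_eval_poly[OF 1]
  note 3 = ring_morphism.ring_morphism_eval_poly[OF 2]
  note simps = h[THEN ring_morphism.eval_poly_const] h[THEN ring_morphism.eval_poly_var]
    1[THEN ring_morphism.eval_poly_const] 1[THEN ring_morphism.eval_poly_var]
    2[THEN ring_morphism.eval_poly_const] 2[THEN ring_morphism.eval_poly_var]
    3[THEN ring_morphism.eval_poly_const] 3[THEN ring_morphism.eval_poly_var]
  show "eval4 h x y z t (const_space c) = h c" "eval4 h x y z t x_coord = x"
    "eval4 h x y z t y_coord = y" "eval4 h x y z t z_coord = z" "eval4 h x y z t t_coord = t"
    unfolding eval4_def x_coord_def y_coord_def z_coord_def t_coord_def
    by (simp_all only: simps)
qed

end

lemma ring_morphism_space_unique: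
  fixes f g :: "space_poly \<Rightarrow> 'b::comm_ring_1"
  assumes f: "ring_morphism f" and g: "ring_morphism g"
    and *: "\<And>c. f (const_space c) = g (const_space c)" "f x_coord = g x_coord" "f y_coord = g y_coord"
      "f z_coord = g z_coord" "f t_coord = g t_coord"
  shows "f p = g p"
proof (rule ring_morphism_poly_unique[OF f g])
  note c = ring_morphism_comp[OF _ ring_morphism_const_poly]
  fix q
  show "f [:q:] = g [:q:]"
  proof (rule ring_morphism_poly_unique[OF c[OF f] c[OF g]])
    fix r
    show "f [:[:r:]:] = g [:[:r:]:]"
    proof (rule ring_morphism_poly_unique[OF c[OF c[OF f]] c[OF c[OF g]]])
      fix s
      show "f [:[:[:s:]:]:] = g [:[:[:s:]:]:]"
        by (rule ring_morphism_poly_unique[OF c[OF c[OF c[OF f]]] c[OF c[OF c[OF g]]]])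
          (use * in \<open>simp_all add: x_coord_def\<close>)
    qed (use * in \<open>simp add: y_coord_def\<close>)
  qed (use * in \<open>simp add: t_coord_def\<close>)
qed (use * in \<open>simp add: z_coord_def\<close>)

abbreviation monom3 :: "complex \<Rightarrow> nat \<Rightarrow> nat \<Rightarrow> nat \<Rightarrow> complex poly poly poly" where
  "monom3 a i j k \<equiv> monom (monom (monom a i) j) k"

lemma monom3_induct [case_names add monom]:
  assumes add: "\<And>p q. P p \<Longrightarrow> P q \<Longrightarrow> P (p + q)" and monom: "\<And>a i j k. P (monom3 a i j k)"
  shows "P p"
proof (induction p rule: poly_monom_induct)
  case (monom q k)
  show ?case
  proof (induction q rule: poly_monom_induct)
    case (monom r j)
    show ?case
      by (induction r rule: poly_monom_induct) (use assms in \<open>auto simp flip: add_monom\<close>)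
  qed (use add in \<open>auto simp flip: add_monom\<close>)
qed (use add in auto)

lemma monom4_eq:
  "monom (monom3 a i j k) l = const_space a * x_coord ^ i * y_coord ^ j * t_coord ^ k * z_coord ^ l"
proof -
  interpret c: ring_morphism "\<lambda>c. [:c:]" for c :: "'z::comm_ring_1" by (rule ring_morphism_const_poly)
  show ?thesis
    unfolding monom_eq_mult x_coord_def y_coord_def z_coord_def t_coord_def
    unfolding c.mult c.power by (rule refl)
qed

section \<open>Division by the equation of the cubic\<close>

text \<open>
  The constant term \<open>x + x\<^sup>2y + t\<^sup>3\<close> of the equation as a polynomial in \<open>z\<close>. In the iterated polynomial
  ring, \<open>x\<close> is the innermost variable, followed by \<open>y\<close> and \<open>t\<close>.
\<close>

definition russell_constant_term :: "complex poly poly poly" where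
  "russell_constant_term = [:[:[:0, 1:], [:0, 0, 1:]:], 0, 0, 1:]"

definition russell_poly :: space_poly where
  "russell_poly = [:russell_constant_term, 0, 1:]"

lemma russell_poly_eq: "russell_poly = x_coord + x_coord ^ 2 * y_coord + z_coord ^ 2 + t_coord ^ 3"
  by (simp add: russell_poly_def russell_constant_term_def x_coord_def y_coord_def z_coord_def
      t_coord_def power2_eq_square power3_eq_cube one_pCons)

lemma divide_by_russell_poly: "\<exists>q a b. p = russell_poly * q + [:a, b:]"
proof (induction p)
  case 0
  show ?case by (intro exI[of _ 0]) simp
next
  case (pCons c p)
  then obtain q a b where "p = russell_poly * q + [:a, b:]" by blast
  then have "pCons c p = russell_poly * (pCons 0 q) + [:c, a, b:]" by simp
  also have "[:c, a, b:] = russell_poly * [:b:] + [:c - russell_constant_term * b, a:]"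
    by (simp add: russell_poly_def)
  finally have "pCons c p =
      russell_poly * (pCons 0 q + [:b:]) + [:c - russell_constant_term * b, a:]"
    by (simp only: distrib_left add.assoc)
  then show ?case by blast
qed

section \<open>Regular functions on the cubic\<close>

definition eval_at :: "point4 \<Rightarrow> space_poly \<Rightarrow> complex" where
  "eval_at = (\<lambda>(x, y, z, t). eval4 (\<lambda>c. c) x y z t)"

lemma ring_morphism_eval_at: "ring_morphism (eval_at pt)"
  by (cases pt) (simp add: eval_at_def ring_morphism_eval4 ring_morphism_ident)

interpretation eval_at: ring_morphism "eval_at pt" for pt
  by (rule ring_morphism_eval_at)

lemma eval_at_simps:
  "eval_at (x, y, z, t) (const_space c) = c" "eval_at (x, y, z, t) x_coord = x"
  "eval_at (x, y, z, t) y_coord = y" "eval_at (x, y, z, t) z_coord = z"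
  "eval_at (x, y, z, t) t_coord = t"
  by (simp_all add: eval_at_def eval4_simps ring_morphism_ident)

lemma space_poly_induct [case_names const x y z t add mult]:
  assumes "\<And>c. P (const_space c)" "P x_coord" "P y_coord" "P z_coord" "P t_coord"
    and add: "\<And>p q. P p \<Longrightarrow> P q \<Longrightarrow> P (p + q)" and mult: "\<And>p q. P p \<Longrightarrow> P q \<Longrightarrow> P (p * q)"
  shows "P p"
proof (induction p rule: poly_monom_induct)
  case (monom q l)
  have power: "P q \<Longrightarrow> P (q ^ n)" for q n
    by (induction n) (use assms(1)[of 1] mult in \<open>auto simp: one_pCons\<close>)
  show ?case
  proof (induction q rule: monom3_induct)
    case (add p q)
    then show ?case using assms(6) by (simp flip: add_monom)
  next
    case (monom a i j k)
    show ?case unfolding monom4_eq by (intro mult power assms)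
  qed
qed (use add in auto)

lemma polynomial_functions4_eq: "polynomial_functions4 = range (\<lambda>p pt. eval_at pt p)"
proof (intro equalityI subsetI)
  fix f assume "f \<in> polynomial_functions4"
  then show "f \<in> range (\<lambda>p pt. eval_at pt p)"
  proof induction
    case (const c)
    show ?case by (rule range_eqI[of _ _ "const_space c"]) (auto simp: eval_at_simps)
  next
    case x
    show ?case by (rule range_eqI[of _ _ x_coord]) (auto simp: eval_at_simps)
  next
    case y
    show ?case by (rule range_eqI[of _ _ y_coord]) (auto simp: eval_at_simps)
  next
    case z
    show ?case by (rule range_eqI[of _ _ z_coord]) (auto simp: eval_at_simps)
  next
    case t
    show ?case by (rule range_eqI[of _ _ t_coord]) (auto simp: eval_at_simps)
  next
    case (add f g)
    then obtain p q where "f = (\<lambda>pt. eval_at pt p)" "g = (\<lambda>pt. eval_at pt q)" by blast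
    then show ?case by (intro range_eqI[of _ _ "p + q"]) (auto simp: eval_at.add)
  next
    case (mult f g)
    then obtain p q where "f = (\<lambda>pt. eval_at pt p)" "g = (\<lambda>pt. eval_at pt q)" by blast
    then show ?case by (intro range_eqI[of _ _ "p * q"]) (auto simp: eval_at.mult)
  qed
next
  fix f assume "f \<in> range (\<lambda>p pt. eval_at pt p)"
  then obtain p where f: "f = (\<lambda>pt. eval_at pt p)" by blast
  have "(\<lambda>pt. eval_at pt p) \<in> polynomial_functions4"
  proof (induction p rule: space_poly_induct)
    case (const c)
    have "(\<lambda>pt. eval_at pt (const_space c)) = (\<lambda>_. c)" by (auto simp: eval_at_simps)
    then show ?case by (simp add: polynomial_functions4.const)
  next
    case x
    have "(\<lambda>pt. eval_at pt x_coord) = (\<lambda>(x, y, z, t). x)" by (auto simp: eval_at_simps)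
    then show ?case using polynomial_functions4.x by simp
  next
    case y
    have "(\<lambda>pt. eval_at pt y_coord) = (\<lambda>(x, y, z, t). y)" by (auto simp: eval_at_simps)
    then show ?case using polynomial_functions4.y by simp
  next
    case z
    have "(\<lambda>pt. eval_at pt z_coord) = (\<lambda>(x, y, z, t). z)" by (auto simp: eval_at_simps)
    then show ?case using polynomial_functions4.z by simp
  next
    case t
    have "(\<lambda>pt. eval_at pt t_coord) = (\<lambda>(x, y, z, t). t)" by (auto simp: eval_at_simps)
    then show ?case using polynomial_functions4.t by simp
  qed (auto simp: eval_at.hom intro: polynomial_functions4.add polynomial_functions4.mult)
  then show "f \<in> polynomial_functions4" by (simp add: f)
qed

lemma eval_poly_vanishing:
  fixes h :: "'a::comm_ring_1 \<Rightarrow> complex"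
  assumes "ring_morphism h" "\<And>a. eval_poly h a p = 0"
  shows "h (coeff p n) = 0"
proof -
  interpret ring_morphism h by fact
  have "map_poly h p = 0"
    using assms(2) by (simp add: eval_poly_def poly_all_0_iff_0[symmetric])
  then have "coeff (map_poly h p) n = 0" by simp
  then show ?thesis by (simp add: coeff_map_poly zero)
qed

lemma poly3_vanishing:
  assumes "\<And>x y t. eval_poly (eval_poly (eval_poly (\<lambda>c. c) x) y) t p = (0::complex)"
  shows "p = 0"
proof (rule poly_eqI)+
  note * = ring_morphism.ring_morphism_eval_poly
  fix i j k
  have "eval_poly (eval_poly (\<lambda>c. c) x) y (coeff p k) = 0" for x y
    by (rule eval_poly_vanishing[OF *[OF *[OF ring_morphism_ident]] assms])
  then have "eval_poly (\<lambda>c. c) x (coeff (coeff p k) j) = 0" for x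
    by (rule eval_poly_vanishing[OF *[OF ring_morphism_ident]])
  then have "coeff (coeff (coeff p k) j) i = 0"
    by (rule eval_poly_vanishing[OF ring_morphism_ident])
  then show "coeff (coeff (coeff p k) j) i = coeff (coeff (coeff 0 k) j) i" by simp
qed

lemma eval_at_russell_poly: "eval_at pt russell_poly = 0 \<longleftrightarrow> pt \<in> russell_cubic_points"
  by (cases pt) (simp add: russell_poly_eq eval_at.hom eval_at_simps russell_cubic_points_def)

text \<open>
  Over \<open>(x,y,t)\<close> the cubic has the points with \<open>z\<^sup>2 = -g\<close>, where \<open>g = x + x\<^sup>2y + t\<^sup>3\<close>. As \<open>a + bz\<close>
  vanishes for both signs of \<open>z\<close>, the functions \<open>a\<close> and \<open>zb\<close> vanish, hence also \<open>gb = -z\<^sup>2b\<close>.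
\<close>

lemma linear_vanishing_on_cubic:
  assumes "\<And>pt. pt \<in> russell_cubic_points \<Longrightarrow> eval_at pt [:a, b:] = 0"
  shows "a = 0 \<and> b = 0"
proof -
  define e where "e = (\<lambda>x y t. eval_poly (eval_poly (eval_poly (\<lambda>c. c::complex) x) y) t)"
  have e: "ring_morphism (e x y t)" for x y t
    unfolding e_def by (intro ring_morphism.ring_morphism_eval_poly ring_morphism_ident)
  have eval: "eval_at (x, y, z, t) [:c, d:] = e x y t c + z * e x y t d" for x y z t c d
    using ring_morphism.eval_poly_pCons[OF e] ring_morphism.eval_poly_0[OF e]
    by (simp add: eval_at_def eval4_def e_def)
  \<comment> \<open>The coefficients of a polynomial in \<open>z\<close> are evaluated by \<open>e\<close>, independently of \<open>z\<close>.\<close>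
  have eq: "eval_at (x, y, z, t) russell_poly = e x y t russell_constant_term + z ^ 2" for x y z t
    using ring_morphism.eval_poly_pCons[OF e] ring_morphism.eval_poly_0[OF e]
      ring_morphism.zero[OF e] ring_morphism.one[OF e]
    by (simp add: eval_at_def eval4_def e_def russell_poly_def power2_eq_square)
  have *: "e x y t a = 0 \<and> e x y t (russell_constant_term * b) = 0" for x y t
  proof -
    define z where "z = csqrt (- e x y t russell_constant_term)"
    have z2: "z ^ 2 = - e x y t russell_constant_term" by (simp add: z_def)
    then have "(x, y, z, t) \<in> russell_cubic_points" "(x, y, - z, t) \<in> russell_cubic_points"
      by (simp_all add: eq flip: eval_at_russell_poly)
    then have "e x y t a + z * e x y t b = 0" "e x y t a - z * e x y t b = 0"
      using assms eval by fastforce+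
    then have "e x y t a = 0" "z * e x y t b = 0"
      by (auto simp: algebra_simps)
    moreover have "e x y t (russell_constant_term * b) = - (z ^ 2) * e x y t b"
      by (simp add: ring_morphism.mult[OF e] z2)
    ultimately show ?thesis by (auto simp: power2_eq_square)
  qed
  have "a = 0" using * by (intro poly3_vanishing) (simp add: e_def)
  moreover have "russell_constant_term * b = 0" using * by (intro poly3_vanishing) (simp add: e_def)
  moreover have "russell_constant_term \<noteq> 0" by (simp add: russell_constant_term_def)
  ultimately show ?thesis by simp
qed

lemma vanishing_on_cubic_iff:
  "(\<forall>pt\<in>russell_cubic_points. eval_at pt p = 0) \<longleftrightarrow> russell_poly dvd p"
proof
  obtain q a b where p: "p = russell_poly * q + [:a, b:]" using divide_by_russell_poly by blast
  assume "\<forall>pt\<in>russell_cubic_points. eval_at pt p = 0"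
  then have "eval_at pt [:a, b:] = 0" if "pt \<in> russell_cubic_points" for pt
    using that eval_at_russell_poly[of pt] by (auto simp: p eval_at.add eval_at.mult)
  then have "a = 0 \<and> b = 0" by (rule linear_vanishing_on_cubic)
  then show "russell_poly dvd p" by (simp add: p)
next
  assume "russell_poly dvd p"
  then show "\<forall>pt\<in>russell_cubic_points. eval_at pt p = 0"
    using eval_at_russell_poly by (auto simp: dvd_def eval_at.mult)
qed

section \<open>Generators of the section algebra\<close>

lemma single_power: "Poly_Mapping.single (n::int) (a::'a::comm_ring_1) ^ k = Poly_Mapping.single (int k * n) (a ^ k)"
  by (induction k) (simp_all add: mult_single algebra_simps)

text \<open>
  The coordinates of the cubic as homogeneous rational functions, in the order \<open>x, y, z, t\<close>.
\<close>

definition laurent :: "space_poly \<Rightarrow> (int \<Rightarrow>\<^sub>0 plane_field)" where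
  "laurent = eval4 (\<lambda>c. Poly_Mapping.single 0 (plane_const c))
    (Poly_Mapping.single 6 (pu ^ 2 * pv / pw ^ 3)) (Poly_Mapping.single (- 6) (pw ^ 3 / pu ^ 2))
    (Poly_Mapping.single 3 (plane_const \<i> * (pu / pw))) (Poly_Mapping.single 2 (pu / pw))"

lemma ring_morphism_single_const: "ring_morphism (\<lambda>c. Poly_Mapping.single (0::int) (plane_const c))"
  by unfold_locales (simp_all add: plane_const.hom single_add mult_single)

interpretation laurent: ring_morphism laurent
  unfolding laurent_def by (intro ring_morphism_eval4 ring_morphism_single_const)

lemma laurent_simps:
  "laurent (const_space c) = Poly_Mapping.single 0 (plane_const c)"
  "laurent x_coord = Poly_Mapping.single 6 (pu ^ 2 * pv / pw ^ 3)"
  "laurent y_coord = Poly_Mapping.single (- 6) (pw ^ 3 / pu ^ 2)"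
  "laurent z_coord = Poly_Mapping.single 3 (plane_const \<i> * (pu / pw))"
  "laurent t_coord = Poly_Mapping.single 2 (pu / pw)"
  by (simp_all add: laurent_def eval4_simps ring_morphism_single_const)

lemma pw_eq: "pw = pu + pv + pv ^ 2"
  by (simp add: pw_def pu_def pv_def plane_fun.hom)

lemma laurent_russell_poly: "laurent russell_poly = 0"
proof -
  have "(a ^ 2 * b / c) ^ 2 * (c / a ^ 2) = a ^ 2 * b ^ 2 / c"
    if "a \<noteq> 0" "c \<noteq> 0" for a b c :: plane_field
    using that by (simp add: power2_eq_square)
  then have "(pu ^ 2 * pv / pw ^ 3) ^ 2 * (pw ^ 3 / pu ^ 2) = pu ^ 2 * pv ^ 2 / pw ^ 3"
    by simp
  moreover have "(pu / pw) ^ 3 = pu ^ 2 * pu / pw ^ 3"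
    by (simp add: power_divide power2_eq_square power3_eq_cube)
  ultimately have "(pu ^ 2 * pv / pw ^ 3) + (pu ^ 2 * pv / pw ^ 3) ^ 2 * (pw ^ 3 / pu ^ 2) + (pu / pw) ^ 3 =
      pu ^ 2 * (pu + pv + pv ^ 2) / pw ^ 3"
    by (simp only: add_divide_distrib distrib_left) (simp only: add_ac)
  also have "\<dots> = (pu / pw) ^ 2"
    unfolding pw_eq[symmetric] by (simp add: power2_eq_square power3_eq_cube)
  finally have "(pu ^ 2 * pv / pw ^ 3) + (pu ^ 2 * pv / pw ^ 3) ^ 2 * (pw ^ 3 / pu ^ 2) + (pu / pw) ^ 3 =
      (pu / pw) ^ 2" .
  moreover have "(plane_const \<i> * (pu / pw)) ^ 2 = - ((pu / pw) ^ 2)"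
    unfolding power_mult_distrib plane_const.power[symmetric]
    by (simp add: plane_const.uminus plane_const.one)
  moreover have "a + b + c + d = 0" if "a + b + d = e" "c = - e" for a b c d e :: plane_field
    using that by auto
  ultimately have *: "(pu ^ 2 * pv / pw ^ 3) + (pu ^ 2 * pv / pw ^ 3) ^ 2 * (pw ^ 3 / pu ^ 2) +
      (plane_const \<i> * (pu / pw)) ^ 2 + (pu / pw) ^ 3 = 0"
    by blast
  show ?thesis
    unfolding russell_poly_eq laurent.hom laurent_simps single_power mult_single
    using * by (simp flip: single_add)
qed

text \<open>
  The exponent of \<open>w\<close> in the image of a monomial depends on the degree only, and that of \<open>u\<close> exceeds
  its value in the frame by \<open>k div 3\<close>, since \<open>t\<^sup>3\<close> contributes one factor \<open>u = yt\<^sup>3\<close>.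
\<close>

lemma laurent_monom:
  fixes i j k l :: nat
  assumes "l < 2"
  defines "n \<equiv> 6 * int i - 6 * int j + 2 * int k + 3 * int l"
  shows "laurent (monom (monom3 a i j k) l) =
    Poly_Mapping.single n (degree_frame n * plane_fun (monom (monom (a * \<i> ^ l) (k div 3)) i))"
proof -
  have l: "l = 0 \<or> l = 1" using assms(1) by auto
  have exp: "- ((- n) div 3) + int (k div 3) = 2 * int i - 2 * int j + int k + int l"
    "n div 2 = 3 * int i - 3 * int j + int k + int l"
  proof -
    have k: "k = 3 * (k div 3) + k mod 3" "k mod 3 = 0 \<or> k mod 3 = 1 \<or> k mod 3 = 2" by auto
    then show "- ((- n) div 3) + int (k div 3) = 2 * int i - 2 * int j + int k + int l"
      using l unfolding n_def by linarith
    show "n div 2 = 3 * int i - 3 * int j + int k + int l"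
      using l unfolding n_def by linarith
  qed
  have "laurent (monom (monom3 a i j k) l) = Poly_Mapping.single n (plane_const a *
      (pu ^ 2 * pv / pw ^ 3) ^ i * (pw ^ 3 / pu ^ 2) ^ j * (pu / pw) ^ k * (plane_const \<i> * (pu / pw)) ^ l)"
    unfolding monom4_eq laurent.hom laurent_simps single_power mult_single n_def
    by (simp add: algebra_simps)
  also have "plane_const a * (pu ^ 2 * pv / pw ^ 3) ^ i * (pw ^ 3 / pu ^ 2) ^ j * (pu / pw) ^ k *
      (plane_const \<i> * (pu / pw)) ^ l = plane_const (a * \<i> ^ l) * pv ^ i *
      (pu powi (2 * int i - 2 * int j + int k + int l) * pw powi (- (3 * int i - 3 * int j + int k + int l)))"
  proof -
    have "(pu ^ 2 * pv / pw ^ 3) ^ i = pv ^ i * (pu powi (2 * int i) * pw powi (- (3 * int i)))"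
      "(pw ^ 3 / pu ^ 2) ^ j = pu powi (- (2 * int j)) * pw powi (3 * int j)"
      "(pu / pw) ^ m = pu powi int m * pw powi (- int m)" for m
      using power_int_of_nat[of pu "2 * i"] power_int_of_nat[of pw "3 * i"]
        power_int_of_nat[of pu "2 * j"] power_int_of_nat[of pw "3 * j"]
      by (simp_all add: power_mult_distrib power_divide power_mult power_int_minus divide_inverse
          power_inverse)
    then have "plane_const a * (pu ^ 2 * pv / pw ^ 3) ^ i * (pw ^ 3 / pu ^ 2) ^ j * (pu / pw) ^ k *
      (plane_const \<i> * (pu / pw)) ^ l = plane_const (a * \<i> ^ l) * pv ^ i *
      ((pu powi (2 * int i) * pu powi (- (2 * int j)) * pu powi int k * pu powi int l) *
       (pw powi (- (3 * int i)) * pw powi (3 * int j) * pw powi (- int k) * pw powi (- int l)))"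
      by (simp only: power_mult_distrib plane_const.mult plane_const.power) (simp only: mult_ac)
    then show ?thesis
      unfolding powi_cancel[OF puv_nonzero(1)] powi_cancel[OF pw_nonzero]
      by (simp add: algebra_simps)
  qed
  also have "\<dots> = plane_const (a * \<i> ^ l) * pv ^ i * (degree_frame n * pu powi int (k div 3))"
    unfolding exp[symmetric] degree_frame_def powi_cancel[OF puv_nonzero(1), symmetric]
    by (simp only: mult_ac)
  also have "\<dots> = degree_frame n * plane_fun (monom (monom (a * \<i> ^ l) (k div 3)) i)"
    unfolding monom_monom_eq power_int_of_nat plane_fun.mult plane_fun.power
      plane_const_def pu_def pv_def by (simp only: mult_ac)
  finally show ?thesis .
qed

text \<open>
  The exponents of \<open>y\<close> and \<open>t\<close> in the monomial of degree \<open>n\<close> with image a multiple of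
  \<open>f\<^sub>n u\<^sup>i v\<^sup>j\<close>; its exponents of \<open>x\<close> and \<open>z\<close> are \<open>j\<close> and \<open>n mod 2\<close>.
\<close>

definition y_exponent :: "int \<Rightarrow> nat \<Rightarrow> nat \<Rightarrow> int" where
  "y_exponent n i j = int i + int j - (n div 2 + (- n) div 3)"

definition t_exponent :: "int \<Rightarrow> nat \<Rightarrow> int" where
  "t_exponent n i = 3 * int i - 3 * ((- n) div 3) - n"

text \<open>
  Only the exponent of \<open>y\<close> can be negative in the inverse direction. Its being nonnegative is the
  condition on multiplicities in the description of the sections.
\<close>

lemma exponents_iff:
  fixes i j k l i' :: nat
  assumes "l < 2"
  shows "n = 6 * int i - 6 * int j + 2 * int k + 3 * int l \<and> i' = k div 3 \<longleftrightarrow>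
    int l = n mod 2 \<and> 0 \<le> y_exponent n i' i \<and> j = nat (y_exponent n i' i) \<and> k = nat (t_exponent n i')"
    (is "?L \<longleftrightarrow> ?R")
proof
  have l: "l = 0 \<or> l = 1" using assms by auto
  show ?R if ?L
  proof -
    have n: "n = 6 * int i - 6 * int j + 2 * int k + 3 * int l" and i': "i' = k div 3"
      using that by auto
    define r where "r = k mod 3"
    have "k = 3 * i' + r" by (simp add: i' r_def)
    then have r: "int k = 3 * int i' + int r" "r < 3" by (simp_all add: r_def)
    have *: "n = 2 * (3 * int i - 3 * int j + int k + int l) + int l" by (simp add: n)
    have 2: "n div 2 = 3 * int i - 3 * int j + int k + int l" "n mod 2 = int l"
      by (rule int_div_pos_eq[OF *] int_mod_pos_eq[OF *]; use assms in simp)+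
    have "- n = 3 * (2 * int j - 2 * int i - int l - 2 * int i' - int r) + int r"
      by (simp add: n r(1))
    then have 3: "(- n) div 3 = 2 * int j - 2 * int i - int l - 2 * int i' - int r"
      using r(2) by (intro int_div_pos_eq[where r = "int r"]) auto
    have "y_exponent n i' i = int j" unfolding y_exponent_def 2 3 using r(1) by simp
    moreover have "t_exponent n i' = int k" unfolding t_exponent_def 3 using r(1) n by simp
    ultimately show ?R using 2 by simp
  qed
  show ?L if ?R
  proof -
    define c d where "c = n div 2" and "d = (- n) div 3"
    have d: "3 * d \<le> - n" "- n < 3 * d + 3" unfolding d_def by linarith+
    have "int l = n mod 2" "int j = int i' + int i - (c + d)"
      using that by (auto simp: y_exponent_def c_def d_def)
    moreover have k: "int k = 3 * int i' - 3 * d - n"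
      using that d by (simp add: t_exponent_def flip: d_def)
    moreover have "n = 2 * c + n mod 2" by (simp add: c_def)
    ultimately have "n = 6 * int i - 6 * int j + 2 * int k + 3 * int l" by linarith
    moreover have "i' = k div 3" using k d by linarith
    ultimately show ?L ..
  qed
qed

lemma coeff_monom3:
  "coeff (coeff (coeff (monom3 a i j k) k') j') i' = (if i = i' \<and> j = j' \<and> k = k' then a else 0)"
  by simp

lemma lookup_laurent_monom:
  assumes "l < 2"
  shows "\<exists>b. Poly_Mapping.lookup (laurent (monom q l)) n = degree_frame n * plane_fun b \<and>
    (\<forall>i j. coeff (coeff b j) i =
      (if int l = n mod 2 \<and> 0 \<le> y_exponent n i j
       then \<i> ^ l * coeff (coeff (coeff q (nat (t_exponent n i))) (nat (y_exponent n i j))) j else 0))"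
proof (induction q rule: monom3_induct)
  case (add p q)
  from add(1) obtain b where b:
    "Poly_Mapping.lookup (laurent (monom p l)) n = degree_frame n * plane_fun b"
    "\<forall>i j. coeff (coeff b j) i = (if int l = n mod 2 \<and> 0 \<le> y_exponent n i j
       then \<i> ^ l * coeff (coeff (coeff p (nat (t_exponent n i))) (nat (y_exponent n i j))) j else 0)"
    by (elim exE conjE)
  from add(2) obtain c where c:
    "Poly_Mapping.lookup (laurent (monom q l)) n = degree_frame n * plane_fun c"
    "\<forall>i j. coeff (coeff c j) i = (if int l = n mod 2 \<and> 0 \<le> y_exponent n i j
       then \<i> ^ l * coeff (coeff (coeff q (nat (t_exponent n i))) (nat (y_exponent n i j))) j else 0)"
    by (elim exE conjE)
  have "Poly_Mapping.lookup (laurent (monom (p + q) l)) n = degree_frame n * plane_fun (b + c)"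
    by (simp add: laurent.add lookup_add plane_fun.add distrib_left b(1) c(1) flip: add_monom)
  then show ?case
    by (intro exI[of _ "b + c"] conjI) (simp_all add: b(2) c(2) distrib_left)
next
  case (monom a i j k)
  define d where "d = 6 * int i - 6 * int j + 2 * int k + 3 * int l"
  have "Poly_Mapping.lookup (laurent (monom (monom3 a i j k) l)) n =
      degree_frame n * plane_fun (if n = d then monom (monom (a * \<i> ^ l) (k div 3)) i else 0)"
    unfolding laurent_monom[OF assms] d_def by (simp add: lookup_single plane_fun.zero when_def)
  moreover have "coeff (coeff (if n = d then monom (monom (a * \<i> ^ l) (k div 3)) i else 0) j') i' =
      (if int l = n mod 2 \<and> 0 \<le> y_exponent n i' j' then \<i> ^ l *
        coeff (coeff (coeff (monom3 a i j k) (nat (t_exponent n i'))) (nat (y_exponent n i' j'))) j' else 0)"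
    for i' j'
  proof -
    define C y t where "C \<longleftrightarrow> int l = n mod 2 \<and> 0 \<le> y_exponent n i' j'"
      and "y = nat (y_exponent n i' j')" and "t = nat (t_exponent n i')"
    have iff: "n = d \<and> i' = k div 3 \<and> i = j' \<longleftrightarrow> C \<and> i = j' \<and> j = y \<and> k = t"
      using exponents_iff[OF assms, of n i j k i'] unfolding C_def y_def t_def d_def by metis
    have "coeff (coeff (if n = d then monom (monom (a * \<i> ^ l) (k div 3)) i else 0) j') i' =
        (if n = d \<and> i' = k div 3 \<and> i = j' then a * \<i> ^ l else 0)"
      by (cases "n = d"; cases "i = j'"; cases "i' = k div 3") simp_all
    also have "\<dots> = (if C then \<i> ^ l * coeff (coeff (coeff (monom3 a i j k) t) y) j' else 0)"
      unfolding iff coeff_monom3 by (cases C) simp_all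
    finally show ?thesis unfolding C_def y_def t_def .
  qed
  ultimately show ?case by blast
qed

lemma lookup_laurent_linear:
  "\<exists>b. Poly_Mapping.lookup (laurent [:p, q:]) n = degree_frame n * plane_fun b \<and>
    (\<forall>i j. coeff (coeff b j) i =
      (if 0 \<le> y_exponent n i j then \<i> ^ nat (n mod 2) * coeff (coeff (coeff (if even n then p else q)
         (nat (t_exponent n i))) (nat (y_exponent n i j))) j else 0))"
proof -
  have split: "[:p, q:] = monom p 0 + monom q 1" by (simp add: monom_0 monom_Suc)
  have less: "(0::nat) < 2" "(1::nat) < 2" by simp_all
  obtain b where b: "Poly_Mapping.lookup (laurent (monom p 0)) n = degree_frame n * plane_fun b"
    "\<forall>i j. coeff (coeff b j) i = (if int 0 = n mod 2 \<and> 0 \<le> y_exponent n i j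
       then \<i> ^ 0 * coeff (coeff (coeff p (nat (t_exponent n i))) (nat (y_exponent n i j))) j else 0)"
    using lookup_laurent_monom[OF less(1), of p n] by (elim exE conjE)
  obtain c where c: "Poly_Mapping.lookup (laurent (monom q 1)) n = degree_frame n * plane_fun c"
    "\<forall>i j. coeff (coeff c j) i = (if int 1 = n mod 2 \<and> 0 \<le> y_exponent n i j
       then \<i> ^ 1 * coeff (coeff (coeff q (nat (t_exponent n i))) (nat (y_exponent n i j))) j else 0)"
    using lookup_laurent_monom[OF less(2), of q n] by (elim exE conjE)
  have "Poly_Mapping.lookup (laurent [:p, q:]) n = degree_frame n * plane_fun (b + c)"
    unfolding split laurent.add lookup_add b(1) c(1) plane_fun.add distrib_left ..
  moreover have "coeff (coeff (b + c) j) i =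
      (if 0 \<le> y_exponent n i j then \<i> ^ nat (n mod 2) * coeff (coeff (coeff (if even n then p else q)
         (nat (t_exponent n i))) (nat (y_exponent n i j))) j else 0)" for i j
  proof (cases "even n")
    case True
    then have "n mod 2 = 0" by presburger
    then show ?thesis
      unfolding coeff_add b(2)[rule_format] c(2)[rule_format] if_P[OF True] by simp
  next
    case False
    then have "n mod 2 = 1" by presburger
    then show ?thesis
      unfolding coeff_add b(2)[rule_format] c(2)[rule_format] if_not_P[OF False] by simp
  qed
  ultimately show ?thesis by (intro exI[of _ "b + c"] conjI allI)
qed

text \<open>
  Different monomials with exponent of \<open>z\<close> less than 2 contribute to different coefficients of the image.
\<close>

lemma laurent_linear_eq_0:
  assumes "laurent [:p, q:] = 0"
  shows "p = 0 \<and> q = 0"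
proof -
  have "coeff (coeff (coeff (if l = 0 then p else q) k) j) i = 0" if "l < 2" for i j k l :: nat
  proof -
    define n where "n = 6 * int i - 6 * int j + 2 * int k + 3 * int l"
    have *: "int l = n mod 2" "0 \<le> y_exponent n (k div 3) i" "nat (y_exponent n (k div 3) i) = j"
      "nat (t_exponent n (k div 3)) = k"
      using exponents_iff[OF that, of n i j k "k div 3"] by (auto simp: n_def)
    have ev: "even n \<longleftrightarrow> l = 0" using *(1) that by presburger
    obtain b where b: "Poly_Mapping.lookup (laurent [:p, q:]) n = degree_frame n * plane_fun b"
      "\<forall>i j. coeff (coeff b j) i = (if 0 \<le> y_exponent n i j
       then \<i> ^ nat (n mod 2) * coeff (coeff (coeff (if even n then p else q)
         (nat (t_exponent n i))) (nat (y_exponent n i j))) j else 0)"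
      using lookup_laurent_linear[of p q n] by (elim exE conjE)
    have bk: "coeff (coeff b i) (k div 3) = (if 0 \<le> y_exponent n (k div 3) i then \<i> ^ nat (n mod 2) *
        coeff (coeff (coeff (if even n then p else q)
         (nat (t_exponent n (k div 3)))) (nat (y_exponent n (k div 3) i))) i else 0)"
      by (rule b(2)[rule_format])
    have "b = 0" using b(1) assms by simp
    then have "\<i> ^ nat (n mod 2) * coeff (coeff (coeff (if even n then p else q) k) j) i = 0"
      using bk unfolding *(3,4) if_P[OF *(2)] by simp
    then show ?thesis unfolding ev by simp
  qed
  from this[of 0] this[of 1] have "coeff (coeff (coeff p k) j) i = 0" "coeff (coeff (coeff q k) j) i = 0"
    for i j k by simp_all
  then show ?thesis by (simp add: poly_eq_iff)
qed

lemma laurent_eq_0_iff: "laurent p = 0 \<longleftrightarrow> russell_poly dvd p"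
proof
  obtain q a b where p: "p = russell_poly * q + [:a, b:]" using divide_by_russell_poly by blast
  assume "laurent p = 0"
  then have "laurent [:a, b:] = 0" by (simp add: p laurent.add laurent.mult laurent_russell_poly)
  then have "a = 0 \<and> b = 0" by (rule laurent_linear_eq_0)
  then show "russell_poly dvd p" by (simp add: p)
qed (auto simp: dvd_def laurent.mult laurent_russell_poly)

lemma lookup_laurent_in_homogeneous_part: "Poly_Mapping.lookup (laurent p) n \<in> homogeneous_part n"
proof -
  obtain q a c where p: "p = russell_poly * q + [:a, c:]" using divide_by_russell_poly by blast
  then have lp: "laurent p = laurent [:a, c:]"
    by (simp add: laurent.add laurent.mult laurent_russell_poly)
  obtain b where b: "Poly_Mapping.lookup (laurent p) n = degree_frame n * plane_fun b"
    and bc: "\<forall>i j. coeff (coeff b j) i = (if 0 \<le> y_exponent n i j then \<i> ^ nat (n mod 2) *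
      coeff (coeff (coeff (if even n then a else c)
         (nat (t_exponent n i))) (nat (y_exponent n i j))) j else 0)"
    using lookup_laurent_linear[of a c n] unfolding lp by (elim exE conjE)
  have "\<forall>i j. coeff (coeff b j) i \<noteq> 0 \<longrightarrow> 0 \<le> y_exponent n i j"
    unfolding bc[rule_format] by presburger
  then show ?thesis
    unfolding homogeneous_part_def b y_exponent_def by (intro CollectI exI[of _ b]) auto
qed

lemma poly_mapping_sum_single: "F = (\<Sum>n\<in>Poly_Mapping.keys F. Poly_Mapping.single n (Poly_Mapping.lookup F n))"
proof (rule poly_mapping_eqI)
  fix k
  have "(\<Sum>n\<in>Poly_Mapping.keys F. Poly_Mapping.lookup F n when n = k) = Poly_Mapping.lookup F k"
    by (cases "k \<in> Poly_Mapping.keys F") (auto simp: when_def in_keys_iff)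
  then show "Poly_Mapping.lookup F k = Poly_Mapping.lookup
      (\<Sum>n\<in>Poly_Mapping.keys F. Poly_Mapping.single n (Poly_Mapping.lookup F n)) k"
    by (simp add: lookup_sum lookup_single)
qed

lemma sum_in_range_laurent:
  "(\<And>a. a \<in> A \<Longrightarrow> f a \<in> range laurent) \<Longrightarrow> sum f A \<in> range laurent"
proof (induction A rule: infinite_finite_induct)
  case (insert a A)
  then obtain p q where "f a = laurent p" "sum f A = laurent q" by blast
  with insert show ?case by (auto simp flip: laurent.add)
qed (auto intro: range_eqI[of _ _ 0] simp: laurent.zero)

text \<open>
  Each term \<open>f\<^sub>n u\<^sup>i v\<^sup>j\<close> of the section is the image of the monomial with the exponents computed
  above, up to a power of \<open>\<i>\<close>.
\<close>

lemma single_in_range_laurent: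
  assumes "f \<in> homogeneous_part n"
  shows "Poly_Mapping.single n f \<in> range laurent"
proof -
  obtain b where f: "f = degree_frame n * plane_fun b"
    and b: "\<And>i j. coeff (coeff b j) i \<noteq> 0 \<Longrightarrow> n div 2 + (- n) div 3 \<le> int i + int j"
    using assms by (auto simp: homogeneous_part_def)
  define g where "g b = Poly_Mapping.single n (degree_frame n * plane_fun b)" for b
  have g_sum: "g (sum h A) = (\<Sum>a\<in>A. g (h a))" for h and A :: "nat set"
    using sum_comp_morphism[of g h A]
    by (simp add: g_def plane_fun.hom distrib_left single_add comp_def)
  have monom: "g (monom (monom c i) j) \<in> range laurent"
    if "c \<noteq> 0 \<Longrightarrow> 0 \<le> y_exponent n i j" for c i j
  proof (cases "c = 0")
    case True
    then show ?thesis by (auto simp: g_def plane_fun.zero intro: range_eqI[of _ _ 0] simp: laurent.zero)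
  next
    case False
    define l where "l = nat (n mod 2)"
    have l: "l < 2" unfolding l_def by linarith
    define y t where "y = nat (y_exponent n i j)" and "t = nat (t_exponent n i)"
    have "n = 6 * int j - 6 * int y + 2 * int t + 3 * int l \<and> i = t div 3"
      using exponents_iff[OF l, of n j y t i] that[OF False] by (simp add: y_def t_def l_def)
    then have "laurent (monom (monom3 (c / \<i> ^ l) j y t) l) = g (monom (monom c i) j)"
      unfolding laurent_monom[OF l] g_def by simp
    then show ?thesis by (metis rangeI)
  qed
  have "b = (\<Sum>j\<le>degree b. \<Sum>i\<le>degree (coeff b j). monom (monom (coeff (coeff b j) i) i) j)"
  proof -
    have "monom q j = (\<Sum>i\<le>degree q. monom (monom (coeff q i) i) j)" for q :: "complex poly" and j
      by (intro poly_eqI) (auto simp: coeff_sum coeff_eq_0)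
    then have "(\<Sum>j\<le>degree b. monom (coeff b j) j) =
        (\<Sum>j\<le>degree b. \<Sum>i\<le>degree (coeff b j). monom (monom (coeff (coeff b j) i) i) j)"
      by (intro sum.cong refl)
    then show ?thesis unfolding poly_as_sum_of_monoms .
  qed
  then have "g b = (\<Sum>j\<le>degree b. \<Sum>i\<le>degree (coeff b j). g (monom (monom (coeff (coeff b j) i) i) j))"
    unfolding g_sum[symmetric] by (rule arg_cong)
  also have "\<dots> \<in> range laurent"
    by (intro sum_in_range_laurent monom) (use b in \<open>auto simp: y_exponent_def\<close>)
  finally show ?thesis by (simp add: f g_def)
qed

lemma range_laurent: "range laurent = section_algebra blowup_plane russell_divisor"
proof (intro equalityI subsetI)
  fix F assume "F \<in> section_algebra blowup_plane russell_divisor"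
  then have "Poly_Mapping.lookup F n \<in> homogeneous_part n" for n
    by (simp add: section_algebra_def sections_russell)
  then have "(\<Sum>n\<in>Poly_Mapping.keys F. Poly_Mapping.single n (Poly_Mapping.lookup F n)) \<in> range laurent"
    by (intro sum_in_range_laurent single_in_range_laurent)
  then show "F \<in> range laurent" by (simp flip: poly_mapping_sum_single)
qed (auto simp: section_algebra_def sections_russell lookup_laurent_in_homogeneous_part)

section \<open>The torus action\<close>

lemma lookup_grading_scale:
  "Poly_Mapping.lookup (grading_scale plane_const l F) n = plane_const (l powi n) * Poly_Mapping.lookup F n"
  by (auto simp: grading_scale_def lookup_mapp when_def in_keys_iff)

lemma grading_scale_single:
  "grading_scale plane_const l (Poly_Mapping.single n a) = Poly_Mapping.single n (plane_const (l powi n) * a)"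
  by (rule poly_mapping_eqI) (simp add: lookup_grading_scale lookup_single when_def)

text \<open>
  Multiplicativity is checked on homogeneous elements, where it is \<open>l\<^sup>n\<^sup>+\<^sup>m = l\<^sup>n l\<^sup>m\<close>.
\<close>

lemma ring_morphism_grading_scale:
  assumes "l \<noteq> 0"
  shows "ring_morphism (grading_scale plane_const l)"
proof -
  let ?g = "grading_scale plane_const l"
  have add: "?g (F + G) = ?g F + ?g G" for F G
    by (rule poly_mapping_eqI) (simp add: lookup_grading_scale lookup_add distrib_left)
  have zero: "?g 0 = 0" by (rule poly_mapping_eqI) (simp add: lookup_grading_scale)
  have sum: "?g (sum f A) = (\<Sum>a\<in>A. ?g (f a))" for f and A :: "int set"
    by (induction A rule: infinite_finite_induct) (simp_all add: zero add)
  have single: "?g (Poly_Mapping.single n a * Poly_Mapping.single m b) =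
      ?g (Poly_Mapping.single n a) * ?g (Poly_Mapping.single m b)" for n m a b
    by (simp add: grading_scale_single mult_single power_int_add assms plane_const.mult mult_ac)
  have mult: "?g (F * G) = ?g F * ?g G" for F G
  proof -
    define f g where "f n = Poly_Mapping.single n (Poly_Mapping.lookup F n)"
      and "g n = Poly_Mapping.single n (Poly_Mapping.lookup G n)" for n
    have FG: "F = sum f (Poly_Mapping.keys F)" "G = sum g (Poly_Mapping.keys G)"
      unfolding f_def g_def by (rule poly_mapping_sum_single)+
    have "F * G = (\<Sum>n\<in>Poly_Mapping.keys F. \<Sum>m\<in>Poly_Mapping.keys G. f n * g m)"
      unfolding sum_product[symmetric] by (rule arg_cong2[OF FG])
    then have "?g (F * G) = (\<Sum>n\<in>Poly_Mapping.keys F. \<Sum>m\<in>Poly_Mapping.keys G. ?g (f n) * ?g (g m))"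
      by (simp add: sum f_def g_def single)
    also have "\<dots> = ?g (sum f (Poly_Mapping.keys F)) * ?g (sum g (Poly_Mapping.keys G))"
      by (simp add: sum sum_product)
    also have "\<dots> = ?g F * ?g G" by (simp only: FG[symmetric])
    finally show ?thesis .
  qed
  have "?g 1 = 1"
    unfolding single_one[symmetric] grading_scale_single by (simp add: plane_const.one)
  with add mult show ?thesis by unfold_locales auto
qed

definition scale_coords :: "complex \<Rightarrow> space_poly \<Rightarrow> space_poly" where
  "scale_coords l = eval4 const_space (const_space (l powi 6) * x_coord) (const_space (l powi (-6)) * y_coord)
    (const_space (l powi 3) * z_coord) (const_space (l powi 2) * t_coord)"

lemma ring_morphism_scale_coords: "ring_morphism (scale_coords l)"
  unfolding scale_coords_def by (intro ring_morphism_eval4 ring_morphism_const_space)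

lemma scale_coords_simps:
  "scale_coords l (const_space c) = const_space c"
  "scale_coords l x_coord = const_space (l powi 6) * x_coord"
  "scale_coords l y_coord = const_space (l powi (-6)) * y_coord"
  "scale_coords l z_coord = const_space (l powi 3) * z_coord"
  "scale_coords l t_coord = const_space (l powi 2) * t_coord"
  unfolding scale_coords_def by (simp_all only: eval4_simps[OF ring_morphism_const_space])

lemma grading_scale_laurent:
  assumes "l \<noteq> 0"
  shows "grading_scale plane_const l (laurent p) = laurent (scale_coords l p)"
  by (rule ring_morphism_space_unique[OF
        ring_morphism_comp[OF ring_morphism_grading_scale[OF assms] laurent.ring_morphism_axioms]
        ring_morphism_comp[OF laurent.ring_morphism_axioms ring_morphism_scale_coords]])
    (simp_all only: scale_coords_simps laurent.mult laurent_simps grading_scale_single mult_single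
      add_0 power_int_0_right plane_const.one mult_1)

lemma eval_at_scale_coords:
  "eval_at pt (scale_coords l p) = eval_at (cv_act russell_cubic l pt) p"
  by (rule ring_morphism_space_unique[OF
        ring_morphism_comp[OF ring_morphism_eval_at ring_morphism_scale_coords] ring_morphism_eval_at];
      cases pt)
    (simp_all only: scale_coords_simps eval_at.mult eval_at_simps russell_cubic_def
      cstar_variety.simps prod.case)

section \<open>The isomorphism\<close>

definition regular :: "space_poly \<Rightarrow> point4 \<Rightarrow> complex" where
  "regular p = (\<lambda>pt\<in>russell_cubic_points. eval_at pt p)"

lemma regular_apply: "pt \<in> russell_cubic_points \<Longrightarrow> regular p pt = eval_at pt p"
  by (simp add: regular_def)

text \<open>
  Both sides say that the equation of the cubic divides \<open>p - q\<close>.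
\<close>

lemma regular_eq_iff: "regular p = regular q \<longleftrightarrow> laurent p = laurent q"
proof -
  have "regular p = regular q \<longleftrightarrow> (\<forall>pt\<in>russell_cubic_points. eval_at pt (p - q) = 0)"
  proof
    assume eq: "regular p = regular q"
    show "\<forall>pt\<in>russell_cubic_points. eval_at pt (p - q) = 0"
    proof
      fix pt assume "pt \<in> russell_cubic_points"
      then show "eval_at pt (p - q) = 0"
        using arg_cong[OF eq, of "\<lambda>f. f pt"] by (simp add: eval_at.diff regular_apply)
    qed
  qed (auto simp: regular_def eval_at.diff intro!: restrict_ext)
  also have "\<dots> \<longleftrightarrow> laurent (p - q) = 0"
    by (simp only: vanishing_on_cubic_iff laurent_eq_0_iff)
  finally show ?thesis by (simp add: laurent.diff)
qed

lemma carrier_regular_function_ring: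
  "carrier (regular_function_ring russell_cubic_points) = range regular"
  unfolding regular_function_ring_def polynomial_functions4_eq regular_def by auto

text \<open>
  By the previous lemma, the regular function does not depend on the chosen polynomial.
\<close>

definition comorphism :: "(int \<Rightarrow>\<^sub>0 plane_field) \<Rightarrow> point4 \<Rightarrow> complex" where
  "comorphism F = regular (SOME p. laurent p = F)"

lemma comorphism_laurent: "comorphism (laurent p) = regular p"
  unfolding comorphism_def regular_eq_iff by (rule someI_ex) blast

definition point_map :: "point4 \<Rightarrow> (int \<Rightarrow>\<^sub>0 plane_field) \<Rightarrow> complex" where
  "point_map pt = (\<lambda>F\<in>range laurent. comorphism F pt)"

lemma point_map_laurent:
  "pt \<in> russell_cubic_points \<Longrightarrow> point_map pt (laurent p) = eval_at pt p"
  by (simp add: point_map_def comorphism_laurent regular_apply)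

lemma comorphism_ring_iso:
  "comorphism \<in> ring_iso (subring_record (range laurent)) (regular_function_ring russell_cubic_points)"
proof -
  have "comorphism \<in> ring_hom (subring_record (range laurent)) (regular_function_ring russell_cubic_points)"
  proof (rule ring_hom_memI)
    fix F assume "F \<in> carrier (subring_record (range laurent))"
    then obtain p where F: "F = laurent p" by (auto simp: subring_record_def)
    then show "comorphism F \<in> carrier (regular_function_ring russell_cubic_points)"
      by (simp add: carrier_regular_function_ring comorphism_laurent)
    fix G assume "G \<in> carrier (subring_record (range laurent))"
    then obtain q where G: "G = laurent q" by (auto simp: subring_record_def)
    show "comorphism (F \<otimes>\<^bsub>subring_record (range laurent)\<^esub> G) =
        comorphism F \<otimes>\<^bsub>regular_function_ring russell_cubic_points\<^esub> comorphism G"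
      by (auto simp: F G subring_record_def regular_function_ring_def comorphism_laurent
          eval_at.mult regular_def intro!: restrict_ext simp flip: laurent.mult)
    show "comorphism (F \<oplus>\<^bsub>subring_record (range laurent)\<^esub> G) =
        comorphism F \<oplus>\<^bsub>regular_function_ring russell_cubic_points\<^esub> comorphism G"
      by (auto simp: F G subring_record_def regular_function_ring_def comorphism_laurent
          eval_at.add regular_def intro!: restrict_ext simp flip: laurent.add)
  next
    show "comorphism \<one>\<^bsub>subring_record (range laurent)\<^esub> = \<one>\<^bsub>regular_function_ring russell_cubic_points\<^esub>"
      by (auto simp: subring_record_def regular_function_ring_def comorphism_laurent
          eval_at.one regular_def intro!: restrict_ext simp flip: laurent.one)
  qed
  moreover have "bij_betw comorphism (range laurent) (range regular)"
    unfolding bij_betw_def inj_on_def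
    by (auto simp: comorphism_laurent regular_eq_iff image_image)
  ultimately show ?thesis
    by (simp add: ring_iso_def carrier_regular_function_ring subring_record_def)
qed

text \<open>
  Since \<open>G\<close> is sent to 0 and the grading action is linear, the scaled equation is again a multiple of
  \<open>G\<close>.
\<close>

lemma act_on_cubic:
  assumes "l \<noteq> 0" "pt \<in> russell_cubic_points"
  shows "cv_act russell_cubic l pt \<in> russell_cubic_points"
proof -
  have "laurent (scale_coords l russell_poly) = 0"
    unfolding grading_scale_laurent[OF assms(1), symmetric] laurent_russell_poly
    by (rule ring_morphism.zero[OF ring_morphism_grading_scale[OF assms(1)]])
  then have "eval_at pt (scale_coords l russell_poly) = 0"
    using assms(2) by (simp add: laurent_eq_0_iff flip: vanishing_on_cubic_iff)
  then show ?thesis by (simp add: eval_at_scale_coords eval_at_russell_poly)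
qed

text \<open>
  A homomorphism from the section algebra to \<open>\<complex>\<close> is determined by the images of the four
  generators, and these satisfy the equation of the cubic because the generators do.
\<close>

lemma bij_betw_point_map:
  "bij_betw point_map russell_cubic_points
    {\<chi> \<in> ring_hom (subring_record (range laurent)) (subring_record UNIV).
      \<chi> \<in> extensional (range laurent) \<and> (\<forall>c. \<chi> (Poly_Mapping.single 0 (plane_const c)) = c)}"
    (is "bij_betw _ _ ?P")
proof (rule bij_betw_imageI)
  have coords: "pt = (point_map pt (laurent x_coord), point_map pt (laurent y_coord),
      point_map pt (laurent z_coord), point_map pt (laurent t_coord))"
    if "pt \<in> russell_cubic_points" for pt
    using that by (cases pt) (simp add: point_map_laurent eval_at_simps)
  show "inj_on point_map russell_cubic_points"
    by (rule inj_onI) (metis coords)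
  show "point_map ` russell_cubic_points = ?P"
  proof (intro equalityI subsetI)
    fix \<chi> assume "\<chi> \<in> point_map ` russell_cubic_points"
    then obtain pt where pt: "pt \<in> russell_cubic_points" and \<chi>: "\<chi> = point_map pt" by blast
    note map = point_map_laurent[OF pt]
    have "point_map pt \<in> ring_hom (subring_record (range laurent)) (subring_record UNIV)"
    proof (rule ring_hom_memI)
      fix F G assume "F \<in> carrier (subring_record (range laurent))"
        "G \<in> carrier (subring_record (range laurent))"
      then obtain p q where "F = laurent p" "G = laurent q" by (auto simp: subring_record_def)
      then show "point_map pt (F \<otimes>\<^bsub>subring_record (range laurent)\<^esub> G) =
          point_map pt F \<otimes>\<^bsub>subring_record UNIV\<^esub> point_map pt G"
        "point_map pt (F \<oplus>\<^bsub>subring_record (range laurent)\<^esub> G) =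
          point_map pt F \<oplus>\<^bsub>subring_record UNIV\<^esub> point_map pt G"
        by (simp_all add: subring_record_def map eval_at.hom flip: laurent.mult laurent.add)
    qed (simp_all add: subring_record_def map eval_at.one flip: laurent.one)
    moreover have "point_map pt (Poly_Mapping.single 0 (plane_const c)) = c" for c
      using map[of "const_space c"] by (cases pt) (simp add: laurent_simps eval_at_simps)
    ultimately show "\<chi> \<in> ?P" by (simp add: \<chi> point_map_def)
  next
    fix \<chi> assume \<chi>: "\<chi> \<in> ?P"
    define pt where "pt = (\<chi> (laurent x_coord), \<chi> (laurent y_coord), \<chi> (laurent z_coord), \<chi> (laurent t_coord))"
    have hom: "\<chi> \<in> ring_hom (subring_record (range laurent)) (subring_record UNIV)"
      and const: "\<chi> (Poly_Mapping.single 0 (plane_const c)) = c" for c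
      using \<chi> by auto
    have morphism: "ring_morphism (\<lambda>p. \<chi> (laurent p))"
      using ring_hom_add[OF hom, of "laurent _" "laurent _"] ring_hom_mult[OF hom, of "laurent _" "laurent _"]
        ring_hom_one[OF hom]
      by unfold_locales (simp_all add: subring_record_def laurent.hom)
    have eval: "\<chi> (laurent p) = eval_at pt p" for p
      by (rule ring_morphism_space_unique[OF morphism ring_morphism_eval_at])
        (simp_all add: pt_def eval_at_simps laurent_simps(1) const)
    have "eval_at pt russell_poly = \<chi> (laurent 0)"
      by (simp add: eval[symmetric] laurent_russell_poly laurent.zero)
    also have "\<dots> = 0" by (rule ring_morphism.zero[OF morphism])
    finally have pt: "pt \<in> russell_cubic_points" by (simp add: eval_at_russell_poly)
    have "\<chi> = point_map pt"
    proof (rule extensionalityI)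
      show "\<chi> \<in> extensional (range laurent)" "point_map pt \<in> extensional (range laurent)"
        using \<chi> by (auto simp: point_map_def)
    qed (use eval point_map_laurent[OF pt] in auto)
    then show "\<chi> \<in> point_map ` russell_cubic_points" using pt by blast
  qed
qed

lemma russell_cubic_isomorphic:
  "cstar_isomorphic russell_cubic (polyhedral_Spec plane_const blowup_plane russell_divisor)"
proof -
  let ?Y = "polyhedral_Spec plane_const blowup_plane russell_divisor"
  note Y = polyhedral_Spec_def graded_Spec_def range_laurent[symmetric]
  have "bij_betw point_map (cv_points russell_cubic) (cv_points ?Y)"
    using bij_betw_point_map by (simp add: Y russell_cubic_def)
  moreover have "comorphism \<in> ring_iso (cv_ring ?Y) (cv_ring russell_cubic)"
    using comorphism_ring_iso by (simp add: Y russell_cubic_def)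
  moreover have "comorphism (cv_const ?Y c) = cv_const russell_cubic c" for c
    using comorphism_laurent[of "const_space c"]
    by (auto simp: Y russell_cubic_def laurent_simps regular_def eval_at_simps intro!: restrict_ext)
  moreover have "cv_eval russell_cubic (comorphism F) pt = cv_eval ?Y F (point_map pt)"
    if "pt \<in> cv_points russell_cubic" "F \<in> carrier (cv_ring ?Y)" for pt F
    using that by (simp add: Y russell_cubic_def subring_record_def point_map_def)
  moreover have "point_map (cv_act russell_cubic l pt) = cv_act ?Y l (point_map pt)"
    if "l \<noteq> 0" "pt \<in> cv_points russell_cubic" for l pt
  proof -
    have pt: "pt \<in> russell_cubic_points" using that by (simp add: russell_cubic_def)
    have "point_map (cv_act russell_cubic l pt) (laurent p) =
        point_map pt (grading_scale plane_const l (laurent p))" for p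
      using that(1) pt
      by (simp add: point_map_laurent act_on_cubic grading_scale_laurent eval_at_scale_coords)
    then have "point_map (cv_act russell_cubic l pt) =
        (\<lambda>F\<in>range laurent. point_map pt (grading_scale plane_const l F))"
      by (intro extensionalityI[of _ "range laurent"]) (auto simp: point_map_def)
    then show ?thesis by (simp add: Y)
  qed
  ultimately show ?thesis unfolding cstar_isomorphic_def by blast
qed

theorem proposition3p2:
  defines "E \<equiv> exceptional_divisor"
    and "D2 \<equiv> strict_transform u_coord"
    and "D3 \<equiv> strict_transform (u_coord + v_coord + v_coord ^ 2)"
  shows "cstar_isomorphic russell_cubic
    (polyhedral_Spec plane_const blowup_plane
      [({1/2}, D3), ({-1/3}, D2), ({0..1/6}, E)])"
  unfolding E_def D2_def D3_def exceptional_divisor_eq strict_transform_u strict_transform_curve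
  using russell_cubic_isomorphic unfolding russell_divisor_def .

end
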